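(* Let $I\subset\mathbb{R}$ be an interval containing $0$ and let $\varphi\in W^{1,2}(\mathbb{R}^3)$. Then the frictional Newton-Schrödinger problem $$i\frac{\partial\psi}{\partial t}=-\frac{\hbar}{2m}\Delta\psi+i\,4\pi\frac{Gm^2}{\hbar}\,g_1(\psi)-i\,4\pi\frac{Gm^2}{\hbar}\,g_2(\psi),\qquad \psi(0)=\varphi,$$ has at most one weak solution in $L^\infty(I,W^{1,2})$.
   Context: $W^{1,2}=W^{1,2}(\mathbb{R}^3)$ is the Sobolev space of complex-valued functions with $\|\psi\|_{W^{1,2}}^2=\int|\nabla\psi|^2\,dx+\int|\psi|^2\,dx$, and $W^{-1,2}$ is its dual. The constants $\hbar,m,G$ are positive. For $\psi\in W^{1,2}$, $$g_1(\psi)=\psi\int_{\mathbb{R}^3}\frac{|\psi(y)|^2}{|\cdot-y|}\,dy,\qquad g_2(\psi)=\psi\int_{\mathbb{R}^3}\int_{\mathbb{R}^3}\frac{|\psi(y)|^2|\psi(z)|^2}{|z-y|}\,dy\,dz,$$ both regarded as elements of $W^{-1,2}$. A weak solution on an interval $I\ni 0$ is a function $\psi\in L^\infty(I,W^{1,2})\cap W^{1,\infty}(I,W^{-1,2})$ that satisfies the equation in $W^{-1,2}$ for a.e. $t\in I$ and $\psi(0)=\varphi$ (this makes sense because such $\psi$ lies in $C(I,L^2(\mathbb{R}^3))$). *)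

theory Defs
  imports "HOL-Analysis.Analysis" "HOL-Library.Function_Algebras"
begin

text \<open>
  Elements of function spaces are represented by functions, equality in the space being
  equality almost everywhere; elements of a dual space are functionals, equality being
  agreement on the underlying space. A vector-valued space is therefore passed to the generic
  definitions below as a carrier set \<open>V\<close> together with its (semi)norm \<open>N\<close>. The pointwise
  vector space structure on functions makes the library's simple Bochner integral available.
\<close>

instantiation "fun" :: (type, real_vector) real_vector
begin

definition scaleR_fun :: "real \<Rightarrow> ('a \<Rightarrow> 'b) \<Rightarrow> 'a \<Rightarrow> 'b"
  where "scaleR_fun c f = (\<lambda>x. c *\<^sub>R f x)"

instance
  by standard (auto simp: scaleR_fun_def fun_eq_iff scaleR_add_right scaleR_add_left)

end

section \<open>Test functions\<close>

definition smooth :: "('a::euclidean_space \<Rightarrow> 'b::real_normed_vector) \<Rightarrow> bool"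
  where "smooth f \<longleftrightarrow>
    (\<forall>bs. set bs \<subseteq> Basis \<longrightarrow>
      foldr (\<lambda>b g x. frechet_derivative g (at x) b) bs f differentiable_on UNIV)"

definition test_functions :: "'a::euclidean_space set \<Rightarrow> ('a \<Rightarrow> real) set"
  where "test_functions U =
    {\<theta>. smooth \<theta> \<and> compact (closure {x. \<theta> x \<noteq> 0}) \<and> closure {x. \<theta> x \<noteq> 0} \<subseteq> U}"

section \<open>The Sobolev space $W^{1,2}$ and its dual\<close>

definition L2 :: "(real^3 \<Rightarrow> 'b::euclidean_space) set"
  where "L2 = {f. f \<in> borel_measurable lebesgue \<and> integrable lebesgue (\<lambda>x. (norm (f x))\<^sup>2)}"

definition L2_norm :: "(real^3 \<Rightarrow> 'b::euclidean_space) \<Rightarrow> real"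
  where "L2_norm f = sqrt (integral\<^sup>L lebesgue (\<lambda>x. (norm (f x))\<^sup>2))"

definition has_weak_gradient :: "(real^3 \<Rightarrow> complex) \<Rightarrow> (real^3 \<Rightarrow> complex^3) \<Rightarrow> bool"
  where "has_weak_gradient u g \<longleftrightarrow>
    (\<forall>\<theta>\<in>test_functions UNIV. \<forall>j.
      integral\<^sup>L lebesgue (\<lambda>x. frechet_derivative \<theta> (at x) (axis j 1) *\<^sub>R u x) =
      - integral\<^sup>L lebesgue (\<lambda>x. \<theta> x *\<^sub>R (g x $ j)))"

definition W12 :: "(real^3 \<Rightarrow> complex) set"
  where "W12 = {u \<in> L2. \<exists>g\<in>L2. has_weak_gradient u g}"

text \<open>The weak gradient is unique up to null sets, so the choice is immaterial.\<close>

definition weak_gradient :: "(real^3 \<Rightarrow> complex) \<Rightarrow> real^3 \<Rightarrow> complex^3"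
  where "weak_gradient u = (SOME g. g \<in> L2 \<and> has_weak_gradient u g)"

definition W12_norm :: "(real^3 \<Rightarrow> complex) \<Rightarrow> real"
  where "W12_norm u =
    sqrt (integral\<^sup>L lebesgue (\<lambda>x. (norm (weak_gradient u x))\<^sup>2)
        + integral\<^sup>L lebesgue (\<lambda>x. (norm (u x))\<^sup>2))"

text \<open>
  The dual consists of the bounded complex-linear functionals; boundedness with respect to the
  seminorm makes them independent of representatives. Values outside \<open>W12\<close> carry no meaning.
\<close>

definition W12_dual :: "((real^3 \<Rightarrow> complex) \<Rightarrow> complex) set"
  where "W12_dual = {F.
    (\<forall>u\<in>W12. \<forall>v\<in>W12. F (\<lambda>x. u x + v x) = F u + F v) \<and>
    (\<forall>c. \<forall>u\<in>W12. F (\<lambda>x. c * u x) = c * F u) \<and>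
    (\<exists>C. \<forall>u\<in>W12. norm (F u) \<le> C * W12_norm u)}"

definition W12_dual_norm :: "((real^3 \<Rightarrow> complex) \<Rightarrow> complex) \<Rightarrow> real"
  where "W12_dual_norm F = (SUP v\<in>{v \<in> W12. W12_norm v \<le> 1}. norm (F v))"

text \<open>The embedding of functions into the dual uses the bilinear pairing (no conjugation), as
  for distributions; it is consistent with complex-linearity of the functionals.\<close>

definition embed :: "(real^3 \<Rightarrow> complex) \<Rightarrow> (real^3 \<Rightarrow> complex) \<Rightarrow> complex"
  where "embed f = (\<lambda>v. integral\<^sup>L lebesgue (\<lambda>x. f x * v x))"

definition laplacian :: "(real^3 \<Rightarrow> complex) \<Rightarrow> (real^3 \<Rightarrow> complex) \<Rightarrow> complex"
  where "laplacian u = (\<lambda>v.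
    - integral\<^sup>L lebesgue (\<lambda>x. \<Sum>j\<in>UNIV. weak_gradient u x $ j * weak_gradient v x $ j))"

section \<open>Vector-valued functions on an interval\<close>

definition strongly_measurable ::
    "real set \<Rightarrow> 'a set \<Rightarrow> ('a::real_vector \<Rightarrow> real) \<Rightarrow> (real \<Rightarrow> 'a) \<Rightarrow> bool"
  where "strongly_measurable I V N f \<longleftrightarrow>
    (AE t in lebesgue_on I. f t \<in> V) \<and>
    (\<exists>s. (\<forall>n. simple_function (lebesgue_on I) (s n) \<and> s n ` I \<subseteq> V) \<and>
         (AE t in lebesgue_on I. (\<lambda>n. N (f t - s n t)) \<longlonglongrightarrow> 0))"

text \<open>This is the definition of the library's \<open>has_bochner_integral\<close>, relativised to
  \<open>(V, N)\<close>.\<close>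

definition has_bochner_integral_in ::
    "real set \<Rightarrow> 'a set \<Rightarrow> ('a::real_vector \<Rightarrow> real) \<Rightarrow> (real \<Rightarrow> 'a) \<Rightarrow> 'a \<Rightarrow> bool"
  where "has_bochner_integral_in I V N f x \<longleftrightarrow>
    strongly_measurable I V N f \<and> x \<in> V \<and>
    (\<exists>s. (\<forall>n. Bochner_Integration.simple_bochner_integrable (lebesgue_on I) (s n) \<and> s n ` I \<subseteq> V) \<and>
         (\<lambda>n. \<integral>\<^sup>+t. ennreal (N (f t - s n t)) \<partial>lebesgue_on I) \<longlonglongrightarrow> 0 \<and>
         (\<lambda>n. N (Bochner_Integration.simple_bochner_integral (lebesgue_on I) (s n) - x)) \<longlonglongrightarrow> 0)"

definition Linfinity ::
    "real set \<Rightarrow> 'a set \<Rightarrow> ('a::real_vector \<Rightarrow> real) \<Rightarrow> (real \<Rightarrow> 'a) set"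
  where "Linfinity I V N =
    {f. strongly_measurable I V N f \<and> (\<exists>C. AE t in lebesgue_on I. N (f t) \<le> C)}"

definition has_weak_time_derivative ::
    "real set \<Rightarrow> 'a set \<Rightarrow> ('a::real_vector \<Rightarrow> real) \<Rightarrow> (real \<Rightarrow> 'a) \<Rightarrow> (real \<Rightarrow> 'a) \<Rightarrow> bool"
  where "has_weak_time_derivative I V N f f' \<longleftrightarrow>
    (\<forall>\<theta>\<in>test_functions (interior I). \<exists>x.
      has_bochner_integral_in I V N (\<lambda>t. deriv \<theta> t *\<^sub>R f t) x \<and>
      has_bochner_integral_in I V N (\<lambda>t. \<theta> t *\<^sub>R f' t) (- x))"

text \<open>\<open>has_W1infinity_derivative I V N f f'\<close>: $f$ lies in $W^{1,\infty}(I, V)$ and $f'$ is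
  its weak derivative.\<close>

definition has_W1infinity_derivative ::
    "real set \<Rightarrow> 'a set \<Rightarrow> ('a::real_vector \<Rightarrow> real) \<Rightarrow> (real \<Rightarrow> 'a) \<Rightarrow> (real \<Rightarrow> 'a) \<Rightarrow> bool"
  where "has_W1infinity_derivative I V N f f' \<longleftrightarrow>
    f \<in> Linfinity I V N \<and> f' \<in> Linfinity I V N \<and> has_weak_time_derivative I V N f f'"

definition continuous_L2 :: "real set \<Rightarrow> (real \<Rightarrow> real^3 \<Rightarrow> complex) \<Rightarrow> bool"
  where "continuous_L2 I f \<longleftrightarrow>
    (\<forall>t\<in>I. f t \<in> L2 \<and> ((\<lambda>s. L2_norm (f s - f t)) \<longlongrightarrow> 0) (at t within I))"

text \<open>The value at time $t$ of an almost everywhere defined \<open>\<psi>\<close> is that of its continuous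
  $L^2$-valued representative.\<close>

definition has_value_at ::
    "real set \<Rightarrow> (real \<Rightarrow> real^3 \<Rightarrow> complex) \<Rightarrow> real \<Rightarrow> (real^3 \<Rightarrow> complex) \<Rightarrow> bool"
  where "has_value_at I \<psi> t \<phi> \<longleftrightarrow>
    (\<exists>\<psi>c. continuous_L2 I \<psi>c \<and>
      (AE s in lebesgue_on I. AE x in lebesgue. \<psi>c s x = \<psi> s x) \<and>
      (AE x in lebesgue. \<psi>c t x = \<phi> x))"

section \<open>The frictional Newton--Schroedinger problem\<close>

definition g1 :: "(real^3 \<Rightarrow> complex) \<Rightarrow> real^3 \<Rightarrow> complex"
  where "g1 \<psi> = (\<lambda>x. \<psi> x *
    complex_of_real (integral\<^sup>L lebesgue (\<lambda>y. (norm (\<psi> y))\<^sup>2 / norm (x - y))))"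

definition g2 :: "(real^3 \<Rightarrow> complex) \<Rightarrow> real^3 \<Rightarrow> complex"
  where "g2 \<psi> = (\<lambda>x. \<psi> x *
    complex_of_real (integral\<^sup>L lebesgue (\<lambda>z. integral\<^sup>L lebesgue (\<lambda>y.
      (norm (\<psi> y))\<^sup>2 * (norm (\<psi> z))\<^sup>2 / norm (z - y)))))"

definition weak_solution ::
    "real \<Rightarrow> real \<Rightarrow> real \<Rightarrow> real set \<Rightarrow> (real^3 \<Rightarrow> complex) \<Rightarrow>
      (real \<Rightarrow> real^3 \<Rightarrow> complex) \<Rightarrow> bool"
  where "weak_solution hbar m G I \<phi> \<psi> \<longleftrightarrow>
    \<psi> \<in> Linfinity I W12 W12_norm \<and>
    (\<exists>\<psi>'. has_W1infinity_derivative I W12_dual W12_dual_norm (\<lambda>t. embed (\<psi> t)) \<psi>' \<and>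
      (AE t in lebesgue_on I. \<forall>v\<in>W12.
        \<i> * \<psi>' t v =
          - complex_of_real (hbar / (2 * m)) * laplacian (\<psi> t) v
          + \<i> * complex_of_real (4 * pi * (G * m\<^sup>2 / hbar)) * embed (g1 (\<psi> t)) v
          - \<i> * complex_of_real (4 * pi * (G * m\<^sup>2 / hbar)) * embed (g2 (\<psi> t)) v)) \<and>
    has_value_at I \<psi> 0 \<phi>"

end

theory Submission
  imports Defs
begin

text \<open>
  Let \<open>w\<close> be the difference of two solutions. Its $L^2$ norm obeys a Gronwall inequality. The
  Laplacian is selfadjoint, so it does not contribute to the energy identity. The nonlinear terms
  are Lipschitz in $L^2$ on bounded sets of $W^{1,2}$: by Hardy's inequality, the potential of
  $|\psi_1|^2 - |\psi_2|^2$ is bounded pointwise by a multiple of $\|w\|_{L^2}$.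

  Hardy's inequality is obtained for weak gradients in its dual form. For a test function
  $\theta$, the pairing $\mu \mapsto \int \mu^3 \theta(p + \mu(x-p))\, u(x)\, dx$ has a
  derivative that the weak gradient controls, and it vanishes at $\mu = 0$; density of the test
  functions then gives the weighted $L^2$ bound.

  The energy identity needs no regularisation in time. For almost every \<open>r\<close> the map
  $s \mapsto \Phi(s,r) = \mathrm{Re} \langle w(s), w(r) \rangle$ is an integral of
  $D(s,r) = \mathrm{Re} \langle w'(s), w(r) \rangle$, and only the symmetrised quantity
  $D(s,r) + D(r,s)$, in which the unbounded Laplacian terms cancel, enters the growth of
  $\Phi(t,t)$.
\<close>

section \<open>Smooth functions\<close>

text \<open>What shapes the energy argument is that D(s,r) makes sense only for almost every pair of
  times, while the diagonal is a null set: nothing can be read off D(t,t). Averaging the increment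
  of \<Phi>(t,t) over a short step spreads the diagonal out to a strip, on which Fubini brings
  D(s,r) and D(r,s) together at the same pair; hence the care about joint measurability of D. Since
  the spaces are carrier sets with seminorms, vector-valued integrals are used only after evaluation
  at a fixed element of \<open>W12\<close>, where they are scalar integrals. In the Coulomb integral
  the kernel is absorbed by the factor in \<open>W12\<close>, so w enters through its L2 norm alone.
  Constants: Hardy's inequality for the real and the imaginary part, each against the full gradient,
  gives 8 rather than 4, and sqrt 8 is rounded up to 3. With R a bound of the \<open>W12\<close>
  norms, 3 R^2 then bounds a potential, and the product rule gives the Lipschitz constants 9 R^2 = 3
  R^2 + 6 R * R for \<open>g1\<close> and 15 R^4 = 3 R^4 + 12 R^3 * R for \<open>g2\<close>.\<close>

lemma smooth_coinduct:
  assumes "f \<in> P"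
    and diff: "\<And>g. g \<in> P \<Longrightarrow> g differentiable_on UNIV"
    and deriv: "\<And>g b. g \<in> P \<Longrightarrow> b \<in> Basis \<Longrightarrow> (\<lambda>x. frechet_derivative g (at x) b) \<in> P"
  shows "smooth f"
proof -
  \<comment> \<open>Iterated partial derivatives never leave \<open>P\<close>, so smoothness reduces
    to finding a set of differentiable functions that is closed under partial derivatives. Every
    smoothness proof below exhibits such a set.\<close>
  have "foldr (\<lambda>b g x. frechet_derivative g (at x) b) bs f \<in> P" if "set bs \<subseteq> Basis" for bs
    using that by (induction bs) (auto simp: assms(1) intro: deriv)
  then show ?thesis
    unfolding smooth_def using diff by blast
qed

lemma smooth_differentiable_on: "smooth f \<Longrightarrow> f differentiable_on UNIV"
  unfolding smooth_def by (drule spec[of _ "[]"]) simp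

lemma smooth_differentiable: "smooth f \<Longrightarrow> f differentiable (at x)"
  using smooth_differentiable_on by (auto simp: differentiable_on_def)

lemma smooth_has_derivative: "smooth f \<Longrightarrow> (f has_derivative frechet_derivative f (at x)) (at x)"
  using smooth_differentiable frechet_derivative_works by blast

lemma smooth_continuous_on: "smooth f \<Longrightarrow> continuous_on S f"
  by (meson differentiable_imp_continuous_on continuous_on_subset smooth_differentiable_on subset_UNIV)

lemma smooth_partial:
  assumes "smooth f" and "b \<in> Basis"
  shows "smooth (\<lambda>x. frechet_derivative f (at x) b)"
  unfolding smooth_def
proof (intro allI impI)
  fix bs :: "'a list"
  assume "set bs \<subseteq> Basis"
  with assms(2) have "set (bs @ [b]) \<subseteq> Basis" by auto
  with assms(1) have "foldr (\<lambda>b g x. frechet_derivative g (at x) b) (bs @ [b]) f differentiable_on UNIV"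
    unfolding smooth_def by blast
  then show "foldr (\<lambda>b g x. frechet_derivative g (at x) b) bs
      (\<lambda>x. frechet_derivative f (at x) b) differentiable_on UNIV"
    by simp
qed

lemma smooth_const [simp]: "smooth (\<lambda>x. c)"
proof (rule smooth_coinduct[where P="range (\<lambda>c x. c)"])
  fix g :: "'a \<Rightarrow> 'b" and b :: 'a
  assume "g \<in> range (\<lambda>c x. c)"
  then obtain c where "g = (\<lambda>x. c)" by auto
  then show "g differentiable_on UNIV" and "(\<lambda>x. frechet_derivative g (at x) b) \<in> range (\<lambda>c x. c)"
    by auto
qed auto

lemma smooth_bounded_linear:
  assumes "bounded_linear f"
  shows "smooth f"
proof (rule smooth_coinduct[where P="insert f (range (\<lambda>c x. c))"])
  fix g and b :: 'a
  assume "g \<in> insert f (range (\<lambda>c x. c))"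
  then consider "g = f" | c where "g = (\<lambda>x. c)" by auto
  then have "g differentiable_on UNIV \<and> (\<lambda>x. frechet_derivative g (at x) b) \<in> insert f (range (\<lambda>c x. c))"
  proof cases
    case 1
    have "frechet_derivative f (at x) = f" for x
      using bounded_linear_imp_has_derivative[OF assms] by (rule frechet_derivative_at[symmetric])
    then show ?thesis
      using 1 bounded_linear_imp_differentiable_on[OF assms] by auto
  qed auto
  then show "g differentiable_on UNIV"
    and "(\<lambda>x. frechet_derivative g (at x) b) \<in> insert f (range (\<lambda>c x. c))" by auto
qed auto

text \<open>The partial derivatives of a product or a reciprocal are again built from these
  operations, so this closure is an invariant set for \<open>smooth_coinduct\<close>. This replaces
  a Leibniz formula for higher derivatives.\<close>

inductive_set smooth_algebra :: "('a::euclidean_space \<Rightarrow> real) set" where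
  base: "smooth f \<Longrightarrow> f \<in> smooth_algebra"
| add: "f \<in> smooth_algebra \<Longrightarrow> g \<in> smooth_algebra \<Longrightarrow> (\<lambda>x. f x + g x) \<in> smooth_algebra"
| mult: "f \<in> smooth_algebra \<Longrightarrow> g \<in> smooth_algebra \<Longrightarrow> (\<lambda>x. f x * g x) \<in> smooth_algebra"
| inverse: "f \<in> smooth_algebra \<Longrightarrow> (\<And>x. f x \<noteq> 0) \<Longrightarrow> (\<lambda>x. inverse (f x)) \<in> smooth_algebra"

lemma smooth_algebra_partial:
  assumes "f \<in> smooth_algebra"
  shows "f differentiable_on UNIV \<and>
    (\<forall>b\<in>Basis. (\<lambda>x. frechet_derivative f (at x) b) \<in> smooth_algebra)"
  using assms
proof induction
  case (base f)
  then show ?case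
    by (simp add: smooth_differentiable_on smooth_partial smooth_algebra.base)
next
  case (add f g)
  then have d: "f differentiable (at x)" "g differentiable (at x)" for x
    unfolding differentiable_on_def by simp_all
  have h: "((\<lambda>x. f x + g x) has_derivative
      (\<lambda>h. frechet_derivative f (at x) h + frechet_derivative g (at x) h)) (at x)" for x
    by (intro has_derivative_add d[unfolded frechet_derivative_works])
  have eq: "frechet_derivative (\<lambda>x. f x + g x) (at x) b =
      frechet_derivative f (at x) b + frechet_derivative g (at x) b" for x b
    using fun_cong[OF frechet_derivative_at, OF h] by simp
  have "(\<lambda>x. frechet_derivative f (at x) b + frechet_derivative g (at x) b) \<in> smooth_algebra"
    if "b \<in> Basis" for b
    using add.IH that by (intro smooth_algebra.add) blast+
  moreover have "(\<lambda>x. f x + g x) differentiable (at x)" for x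
    using h by (rule differentiableI)
  ultimately show ?case
    unfolding differentiable_on_def eq by blast
next
  case (mult f g)
  then have d: "f differentiable (at x)" "g differentiable (at x)" for x
    unfolding differentiable_on_def by simp_all
  have h: "((\<lambda>x. f x * g x) has_derivative
      (\<lambda>h. f x * frechet_derivative g (at x) h + frechet_derivative f (at x) h * g x)) (at x)" for x
    by (intro has_derivative_mult d[unfolded frechet_derivative_works])
  have eq: "frechet_derivative (\<lambda>x. f x * g x) (at x) b =
      f x * frechet_derivative g (at x) b + frechet_derivative f (at x) b * g x" for x b
    using fun_cong[OF frechet_derivative_at, OF h] by simp
  have "(\<lambda>x. f x * frechet_derivative g (at x) b + frechet_derivative f (at x) b * g x) \<in> smooth_algebra"
    if "b \<in> Basis" for b
    using mult.IH that
    by (intro smooth_algebra.add[OF smooth_algebra.mult[OF mult.hyps(1)] smooth_algebra.mult[OF _ mult.hyps(2)]]) blast+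
  moreover have "(\<lambda>x. f x * g x) differentiable (at x)" for x
    using h by (rule differentiableI)
  ultimately show ?case
    unfolding differentiable_on_def eq by blast
next
  case (inverse f)
  then have d: "f differentiable (at x)" for x
    unfolding differentiable_on_def by simp
  have h: "((\<lambda>x. inverse (f x)) has_derivative
      (\<lambda>h. - (inverse (f x) * frechet_derivative f (at x) h * inverse (f x)))) (at x)" for x
    by (intro Deriv.has_derivative_inverse inverse.hyps(2) d[unfolded frechet_derivative_works])
  \<comment> \<open>The sign is written as a factor - 1 because the algebra has constants and
    products but no rule for negation.\<close>
  then have eq: "frechet_derivative (\<lambda>x. inverse (f x)) (at x) b =
      - 1 * (inverse (f x) * (frechet_derivative f (at x) b * inverse (f x)))" for x b
    using fun_cong[OF frechet_derivative_at, OF h] by (simp add: mult.assoc)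
  have inv: "(\<lambda>x. inverse (f x)) \<in> smooth_algebra"
    using inverse.hyps by (rule smooth_algebra.inverse)
  have c: "(\<lambda>x. - 1) \<in> smooth_algebra"
    by (rule smooth_algebra.base[OF smooth_const])
  have p: "(\<lambda>x. frechet_derivative f (at x) b) \<in> smooth_algebra" if "b \<in> Basis" for b
    using inverse.IH that by blast
  have "(\<lambda>x. - 1 * (inverse (f x) * (frechet_derivative f (at x) b * inverse (f x)))) \<in> smooth_algebra"
    if "b \<in> Basis" for b
    by (rule smooth_algebra.mult[OF c smooth_algebra.mult[OF inv smooth_algebra.mult[OF p[OF that] inv]]])
  moreover have "(\<lambda>x. inverse (f x)) differentiable (at x)" for x
    using h by (rule differentiableI)
  ultimately show ?case
    unfolding differentiable_on_def eq by blast
qed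

lemma smooth_algebra_smooth: "f \<in> smooth_algebra \<Longrightarrow> smooth f"
  by (erule smooth_coinduct) (simp_all add: smooth_algebra_partial)

lemma smooth_add: 
  fixes f g :: "'a::euclidean_space \<Rightarrow> real"
  shows "smooth f \<Longrightarrow> smooth g \<Longrightarrow> smooth (\<lambda>x. f x + g x)"
  by (rule smooth_algebra_smooth, rule smooth_algebra.add; rule smooth_algebra.base)

lemma smooth_mult: 
  fixes f g :: "'a::euclidean_space \<Rightarrow> real"
  shows "smooth f \<Longrightarrow> smooth g \<Longrightarrow> smooth (\<lambda>x. f x * g x)"
  by (rule smooth_algebra_smooth, rule smooth_algebra.mult; rule smooth_algebra.base)

lemma smooth_divide: 
  fixes f g :: "'a::euclidean_space \<Rightarrow> real"
  shows "smooth f \<Longrightarrow> smooth g \<Longrightarrow> (\<And>x. g x \<noteq> 0) \<Longrightarrow> smooth (\<lambda>x. f x / g x)"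
  unfolding divide_inverse
  by (rule smooth_algebra_smooth, rule smooth_algebra.mult)
    (simp_all add: smooth_algebra.base smooth_algebra.inverse)

lemma smooth_prod:
  fixes f :: "'i \<Rightarrow> 'a::euclidean_space \<Rightarrow> real"
  assumes "\<And>i. i \<in> A \<Longrightarrow> smooth (f i)"
  shows "smooth (\<lambda>x. \<Prod>i\<in>A. f i x)"
  using assms by (induction A rule: infinite_finite_induct) (simp_all add: smooth_mult)

lemma smooth_real_polynomial_function:
  fixes f :: "'a::euclidean_space \<Rightarrow> real"
  shows "real_polynomial_function f \<Longrightarrow> smooth f"
  by (induction rule: real_polynomial_function.induct)
    (simp_all add: smooth_bounded_linear smooth_add smooth_mult)

lemma frechet_derivative_affine:
  fixes f :: "'a::euclidean_space \<Rightarrow> real"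
  assumes "smooth f"
  shows "((\<lambda>x. f (q + c *\<^sub>R x)) has_derivative (\<lambda>h. c * frechet_derivative f (at (q + c *\<^sub>R x)) h)) (at x)"
proof -
  have "((\<lambda>x. f (q + c *\<^sub>R x)) has_derivative
      (\<lambda>h. frechet_derivative f (at (q + c *\<^sub>R x)) (c *\<^sub>R h))) (at x)"
    by (rule has_derivative_compose[OF _ smooth_has_derivative[OF assms]])
      (auto intro!: derivative_eq_intros)
  moreover have "linear (frechet_derivative f (at (q + c *\<^sub>R x)))"
    using linear_frechet_derivative smooth_differentiable[OF assms] by blast
  ultimately show ?thesis by (simp add: linear_scale)
qed

lemma smooth_affine:
  fixes f :: "'a::euclidean_space \<Rightarrow> real"
  assumes "smooth f"
  shows "smooth (\<lambda>x. f (q + c *\<^sub>R x))"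
proof -
  \<comment> \<open>The chain rule produces a factor \<open>c\<close> with each derivative, so the
    invariant set carries an arbitrary scalar factor \<open>k\<close>.\<close>
  define P :: "('a \<Rightarrow> real) set" where "P = (\<lambda>(k, f) x. k * f (q + c *\<^sub>R x)) ` (UNIV \<times> Collect smooth)"
  have "(\<lambda>x. 1 * f (q + c *\<^sub>R x)) \<in> P"
    unfolding P_def by (rule image_eqI[of _ _ "(1, f)"]) (use assms in auto)
  then show ?thesis
    unfolding mult_1
  proof (rule smooth_coinduct)
    fix g :: "'a \<Rightarrow> real" and b :: 'a
    assume "g \<in> P"
    then obtain k f where f: "smooth f" and g: "g = (\<lambda>x. k * f (q + c *\<^sub>R x))"
      unfolding P_def by auto
    have d: "(g has_derivative (\<lambda>h. k * (c * frechet_derivative f (at (q + c *\<^sub>R x)) h))) (at x)" for x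
      unfolding g by (rule has_derivative_mult_right[OF frechet_derivative_affine[OF f]])
    show "g differentiable_on UNIV"
      unfolding differentiable_on_def using differentiableI[OF d] by simp
    assume "b \<in> Basis"
    have "(\<lambda>x. (k * c) * frechet_derivative f (at (q + c *\<^sub>R x)) b) \<in> P"
      unfolding P_def using smooth_partial[OF f \<open>b \<in> Basis\<close>]
      by (intro image_eqI[of _ _ "(k * c, \<lambda>x. frechet_derivative f (at x) b)"]) simp_all
    then show "(\<lambda>x. frechet_derivative g (at x) b) \<in> P"
      by (simp add: frechet_derivative_at[OF d, symmetric] mult.assoc)
  qed
qed

lemma smooth_inner:
  fixes f :: "real \<Rightarrow> real" and v :: "'a::euclidean_space"
  assumes "smooth f"
  shows "smooth (\<lambda>x. f (x \<bullet> v))"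
proof -
  define P :: "('a \<Rightarrow> real) set" where "P = (\<lambda>(k, f) x. k * f (x \<bullet> v)) ` (UNIV \<times> Collect smooth)"
  have "(\<lambda>x. 1 * f (x \<bullet> v)) \<in> P"
    unfolding P_def by (rule image_eqI[of _ _ "(1, f)"]) (use assms in auto)
  then show ?thesis
    unfolding mult_1
  proof (rule smooth_coinduct)
    fix g :: "'a \<Rightarrow> real" and b :: 'a
    assume "g \<in> P"
    then obtain k f where f: "smooth f" and g: "g = (\<lambda>x. k * f (x \<bullet> v))"
      unfolding P_def by auto
    have lin: "frechet_derivative f (at y) z = z * frechet_derivative f (at y) 1" for y z
      using linear_scale[OF linear_frechet_derivative[OF smooth_differentiable[OF f]], of y z 1] by simp
    have "((\<lambda>x. f (x \<bullet> v)) has_derivative (\<lambda>h. frechet_derivative f (at (x \<bullet> v)) (h \<bullet> v))) (at x)" for x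
      by (rule has_derivative_compose[OF _ smooth_has_derivative[OF f]])
        (rule has_derivative_inner_left[OF has_derivative_ident])
    then have d: "(g has_derivative (\<lambda>h. k * ((h \<bullet> v) * frechet_derivative f (at (x \<bullet> v)) 1))) (at x)" for x
      unfolding g by (subst lin[symmetric]) (rule has_derivative_mult_right)
    show "g differentiable_on UNIV"
      unfolding differentiable_on_def using differentiableI[OF d] by simp
    have "(\<lambda>x. (k * (b \<bullet> v)) * frechet_derivative f (at (x \<bullet> v)) 1) \<in> P"
      unfolding P_def using smooth_partial[OF f, of 1]
      by (intro image_eqI[of _ _ "(k * (b \<bullet> v), \<lambda>x. frechet_derivative f (at x) 1)"]) simp_all
    then show "(\<lambda>x. frechet_derivative g (at x) b) \<in> P"
      by (simp add: frechet_derivative_at[OF d, symmetric] mult.assoc)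
  qed
qed

section \<open>A smooth transition from 0 to 1\<close>

text \<open>For k = 0 this is the classical smooth function exp(-1/x), flat at 0. The powers of 1/x
  are included because differentiation produces them.\<close>

definition exp_bump :: "nat \<Rightarrow> real \<Rightarrow> real"
  where "exp_bump k x = (if x > 0 then (1 / x) ^ k * exp (- (1 / x)) else 0)"

lemma exp_bump_has_field_derivative:
  "(exp_bump k has_field_derivative (exp_bump (k + 2) x - real k * exp_bump (k + 1) x)) (at x)"
proof (cases x "0::real" rule: linorder_cases)
  case less
  have "((\<lambda>x. 0) has_field_derivative 0) (at x)" by simp
  then have "(exp_bump k has_field_derivative 0) (at x)"
    by (rule has_field_derivative_transform_within_open[where S="{..<0}"])
      (use less in \<open>auto simp: exp_bump_def\<close>)
  then show ?thesis using less by (simp add: exp_bump_def)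
next
  case equal
  \<comment> \<open>With y = 1/h the right difference quotient at 0 is y^(k+1) / exp y, so the decay
    of the exponential at infinity gives derivative 0; the left quotient is constantly 0.\<close>
  have "((\<lambda>y::real. y ^ (k + 1) / exp y) \<longlongrightarrow> 0) at_top"
    by (rule tendsto_power_div_exp_0)
  then have "((\<lambda>h::real. inverse h ^ (k + 1) / exp (inverse h)) \<longlongrightarrow> 0) (at_right 0)"
    by (rule filterlim_compose) (rule filterlim_inverse_at_top_right)
  moreover have "\<forall>\<^sub>F h::real in at_right 0. inverse h ^ (k + 1) / exp (inverse h) = (exp_bump k h - exp_bump k 0) / h"
    by (auto simp: eventually_at_right_field exp_bump_def exp_minus field_simps intro!: exI[of _ 1])
  ultimately have r: "((\<lambda>h. (exp_bump k h - exp_bump k 0) / h) \<longlongrightarrow> 0) (at_right 0)"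
    by (rule Lim_transform_eventually)
  have "\<forall>\<^sub>F h::real in at_left 0. 0 = (exp_bump k h - exp_bump k 0) / h"
    by (auto simp: eventually_at_left_field exp_bump_def intro!: exI[of _ "-1"])
  then have l: "((\<lambda>h. (exp_bump k h - exp_bump k 0) / h) \<longlongrightarrow> 0) (at_left 0)"
    by (rule tendsto_eventually[OF eventually_mono]) auto
  have "((\<lambda>h. (exp_bump k h - exp_bump k 0) / h) \<longlongrightarrow> 0) (at 0)"
    using l r by (rule filterlim_split_at)
  then show ?thesis
    using equal by (simp add: has_field_derivative_iff exp_bump_def[of _ 0])
next
  case greater
  have inv: "((\<lambda>x. 1 / x) has_field_derivative - ((1 / x) ^ 2)) (at x)"
    using greater by (auto intro!: derivative_eq_intros simp: power2_eq_square)
  have "((\<lambda>x. (1 / x) ^ k * exp (- (1 / x))) has_field_derivative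
      real k * (1 / x) ^ (k - 1) * (- ((1 / x) ^ 2)) * exp (- (1 / x))
        + exp (- (1 / x)) * (- (- ((1 / x) ^ 2))) * (1 / x) ^ k) (at x)"
    by (intro DERIV_mult DERIV_fun_exp DERIV_minus inv) (use DERIV_power[OF inv, of k] in \<open>simp add: mult_ac\<close>)
  \<comment> \<open>The truncated exponent \<open>k - 1\<close> is harmless at k = 0, where its
    coefficient vanishes.\<close>
  moreover have "real k * y ^ (k - 1) * (- (y ^ 2)) * E + E * (- (- (y ^ 2))) * y ^ k =
      y ^ (k + 2) * E - real k * (y ^ (k + 1) * E)" for y E :: real
    by (cases k) (simp_all add: power2_eq_square algebra_simps)
  ultimately have "((\<lambda>x. (1 / x) ^ k * exp (- (1 / x))) has_field_derivative
      (exp_bump (k + 2) x - real k * exp_bump (k + 1) x)) (at x)"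
    using greater by (simp only: exp_bump_def if_True)
  then show ?thesis
    by (rule has_field_derivative_transform_within_open[where S="{0<..}"])
      (use greater in \<open>auto simp: exp_bump_def\<close>)
qed

lemma frechet_derivative_real:
  fixes f :: "real \<Rightarrow> real"
  assumes "(f has_field_derivative d) (at x)"
  shows "frechet_derivative f (at x) = (\<lambda>h. d * h)"
  using frechet_derivative_at[of f "\<lambda>h. d * h" x] assms by (simp add: has_field_derivative_def)

text \<open>Differentiation raises the index k by 1 and 2, so an invariant set has to contain all
  indices together with their linear combinations.\<close>

inductive_set exp_bump_span :: "(real \<Rightarrow> real) set" where
  base: "(\<lambda>x. c * exp_bump k x) \<in> exp_bump_span"
| add: "f \<in> exp_bump_span \<Longrightarrow> g \<in> exp_bump_span \<Longrightarrow> (\<lambda>x. f x + g x) \<in> exp_bump_span"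

lemma exp_bump_span_derivative:
  "f \<in> exp_bump_span \<Longrightarrow> \<exists>f'\<in>exp_bump_span. \<forall>x. (f has_field_derivative f' x) (at x)"
proof (induction rule: exp_bump_span.induct)
  case (base c k)
  show ?case
  proof (rule bexI)
    show "\<forall>x. ((\<lambda>x. c * exp_bump k x) has_field_derivative
        c * exp_bump (k + 2) x + (- c * real k) * exp_bump (k + 1) x) (at x)"
      by (auto intro!: derivative_eq_intros exp_bump_has_field_derivative[THEN DERIV_cong] simp: algebra_simps)
    show "(\<lambda>x. c * exp_bump (k + 2) x + (- c * real k) * exp_bump (k + 1) x) \<in> exp_bump_span"
      by (intro exp_bump_span.intros)
  qed
next
  case (add f g)
  then obtain f' g' where "f' \<in> exp_bump_span" "\<And>x. (f has_field_derivative f' x) (at x)"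
    and "g' \<in> exp_bump_span" "\<And>x. (g has_field_derivative g' x) (at x)" by blast
  then show ?case
    by (intro bexI[of _ "\<lambda>x. f' x + g' x"]) (auto intro!: derivative_intros exp_bump_span.intros)
qed

lemma smooth_exp_bump: "smooth (exp_bump 0)"
proof (rule smooth_coinduct[where P=exp_bump_span])
  show "exp_bump 0 \<in> exp_bump_span"
    using exp_bump_span.base[of 1 0] by simp
next
  fix g and b :: real
  assume "g \<in> exp_bump_span" 
  then obtain g' where g': "g' \<in> exp_bump_span" "\<And>x. (g has_field_derivative g' x) (at x)"
    using exp_bump_span_derivative by blast
  then show "g differentiable_on UNIV"
    by (auto simp: differentiable_on_def has_field_derivative_def differentiable_def)
  assume "b \<in> Basis"
  then show "(\<lambda>x. frechet_derivative g (at x) b) \<in> exp_bump_span"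
    using g' by (simp add: frechet_derivative_real[OF g'(2)])
qed

text \<open>The standard smooth transition: 0 on the negative axis, 1 from 1 onwards. The
  denominator is positive everywhere since x or 1 - x is positive.\<close>

definition smooth_step :: "real \<Rightarrow> real"
  where "smooth_step x = exp_bump 0 x / (exp_bump 0 x + exp_bump 0 (1 - x))"

lemma exp_bump_sum_pos: "exp_bump 0 x + exp_bump 0 (1 - x) > 0"
  by (auto simp: exp_bump_def add_pos_pos)

lemma smooth_smooth_step: "smooth smooth_step"
proof -
  have "smooth (\<lambda>x. exp_bump 0 (1 - x))"
    using smooth_affine[OF smooth_exp_bump, of 1 "-1"] by simp
  then show ?thesis
    unfolding smooth_step_def[abs_def]
    by (intro smooth_divide smooth_add smooth_exp_bump less_imp_neq[OF exp_bump_sum_pos, THEN not_sym])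
qed

lemma smooth_step_0: "x \<le> 0 \<Longrightarrow> smooth_step x = 0"
  and smooth_step_1: "x \<ge> 1 \<Longrightarrow> smooth_step x = 1"
  by (auto simp: smooth_step_def exp_bump_def)

lemma smooth_step_ge_0: "0 \<le> smooth_step x" and smooth_step_le_1: "smooth_step x \<le> 1"
  using exp_bump_sum_pos[of x] by (auto simp: smooth_step_def exp_bump_def)

section \<open>Test functions\<close>

lemma test_functionsI:
  fixes \<theta> :: "'a::euclidean_space \<Rightarrow> real"
  assumes "smooth \<theta>" and "compact K" and "K \<subseteq> U" and "\<And>x. x \<notin> K \<Longrightarrow> \<theta> x = 0"
  shows "\<theta> \<in> test_functions U"
proof -
  have sub: "closure {x. \<theta> x \<noteq> 0} \<subseteq> K"
    by (intro closure_minimal compact_imp_closed[OF assms(2)]) (use assms(4) in auto)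
  then have "compact (closure {x. \<theta> x \<noteq> 0})"
    using assms(2) compact_Int_closed[of K "closure {x. \<theta> x \<noteq> 0}"] by (simp add: Int_absorb1)
  then show ?thesis
    using assms(1,3) sub by (auto simp: test_functions_def)
qed

lemma test_functions_smooth: "\<theta> \<in> test_functions U \<Longrightarrow> smooth \<theta>"
  by (simp add: test_functions_def)

lemma test_functions_support:
  fixes \<theta> :: "'a::euclidean_space \<Rightarrow> real"
  assumes "\<theta> \<in> test_functions U"
  obtains K where "compact K" "K \<subseteq> U" "\<And>x. x \<notin> K \<Longrightarrow> \<theta> x = 0"
proof
  show "compact (closure {x. \<theta> x \<noteq> 0})" "closure {x. \<theta> x \<noteq> 0} \<subseteq> U"
    using assms by (auto simp: test_functions_def)
  show "\<theta> x = 0" if "x \<notin> closure {x. \<theta> x \<noteq> 0}" for x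
    using that closure_subset[of "{x. \<theta> x \<noteq> 0}"] by auto
qed

lemma test_functions_ball_support:
  fixes \<theta> :: "'a::euclidean_space \<Rightarrow> real"
  assumes "\<theta> \<in> test_functions U"
  obtains R where "R > 0" "\<And>x. norm x > R \<Longrightarrow> \<theta> x = 0"
proof -
  obtain K where K: "compact K" "\<And>x. x \<notin> K \<Longrightarrow> \<theta> x = 0"
    using test_functions_support[OF assms] by metis
  obtain R where "R > 0" "\<And>x. x \<in> K \<Longrightarrow> norm x \<le> R"
    using compact_imp_bounded[OF K(1)] bounded_pos by metis
  then show thesis
    using K(2) by (intro that[of R]) fastforce+
qed

lemma test_functions_bounded:
  fixes \<theta> :: "'a::euclidean_space \<Rightarrow> real"
  assumes "\<theta> \<in> test_functions U"
  obtains M where "M > 0" "\<And>x. \<bar>\<theta> x\<bar> \<le> M"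
proof -
  obtain K where K: "compact K" "\<And>x. x \<notin> K \<Longrightarrow> \<theta> x = 0"
    using test_functions_support[OF assms] by metis
  have "compact (\<theta> ` K)"
    by (rule compact_continuous_image[OF smooth_continuous_on[OF test_functions_smooth[OF assms]] K(1)])
  then obtain M where M: "M > 0" "\<And>x. x \<in> K \<Longrightarrow> \<bar>\<theta> x\<bar> \<le> M"
    using compact_imp_bounded bounded_pos by (metis image_eqI real_norm_def)
  have "\<bar>\<theta> x\<bar> \<le> M" for x
    using M K(2)[of x] by (cases "x \<in> K") auto
  then show thesis using M(1) that by blast
qed

lemma test_functions_partial:
  fixes \<theta> :: "'a::euclidean_space \<Rightarrow> real"
  assumes "\<theta> \<in> test_functions U" and "b \<in> Basis"
  shows "(\<lambda>x. frechet_derivative \<theta> (at x) b) \<in> test_functions U"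
proof -
  obtain K where K: "compact K" "K \<subseteq> U" "\<And>x. x \<notin> K \<Longrightarrow> \<theta> x = 0"
    using test_functions_support[OF assms(1)] by metis
  have "frechet_derivative \<theta> (at x) b = 0" if "x \<notin> K" for x
  proof -
    have "((\<lambda>x. 0) has_derivative (\<lambda>h. 0)) (at x)" by simp
    then have "(\<theta> has_derivative (\<lambda>h. 0)) (at x)"
      by (rule has_derivative_transform_within_open[of _ _ _ _ "- K"])
        (use that K compact_imp_closed in auto)
    from frechet_derivative_at[OF this, symmetric] show ?thesis by simp
  qed
  then show ?thesis
    using K by (intro test_functionsI[of _ K] smooth_partial test_functions_smooth[OF assms(1)] assms(2)) auto
qed

lemma test_functions_mult:
  fixes \<theta> :: "'a::euclidean_space \<Rightarrow> real"
  assumes "smooth f" and "\<theta> \<in> test_functions U"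
  shows "(\<lambda>x. f x * \<theta> x) \<in> test_functions U"
proof -
  obtain K where "compact K" "K \<subseteq> U" "\<And>x. x \<notin> K \<Longrightarrow> \<theta> x = 0"
    using test_functions_support[OF assms(2)] by metis
  then show ?thesis
    by (intro test_functionsI[of _ K] smooth_mult assms(1) test_functions_smooth[OF assms(2)]) auto
qed

lemma test_functions_affine:
  fixes \<theta> :: "'a::euclidean_space \<Rightarrow> real"
  assumes "\<theta> \<in> test_functions UNIV" and "c \<noteq> 0"
  shows "(\<lambda>x. \<theta> (q + c *\<^sub>R x)) \<in> test_functions UNIV"
proof -
  obtain K where K: "compact K" "\<And>x. x \<notin> K \<Longrightarrow> \<theta> x = 0"
    using test_functions_support[OF assms(1)] by metis
  show ?thesis
  proof (rule test_functionsI)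
    show "compact ((\<lambda>y. (1 / c) *\<^sub>R (y - q)) ` K)"
      by (intro compact_continuous_image K continuous_intros)
    fix x assume x: "x \<notin> (\<lambda>y. (1 / c) *\<^sub>R (y - q)) ` K"
    have "x = (1 / c) *\<^sub>R ((q + c *\<^sub>R x) - q)" using assms(2) by simp
    then have "q + c *\<^sub>R x \<notin> K" using x by blast
    then show "\<theta> (q + c *\<^sub>R x) = 0" by (rule K)
  qed (auto intro: smooth_affine test_functions_smooth[OF assms(1)])
qed

text \<open>A smooth substitute for the indicator of the box from a to b: each factor vanishes
  beyond its face and has reached 1 at distance 1/n inside it.\<close>

definition box_bump :: "nat \<Rightarrow> 'a::euclidean_space \<Rightarrow> 'a \<Rightarrow> 'a \<Rightarrow> real"
  where "box_bump n a b x =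
    (\<Prod>i\<in>Basis. smooth_step (real n * (x \<bullet> i - a \<bullet> i)) * smooth_step (real n * (b \<bullet> i - x \<bullet> i)))"

lemma box_bump_bounds: "0 \<le> box_bump n a b x" "box_bump n a b x \<le> 1"
  unfolding box_bump_def
  by (auto intro!: prod_nonneg prod_le_1 mult_le_one simp: smooth_step_ge_0 smooth_step_le_1)

lemma box_bump_eq_0: "x \<notin> box a b \<Longrightarrow> box_bump n a b x = 0"
  by (force simp: box_bump_def mem_box intro!: prod_zero smooth_step_0 mult_nonneg_nonpos)

lemma smooth_step_tendsto:
  assumes "y > 0"
  shows "(\<lambda>n. smooth_step (real n * y)) \<longlonglongrightarrow> 1"
proof (rule tendsto_eventually)
  obtain N :: nat where N: "1 / y < real N" using reals_Archimedean2 by blast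
  show "\<forall>\<^sub>F n in sequentially. smooth_step (real n * y) = 1"
    using eventually_ge_at_top[of N]
  proof eventually_elim
    case (elim n)
    then have "1 / y < real n" using N by linarith
    then have "1 \<le> real n * y" using assms by (simp add: field_simps)
    then show ?case by (rule smooth_step_1)
  qed
qed

lemma box_bump_tendsto:
  assumes "x \<in> box a b"
  shows "(\<lambda>n. box_bump n a b x) \<longlonglongrightarrow> 1"
proof -
  have "(\<lambda>n. box_bump n a b x) \<longlonglongrightarrow> (\<Prod>i\<in>(Basis::'a set). 1 * 1)"
    unfolding box_bump_def using assms
    by (intro tendsto_prod tendsto_mult smooth_step_tendsto) (auto simp: mem_box)
  then show ?thesis by simp
qed

lemma smooth_smooth_step_affine: "smooth (\<lambda>y. smooth_step (c * (y - d)))"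
  using smooth_affine[OF smooth_smooth_step, of "- c * d" c] by (simp add: algebra_simps)

lemma smooth_smooth_step_affine': "smooth (\<lambda>y. smooth_step (c * (d - y)))"
  using smooth_smooth_step_affine[of "- c" d] by (simp add: algebra_simps)

lemma box_bump_test_function: "box_bump n a b \<in> test_functions UNIV"
proof (rule test_functionsI)
  show "smooth (box_bump n a b)"
    unfolding box_bump_def[abs_def]
    by (intro smooth_prod smooth_mult smooth_inner[OF smooth_smooth_step_affine]
      smooth_inner[OF smooth_smooth_step_affine'])
  show "box_bump n a b x = 0" if "x \<notin> cbox a b" for x
    using that box_subset_cbox by (intro box_bump_eq_0) blast
qed auto

text \<open>No convolution is involved: a measurable function is an almost everywhere limit of
  continuous ones, these are approximated on the closed box by polynomials, and a box bump cuts the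
  polynomials off. The uniform bound and the common support are what dominated convergence asks for;
  the extra 1 in the bound absorbs the polynomial error.\<close>

lemma test_functions_dense:
  fixes f :: "'a::euclidean_space \<Rightarrow> real"
  assumes f: "f \<in> borel_measurable lebesgue" and M: "\<And>x. \<bar>f x\<bar> \<le> M"
    and supp: "\<And>x. x \<notin> box a b \<Longrightarrow> f x = 0"
  obtains \<theta> where "\<And>n. \<theta> n \<in> test_functions UNIV" "\<And>n x. \<bar>\<theta> n x\<bar> \<le> M + 1"
    "\<And>n x. x \<notin> box a b \<Longrightarrow> \<theta> n x = 0" "AE x in lebesgue. (\<lambda>n. \<theta> n x) \<longlonglongrightarrow> f x"
proof -
  have M0: "M \<ge> 0" using M[of 0] by linarith
  have "f measurable_on UNIV"
    using f by (simp add: measurable_on_iff_borel_measurable)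
  then obtain N g where N: "negligible N" and g': "\<forall>n. continuous_on UNIV (g n)"
    and lim': "\<forall>x. x \<notin> N \<longrightarrow> (\<lambda>n. g n x) \<longlonglongrightarrow> (if x \<in> UNIV then f x else 0)"
    unfolding measurable_on_def by blast
  have g: "continuous_on UNIV (g n)" for n
    using g' by blast
  have lim: "(\<lambda>n. g n x) \<longlonglongrightarrow> f x" if "x \<notin> N" for x
    using lim' that by simp
  \<comment> \<open>Clamping to [-M, M] gives a uniform bound and does not disturb the limit, since
    the limit already lies in that range.\<close>
  define h where "h n x = max (- M) (min M (g n x))" for n :: nat and x
  have h: "continuous_on S (h n)" for n S
    unfolding h_def using continuous_on_subset[OF g subset_UNIV]
    by (intro continuous_intros)
  have hM: "\<bar>h n x\<bar> \<le> M" for n x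
    using M0 by (auto simp: h_def)
  have "\<forall>n. \<exists>p. real_polynomial_function p \<and> (\<forall>x\<in>cbox a b. \<bar>h n x - p x\<bar> < 1 / real (Suc n))"
  proof
    fix n
    have pos: "0 < 1 / real (Suc n)" by simp
    obtain p where "real_polynomial_function p" "\<And>x. x \<in> cbox a b \<Longrightarrow> \<bar>h n x - p x\<bar> < 1 / real (Suc n)"
      by (rule Stone_Weierstrass_real_polynomial_function[OF compact_cbox[of a b] h[of _ n] pos]) blast
    then show "\<exists>p. real_polynomial_function p \<and> (\<forall>x\<in>cbox a b. \<bar>h n x - p x\<bar> < 1 / real (Suc n))"
      by (intro exI[of _ p]) simp
  qed
  from choice[OF this] obtain p
    where p': "\<forall>n. real_polynomial_function (p n) \<and> (\<forall>x\<in>cbox a b. \<bar>h n x - p n x\<bar> < 1 / real (Suc n))"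
    by (elim exE)
  then have p: "real_polynomial_function (p n)" 
    and hp: "x \<in> cbox a b \<Longrightarrow> \<bar>h n x - p n x\<bar> < 1 / real (Suc n)" for n x
    by simp_all
  define \<theta> where "\<theta> n x = p n x * box_bump n a b x" for n x
  show thesis
  proof (rule that)
    show "\<theta> n \<in> test_functions UNIV" for n
      unfolding \<theta>_def by (intro test_functions_mult smooth_real_polynomial_function p box_bump_test_function)
    show "\<theta> n x = 0" if "x \<notin> box a b" for n x
      using box_bump_eq_0[OF that] by (simp add: \<theta>_def)
    show "\<bar>\<theta> n x\<bar> \<le> M + 1" for n x
    proof (cases "x \<in> box a b")
      case True
      then have "x \<in> cbox a b" using box_subset_cbox by blast
      then have "\<bar>h n x - p n x\<bar> < 1 / real (Suc n)" by (rule hp)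
      moreover have "1 / real (Suc n) \<le> 1" by simp
      ultimately have "\<bar>p n x\<bar> \<le> M + 1" using hM[of n x] by linarith
      then have "\<bar>p n x\<bar> * \<bar>box_bump n a b x\<bar> \<le> (M + 1) * 1"
        using box_bump_bounds[of n a b x] M0 by (intro mult_mono) auto
      then show ?thesis by (simp add: \<theta>_def abs_mult)
    next
      case False
      then show ?thesis using M0 box_bump_eq_0[OF False] by (simp add: \<theta>_def)
    qed
    have "(\<lambda>n. \<theta> n x) \<longlonglongrightarrow> f x" if "x \<notin> N" for x
    proof (cases "x \<in> box a b")
      case True
      then have x: "x \<in> cbox a b" using box_subset_cbox by blast
      have "(\<lambda>n. h n x) \<longlonglongrightarrow> max (- M) (min M (f x))"
        unfolding h_def by (intro tendsto_intros lim that)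
      then have "(\<lambda>n. h n x) \<longlonglongrightarrow> f x"
        using M[of x] by (simp add: max_def min_def abs_le_iff split: if_splits)
      moreover have "(\<lambda>n. h n x - p n x) \<longlonglongrightarrow> 0"
        by (rule Lim_null_comparison[OF _ LIMSEQ_inverse_real_of_nat])
          (use hp[OF x] in \<open>auto simp: inverse_eq_divide intro!: always_eventually less_imp_le\<close>)
      ultimately have "(\<lambda>n. h n x - (h n x - p n x)) \<longlonglongrightarrow> f x - 0"
        by (rule tendsto_diff)
      then have "(\<lambda>n. p n x * box_bump n a b x) \<longlonglongrightarrow> f x * 1"
        by (intro tendsto_mult box_bump_tendsto True) simp
      then show ?thesis by (simp add: \<theta>_def)
    next
      case False
      then show ?thesis by (simp add: \<theta>_def box_bump_eq_0 supp)
    qed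
    moreover have "AE x in lebesgue. x \<notin> N"
      using N by (intro AE_not_in) (simp add: negligible_iff_null_sets)
    ultimately show "AE x in lebesgue. (\<lambda>n. \<theta> n x) \<longlonglongrightarrow> f x"
      by auto
  qed
qed

section \<open>Square integrable functions\<close>

lemma integrable_mult_square_integrable:
  fixes f g :: "'a \<Rightarrow> real"
  assumes "f \<in> borel_measurable M" "g \<in> borel_measurable M"
    and "integrable M (\<lambda>x. (f x)\<^sup>2)" "integrable M (\<lambda>x. (g x)\<^sup>2)"
  shows "integrable M (\<lambda>x. f x * g x)"
proof (rule Bochner_Integration.integrable_bound)
  show "integrable M (\<lambda>x. (f x)\<^sup>2 + (g x)\<^sup>2)" by (intro Bochner_Integration.integrable_add assms)
  show "(\<lambda>x. f x * g x) \<in> borel_measurable M" using assms by measurable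
  have "\<bar>f x * g x\<bar> \<le> (f x)\<^sup>2 + (g x)\<^sup>2" for x
  proof -
    have "2 * (\<bar>f x\<bar> * \<bar>g x\<bar>) \<le> (f x)\<^sup>2 + (g x)\<^sup>2"
      using sum_squares_bound[of "\<bar>f x\<bar>" "\<bar>g x\<bar>"] by simp
    moreover have "0 \<le> \<bar>f x\<bar> * \<bar>g x\<bar>" by simp
    ultimately show ?thesis unfolding abs_mult by linarith
  qed
  then show "AE x in M. norm (f x * g x) \<le> norm ((f x)\<^sup>2 + (g x)\<^sup>2)" by simp
qed

lemma integral_Cauchy_Schwarz:
  fixes f g :: "'a \<Rightarrow> real"
  assumes [measurable]: "f \<in> borel_measurable M" "g \<in> borel_measurable M"
    and f: "integrable M (\<lambda>x. (f x)\<^sup>2)" and g: "integrable M (\<lambda>x. (g x)\<^sup>2)"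
  shows "\<bar>\<integral>x. f x * g x \<partial>M\<bar> \<le> sqrt (\<integral>x. (f x)\<^sup>2 \<partial>M) * sqrt (\<integral>x. (g x)\<^sup>2 \<partial>M)"
proof -
  note fg = integrable_mult_square_integrable[OF assms]
  let ?A = "\<integral>x. (f x)\<^sup>2 \<partial>M" and ?B = "\<integral>x. (g x)\<^sup>2 \<partial>M" and ?C = "\<integral>x. f x * g x \<partial>M"
  have A0: "?A \<ge> 0" and B0: "?B \<ge> 0" by auto
  have "?C\<^sup>2 \<le> ?A * ?B"
  proof (cases "?A = 0")
    case True
    then have "AE x in M. (f x)\<^sup>2 = 0"
      using integral_nonneg_eq_0_iff_AE[OF f] by simp
    then have "AE x in M. f x * g x = 0" by eventually_elim simp
    then have "?C = 0" by (rule integral_eq_zero_AE)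
    then show ?thesis using True by simp
  next
    case False
    \<comment> \<open>Up to the factor A, the integrand is the square of g minus its projection on
      f; expanding gives A (A B - C^2), and A is positive here.\<close>
    have "0 \<le> (\<integral>x. (?A * g x - ?C * f x)\<^sup>2 \<partial>M)" by simp
    also have "(\<lambda>x. (?A * g x - ?C * f x)\<^sup>2) =
        (\<lambda>x. ?A\<^sup>2 * (g x)\<^sup>2 - 2 * ?A * ?C * (f x * g x) + ?C\<^sup>2 * (f x)\<^sup>2)"
      by (simp add: power2_eq_square algebra_simps)
    also have "(\<integral>x. \<dots> x \<partial>M) = ?A\<^sup>2 * ?B - 2 * ?A * ?C * ?C + ?C\<^sup>2 * ?A"
      using f g fg by simp
    also have "\<dots> = ?A * (?A * ?B - ?C\<^sup>2)"
      by (simp add: power2_eq_square algebra_simps)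
    finally show ?thesis
      using False A0 by (simp add: zero_le_mult_iff)
  qed
  then have "sqrt (?C\<^sup>2) \<le> sqrt (?A * ?B)" by (rule real_sqrt_le_mono)
  then show ?thesis by (simp add: real_sqrt_mult)
qed

lemma L2D:
  assumes "f \<in> L2"
  shows "f \<in> borel_measurable lebesgue" "integrable lebesgue (\<lambda>x. (norm (f x))\<^sup>2)"
  using assms by (auto simp: L2_def)

lemma L2_norm_nonneg [simp]: "L2_norm f \<ge> 0"
  by (simp add: L2_norm_def)

lemma L2_norm_square: "(L2_norm f)\<^sup>2 = (\<integral>x. (norm (f x))\<^sup>2 \<partial>lebesgue)"
  by (simp add: L2_norm_def)

lemma L2_integrable_norm_mult:
  assumes "f \<in> L2" "g \<in> L2"
  shows "integrable lebesgue (\<lambda>x. norm (f x) * norm (g x))"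
proof -
  note [measurable] = L2D(1)[OF assms(1)] L2D(1)[OF assms(2)]
  show ?thesis
    by (rule integrable_mult_square_integrable[OF _ _ L2D(2)[OF assms(1)] L2D(2)[OF assms(2)]]) measurable
qed

lemma L2_Cauchy_Schwarz:
  assumes "f \<in> L2" "g \<in> L2"
  shows "(\<integral>x. norm (f x) * norm (g x) \<partial>lebesgue) \<le> L2_norm f * L2_norm g"
proof -
  note [measurable] = L2D(1)[OF assms(1)] L2D(1)[OF assms(2)]
  have "\<bar>\<integral>x. norm (f x) * norm (g x) \<partial>lebesgue\<bar> \<le> L2_norm f * L2_norm g"
    unfolding L2_norm_def
    by (rule integral_Cauchy_Schwarz[OF _ _ L2D(2)[OF assms(1)] L2D(2)[OF assms(2)]]) measurable
  then show ?thesis by linarith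
qed

text \<open>One estimate for both products in use, real scalar times vector and complex times
  complex.\<close>

lemma L2_bilinear:
  fixes p :: "'a::euclidean_space \<Rightarrow> 'b::euclidean_space \<Rightarrow> 'c::euclidean_space"
  assumes "f \<in> L2" "g \<in> L2" 
    and m: "(\<lambda>x. p (f x) (g x)) \<in> borel_measurable lebesgue"
    and b: "\<And>x y. norm (p x y) \<le> norm x * norm y"
  shows "integrable lebesgue (\<lambda>x. p (f x) (g x))"
    and "norm (\<integral>x. p (f x) (g x) \<partial>lebesgue) \<le> L2_norm f * L2_norm g"
proof -
  show i: "integrable lebesgue (\<lambda>x. p (f x) (g x))"
    by (rule Bochner_Integration.integrable_bound[OF L2_integrable_norm_mult[OF assms(1,2)] m]) (simp add: b)
  have "norm (\<integral>x. p (f x) (g x) \<partial>lebesgue) \<le> (\<integral>x. norm (p (f x) (g x)) \<partial>lebesgue)"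
    by (rule integral_norm_bound)
  also have "\<dots> \<le> (\<integral>x. norm (f x) * norm (g x) \<partial>lebesgue)"
    using i L2_integrable_norm_mult[OF assms(1,2)] b by (intro integral_mono) auto
  also have "\<dots> \<le> L2_norm f * L2_norm g" by (rule L2_Cauchy_Schwarz[OF assms(1,2)])
  finally show "norm (\<integral>x. p (f x) (g x) \<partial>lebesgue) \<le> L2_norm f * L2_norm g" .
qed

lemma L2_add:
  assumes "f \<in> L2" "g \<in> L2"
  shows "(\<lambda>x. f x + g x) \<in> L2"
proof -
  note [measurable] = L2D(1)[OF assms(1)] L2D(1)[OF assms(2)]
  have "integrable lebesgue (\<lambda>x. (norm (f x + g x))\<^sup>2)"
  proof (rule Bochner_Integration.integrable_bound)
    show "integrable lebesgue (\<lambda>x. 2 * (norm (f x))\<^sup>2 + 2 * (norm (g x))\<^sup>2)"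
      using assms by (auto dest!: L2D(2))
    have "(norm (f x + g x))\<^sup>2 \<le> 2 * (norm (f x))\<^sup>2 + 2 * (norm (g x))\<^sup>2" for x
    proof -
      have "(norm (f x + g x))\<^sup>2 \<le> (norm (f x) + norm (g x))\<^sup>2"
        by (intro power_mono norm_triangle_ineq) simp
      also have "\<dots> \<le> 2 * (norm (f x))\<^sup>2 + 2 * (norm (g x))\<^sup>2"
        using sum_squares_bound[of "norm (f x)" "norm (g x)"] by (simp add: power2_sum)
      finally show ?thesis .
    qed
    then show "AE x in lebesgue. norm ((norm (f x + g x))\<^sup>2) \<le> norm (2 * (norm (f x))\<^sup>2 + 2 * (norm (g x))\<^sup>2)"
      by simp
  qed measurable
  then show ?thesis by (simp add: L2_def)
qed

lemma L2_uminus: "f \<in> L2 \<Longrightarrow> (\<lambda>x. - f x) \<in> L2"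
  by (auto simp: L2_def)

lemma L2_diff: "f \<in> L2 \<Longrightarrow> g \<in> L2 \<Longrightarrow> (\<lambda>x. f x - g x) \<in> L2"
  using L2_add[of f "\<lambda>x. - g x"] L2_uminus[of g] by simp

lemma L2_norm_triangle:
  assumes "f \<in> L2" "g \<in> L2"
  shows "L2_norm (\<lambda>x. f x + g x) \<le> L2_norm f + L2_norm g"
proof -
  note i = L2D(2)[OF assms(1)] L2D(2)[OF assms(2)] L2_integrable_norm_mult[OF assms]
  have "(L2_norm (\<lambda>x. f x + g x))\<^sup>2 \<le>
      (\<integral>x. (norm (f x))\<^sup>2 + 2 * (norm (f x) * norm (g x)) + (norm (g x))\<^sup>2 \<partial>lebesgue)"
    unfolding L2_norm_square
  proof (rule integral_mono)
    show "(norm (f x + g x))\<^sup>2 \<le> (norm (f x))\<^sup>2 + 2 * (norm (f x) * norm (g x)) + (norm (g x))\<^sup>2" for x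
      using power_mono[OF norm_triangle_ineq[of "f x" "g x"], of 2] by (simp add: power2_sum algebra_simps)
  qed (use i L2D(2)[OF L2_add[OF assms]] in auto)
  also have "\<dots> = (L2_norm f)\<^sup>2 + 2 * (\<integral>x. norm (f x) * norm (g x) \<partial>lebesgue) + (L2_norm g)\<^sup>2"
    using i by (simp add: L2_norm_square)
  also have "\<dots> \<le> (L2_norm f + L2_norm g)\<^sup>2"
    using L2_Cauchy_Schwarz[OF assms] by (simp add: power2_sum)
  finally show ?thesis
    by (rule power2_le_imp_le) simp
qed

text \<open>Preimages under the two functions differ by a subset of a null set, which is measurable
  by completeness. Functions here are only given up to null sets, so this is how measurability
  passes between representatives.\<close>

lemma (in complete_measure) borel_measurable_AE_cong:
  assumes "f \<in> borel_measurable M" and "AE x in M. f x = g x"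
  shows "g \<in> borel_measurable M"
proof (rule measurableI)
  fix A :: "'b set" assume "A \<in> sets borel"
  show "g -` A \<inter> space M \<in> sets M"
  proof (rule in_sets_AE)
    show "f -` A \<inter> space M \<in> sets M"
      using assms(1) \<open>A \<in> sets borel\<close> by (rule measurable_sets)
    show "AE x in M. x \<in> f -` A \<inter> space M \<longleftrightarrow> x \<in> g -` A \<inter> space M"
      using assms(2) by eventually_elim simp
  qed simp
qed simp

lemma complete_measure_lebesgue_on:
  assumes "S \<in> sets lebesgue"
  shows "complete_measure (lebesgue_on S)"
proof
  fix A B :: "'a set"
  assume "B \<subseteq> A" "A \<in> null_sets (lebesgue_on S)"
  then have "A \<in> null_sets lebesgue" "A \<subseteq> S"
    using assms by (simp_all add: null_sets_restrict_space)
  then have "B \<in> sets lebesgue" "B \<subseteq> S"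
    using \<open>B \<subseteq> A\<close> completion.complete by blast+
  then show "B \<in> sets (lebesgue_on S)"
    using assms by (simp add: sets_restrict_space_iff)
qed

lemma L2_AE_cong:
  fixes f g :: "real^3 \<Rightarrow> 'b::euclidean_space"
  assumes "AE x in lebesgue. f x = g x" and "f \<in> L2"
  shows "g \<in> L2" "L2_norm g = L2_norm f"
proof -
  have m [measurable]: "g \<in> borel_measurable lebesgue" "f \<in> borel_measurable lebesgue"
    using L2D(1)[OF assms(2)] assms(1) by (auto intro: completion.borel_measurable_AE_cong)
  have ae: "AE x in lebesgue. (norm (f x))\<^sup>2 = (norm (g x))\<^sup>2"
    using assms(1) by eventually_elim simp
  have "integrable lebesgue (\<lambda>x. (norm (f x))\<^sup>2) \<longleftrightarrow> integrable lebesgue (\<lambda>x. (norm (g x))\<^sup>2)"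
    by (rule integrable_cong_AE[OF _ _ ae]) measurable
  then show "g \<in> L2"
    using L2D(2)[OF assms(2)] m(1) by (simp add: L2_def)
  have "(\<integral>x. (norm (f x))\<^sup>2 \<partial>lebesgue) = (\<integral>x. (norm (g x))\<^sup>2 \<partial>lebesgue)"
    by (rule integral_cong_AE[OF _ _ ae]) measurable
  then show "L2_norm g = L2_norm f"
    by (simp add: L2_norm_def)
qed

lemma borel_measurable_lebesgue_continuous:
  fixes f :: "'a::euclidean_space \<Rightarrow> 'b::topological_space"
  assumes "continuous_on UNIV f"
  shows "f \<in> borel_measurable lebesgue"
proof -
  have "f \<in> borel_measurable lborel"
    using borel_measurable_continuous_onI[OF assms] by simp
  then show ?thesis by (rule measurable_completion)
qed

lemma indicator_L2:
  assumes "A \<in> lmeasurable"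
  shows "(indicator A :: real^3 \<Rightarrow> real) \<in> L2"
proof -
  have [measurable]: "A \<in> sets lebesgue" using assms by blast
  have "(\<lambda>x. (norm (indicator A x :: real))\<^sup>2) = indicator A"
    by (auto simp: indicator_def)
  then show ?thesis
    using assms by (simp add: L2_def integrable_indicator_iff fmeasurable_def)
qed

lemma L2_bounded_support:
  fixes f :: "real^3 \<Rightarrow> 'b::euclidean_space"
  assumes "f \<in> borel_measurable lebesgue" and "A \<in> lmeasurable"
    and "\<And>x. norm (f x) \<le> M" and "\<And>x. x \<notin> A \<Longrightarrow> f x = 0"
  shows "f \<in> L2"
proof -
  note [measurable] = assms(1)
  have "integrable lebesgue (\<lambda>x. (norm (f x))\<^sup>2)"
  proof (rule Bochner_Integration.integrable_bound)
    show "integrable lebesgue (\<lambda>x. M\<^sup>2 * (indicator A x :: real))"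
      using assms(2) by (intro integrable_mult_right) (simp add: lmeasurable_iff_integrable)
    have "(norm (f x))\<^sup>2 \<le> M\<^sup>2 * indicator A x" for x
      using assms(3,4)[of x] power_mono[OF assms(3)[of x], of 2] by (cases "x \<in> A") auto
    then show "AE x in lebesgue. norm ((norm (f x))\<^sup>2) \<le> norm (M\<^sup>2 * (indicator A x :: real))"
      by simp
  qed measurable
  then show ?thesis by (simp add: L2_def)
qed

lemma test_functions_L2:
  fixes \<theta> :: "real^3 \<Rightarrow> real"
  assumes "\<theta> \<in> test_functions U"
  shows "\<theta> \<in> L2"
proof -
  obtain R where R: "\<And>x. norm x > R \<Longrightarrow> \<theta> x = 0"
    using test_functions_ball_support[OF assms] by metis
  obtain M where M: "\<And>x. \<bar>\<theta> x\<bar> \<le> M"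
    using test_functions_bounded[OF assms] by metis
  show ?thesis
  proof (rule L2_bounded_support)
    show "\<theta> \<in> borel_measurable lebesgue"
      by (intro borel_measurable_lebesgue_continuous smooth_continuous_on test_functions_smooth[OF assms])
    show "cball 0 R \<in> lmeasurable" by simp
  qed (use R M in auto)
qed

lemma L2_scaleR:
  fixes f :: "real^3 \<Rightarrow> real" and u :: "real^3 \<Rightarrow> 'b::euclidean_space"
  assumes "f \<in> L2" and "u \<in> L2"
  shows "integrable lebesgue (\<lambda>x. f x *\<^sub>R u x)"
    and "norm (\<integral>x. f x *\<^sub>R u x \<partial>lebesgue) \<le> L2_norm f * L2_norm u"
proof -
  note [measurable] = L2D(1)[OF assms(1)] L2D(1)[OF assms(2)]
  have m: "(\<lambda>x. f x *\<^sub>R u x) \<in> borel_measurable lebesgue" by measurable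
  show "integrable lebesgue (\<lambda>x. f x *\<^sub>R u x)"
    and "norm (\<integral>x. f x *\<^sub>R u x \<partial>lebesgue) \<le> L2_norm f * L2_norm u"
    by (rule L2_bilinear[OF assms m]; simp)+
qed

lemma L2_mult:
  fixes f g :: "real^3 \<Rightarrow> complex"
  assumes "f \<in> L2" and "g \<in> L2"
  shows "integrable lebesgue (\<lambda>x. f x * g x)"
    and "norm (\<integral>x. f x * g x \<partial>lebesgue) \<le> L2_norm f * L2_norm g"
proof -
  note [measurable] = L2D(1)[OF assms(1)] L2D(1)[OF assms(2)]
  have m: "(\<lambda>x. f x * g x) \<in> borel_measurable lebesgue" by measurable
  show "integrable lebesgue (\<lambda>x. f x * g x)"
    and "norm (\<integral>x. f x * g x \<partial>lebesgue) \<le> L2_norm f * L2_norm g"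
    by (rule L2_bilinear[OF assms m]; simp add: norm_mult)+
qed

text \<open>The integrals converge by domination with (M + 1) |u| on the box, a product of two
  square integrable functions. The pointwise data are returned as well, because Hardy's inequality
  needs a second limit along the same sequence.\<close>

lemma L2_test_approx:
  fixes f :: "real^3 \<Rightarrow> real" and u :: "real^3 \<Rightarrow> 'b::euclidean_space"
  assumes u: "u \<in> L2" and f: "f \<in> borel_measurable lebesgue" and M: "\<And>x. \<bar>f x\<bar> \<le> M"
    and supp: "\<And>x. x \<notin> box a b \<Longrightarrow> f x = 0"
  obtains \<theta> where "\<And>n. \<theta> n \<in> test_functions UNIV" "\<And>n x. \<bar>\<theta> n x\<bar> \<le> M + 1"
    "\<And>n x. x \<notin> box a b \<Longrightarrow> \<theta> n x = 0" "AE x in lebesgue. (\<lambda>n. \<theta> n x) \<longlonglongrightarrow> f x"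
    "(\<lambda>n. \<integral>x. \<theta> n x *\<^sub>R u x \<partial>lebesgue) \<longlonglongrightarrow> (\<integral>x. f x *\<^sub>R u x \<partial>lebesgue)"
proof -
  obtain \<theta> where \<theta>: "\<And>n. \<theta> n \<in> test_functions UNIV" "\<And>n x. \<bar>\<theta> n x\<bar> \<le> M + 1"
    "\<And>n x. x \<notin> box a b \<Longrightarrow> \<theta> n x = 0" "AE x in lebesgue. (\<lambda>n. \<theta> n x) \<longlonglongrightarrow> f x"
    by (rule test_functions_dense[OF f M supp]) blast+
  have [measurable]: "u \<in> borel_measurable lebesgue" "\<And>n. \<theta> n \<in> borel_measurable lebesgue"
    using L2D(1)[OF u] L2D(1)[OF test_functions_L2[OF \<theta>(1)]] by blast+
  note [measurable] = f
  have "(\<lambda>n. \<integral>x. \<theta> n x *\<^sub>R u x \<partial>lebesgue) \<longlonglongrightarrow> (\<integral>x. f x *\<^sub>R u x \<partial>lebesgue)"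
  proof (rule integral_dominated_convergence)
    show "integrable lebesgue (\<lambda>x. (M + 1) * (norm (indicator (box a b) x :: real) * norm (u x)))"
      by (intro integrable_mult_right L2_integrable_norm_mult indicator_L2 u) simp
    show "AE x in lebesgue. (\<lambda>n. \<theta> n x *\<^sub>R u x) \<longlonglongrightarrow> f x *\<^sub>R u x"
      using \<theta>(4) by eventually_elim (intro tendsto_intros)
    have "norm (\<theta> n x *\<^sub>R u x) \<le> (M + 1) * (norm (indicator (box a b) x :: real) * norm (u x))" for n x
      using \<theta>(2)[of n x] \<theta>(3)[of x n] by (cases "x \<in> box a b") (auto intro: mult_right_mono)
    then show "AE x in lebesgue. norm (\<theta> n x *\<^sub>R u x) \<le> (M + 1) * (norm (indicator (box a b) x :: real) * norm (u x))" for n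
      by simp
  qed measurable
  with \<theta> show thesis by (rule that)
qed

lemma exhausting_boxes:
  fixes x :: "real^3"
  obtains k :: nat where "x \<in> box (- (\<chi> i. real k)) (\<chi> i. real k)" "r \<le> real k"
proof -
  obtain k :: nat where k: "max (norm x + 1) r < real k" using reals_Archimedean2 by blast
  have "\<bar>x $ i\<bar> < real k" for i
    using component_le_norm_cart[of x i] k by linarith
  then have "x \<in> box (- (\<chi> i. real k)) (\<chi> i. real k)"
    by (auto simp: mem_box_cart abs_less_iff minus_less_iff)
  then show thesis using k by (intro that[of k]) auto
qed

text \<open>The fundamental lemma of the calculus of variations. On a bounded set where u is
  bounded, the truncation f of u is a limit of test functions, so the integral of f u, which is that
  of f^2, vanishes. Such sets exhaust the space.\<close>

lemma L2_fundamental_real: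
  fixes u :: "real^3 \<Rightarrow> real"
  assumes u: "u \<in> L2" and zero: "\<And>\<theta>. \<theta> \<in> test_functions UNIV \<Longrightarrow> (\<integral>x. \<theta> x *\<^sub>R u x \<partial>lebesgue) = 0"
  shows "AE x in lebesgue. u x = 0"
proof -
  note [measurable] = L2D(1)[OF u]
  define A where "A k = {x \<in> box (- (\<chi> i. real k)) (\<chi> i. real k). \<bar>u x\<bar> \<le> real k}" for k
  have "AE x in lebesgue. x \<in> A k \<longrightarrow> u x = 0" for k
  proof -
    have [measurable]: "box (- (\<chi> i. real k)) (\<chi> i. real k :: real^3) \<in> sets lebesgue"
      by simp
    have [measurable]: "A k \<in> sets lebesgue"
      unfolding A_def by measurable
    define f where "f x = indicator (A k) x * u x" for x
    have [measurable]: "f \<in> borel_measurable lebesgue" unfolding f_def by measurable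
    have f1: "\<bar>f x\<bar> \<le> real k" for x
      by (auto simp: f_def indicator_def A_def)
    have f2: "f x = 0" if "x \<notin> box (- (\<chi> i. real k)) (\<chi> i. real k)" for x
      using that by (auto simp: f_def indicator_def A_def)
    obtain \<theta> where \<theta>: "\<And>n. \<theta> n \<in> test_functions UNIV"
      "(\<lambda>n. \<integral>x. \<theta> n x *\<^sub>R u x \<partial>lebesgue) \<longlonglongrightarrow> (\<integral>x. f x *\<^sub>R u x \<partial>lebesgue)"
      by (rule L2_test_approx[OF u \<open>f \<in> borel_measurable lebesgue\<close> f1 f2]) blast+
    have "(\<integral>x. f x *\<^sub>R u x \<partial>lebesgue) = 0"
      using \<theta>(2) unfolding zero[OF \<theta>(1)] by (simp add: LIMSEQ_const_iff)
    moreover have "(\<lambda>x. f x *\<^sub>R u x) = (\<lambda>x. (norm (f x))\<^sup>2)"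
      by (auto simp: f_def indicator_def power2_eq_square)
    moreover have "f \<in> L2"
      by (rule L2_bounded_support[where A="box (- (\<chi> i. real k)) (\<chi> i. real k)"]) (use f1 f2 in auto)
    ultimately have "AE x in lebesgue. (norm (f x))\<^sup>2 = 0"
      using integral_nonneg_eq_0_iff_AE[OF L2D(2)[of f]] by simp
    then show ?thesis
      by eventually_elim (auto simp: f_def)
  qed
  then have "AE x in lebesgue. \<forall>k. x \<in> A k \<longrightarrow> u x = 0"
    by (intro AE_all_countable[THEN iffD2] allI)
  then show ?thesis
  proof eventually_elim
    case (elim x)
    obtain k :: nat where "x \<in> box (- (\<chi> i. real k)) (\<chi> i. real k)" "\<bar>u x\<bar> \<le> real k"
      by (rule exhausting_boxes[of x "\<bar>u x\<bar>"])
    then have "x \<in> A k" unfolding A_def by blast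
    then show ?case using elim by blast
  qed
qed

lemma L2_fundamental:
  fixes u :: "real^3 \<Rightarrow> 'b::euclidean_space"
  assumes u: "u \<in> L2" and zero: "\<And>\<theta>. \<theta> \<in> test_functions UNIV \<Longrightarrow> (\<integral>x. \<theta> x *\<^sub>R u x \<partial>lebesgue) = 0"
  shows "AE x in lebesgue. u x = 0"
proof -
  have "AE x in lebesgue. u x \<bullet> b = 0" if "b \<in> Basis" for b
  proof (rule L2_fundamental_real)
    note [measurable] = L2D(1)[OF u]
    show "(\<lambda>x. u x \<bullet> b) \<in> L2"
      unfolding L2_def
    proof (intro CollectI conjI)
      show "integrable lebesgue (\<lambda>x. (norm (u x \<bullet> b))\<^sup>2)"
      proof (rule Bochner_Integration.integrable_bound[OF L2D(2)[OF u]])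
        show "AE x in lebesgue. norm ((norm (u x \<bullet> b))\<^sup>2) \<le> norm ((norm (u x))\<^sup>2)"
          using power_mono[OF Basis_le_norm[OF that] abs_ge_zero, where n=2] by (intro always_eventually allI) (simp add: power2_abs)
      qed measurable
    qed measurable
    fix \<theta> :: "real^3 \<Rightarrow> real" assume \<theta>: "\<theta> \<in> test_functions UNIV"
    have "(\<integral>x. \<theta> x *\<^sub>R (u x \<bullet> b) \<partial>lebesgue) = (\<integral>x. (\<theta> x *\<^sub>R u x) \<bullet> b \<partial>lebesgue)"
      by simp
    also have "\<dots> = (\<integral>x. \<theta> x *\<^sub>R u x \<partial>lebesgue) \<bullet> b"
      by (intro integral_inner_left L2_scaleR(1) test_functions_L2[OF \<theta>] u)
    finally show "(\<integral>x. \<theta> x *\<^sub>R (u x \<bullet> b) \<partial>lebesgue) = 0"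
      using zero[OF \<theta>] by simp
  qed
  then have "AE x in lebesgue. \<forall>b\<in>Basis. u x \<bullet> b = 0"
    by (simp add: AE_finite_all)
  then show ?thesis
    by eventually_elim (simp add: euclidean_eq_iff[where 'a='b])
qed

section \<open>Weak gradients\<close>

lemma borel_measurable_cvec:
  fixes f :: "'a \<Rightarrow> complex^3"
  assumes "\<And>j. (\<lambda>x. f x $ j) \<in> borel_measurable M"
  shows "f \<in> borel_measurable M"
proof (rule borel_measurable_euclidean_space[THEN iffD2], rule ballI)
  fix b :: "complex^3" assume "b \<in> Basis"
  then obtain j c where "b = axis j c" unfolding Basis_vec_def by blast
  then have "(\<lambda>x. f x \<bullet> b) = (\<lambda>x. f x $ j \<bullet> c)"
    by (simp add: inner_axis)
  moreover have "(\<lambda>x. f x $ j \<bullet> c) \<in> borel_measurable M"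
    using assms[of j] by measurable
  ultimately show "(\<lambda>x. f x \<bullet> b) \<in> borel_measurable M" by simp
qed

lemma borel_measurable_vec_nth [measurable]:
  fixes f :: "'a \<Rightarrow> complex^3"
  assumes [measurable]: "f \<in> borel_measurable M"
  shows "(\<lambda>x. f x $ j) \<in> borel_measurable M"
  by (rule borel_measurable_continuous_on[OF _ assms, where f="\<lambda>v. v $ j"]) (intro continuous_intros)

lemma L2_component:
  fixes g :: "real^3 \<Rightarrow> complex^3"
  assumes "g \<in> L2"
  shows "(\<lambda>x. g x $ j) \<in> L2"
proof -
  note [measurable] = L2D(1)[OF assms]
  have "integrable lebesgue (\<lambda>x. (norm (g x $ j))\<^sup>2)"
  proof (rule Bochner_Integration.integrable_bound[OF L2D(2)[OF assms]])
    show "AE x in lebesgue. norm ((norm (g x $ j))\<^sup>2) \<le> norm ((norm (g x))\<^sup>2)"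
      by (simp add: power_mono Finite_Cartesian_Product.norm_nth_le)
  qed measurable
  then show ?thesis by (simp add: L2_def)
qed

lemma norm_cvec_square: "(norm (v :: complex^3))\<^sup>2 = (\<Sum>j\<in>UNIV. (norm (v $ j))\<^sup>2)"
  by (simp add: norm_vec_def L2_set_def sum_nonneg)

lemma has_weak_gradient_integrable:
  assumes "\<theta> \<in> test_functions UNIV" and "u \<in> L2" and "g \<in> L2"
  shows "integrable lebesgue (\<lambda>x. frechet_derivative \<theta> (at x) (axis j 1) *\<^sub>R u x)"
    and "integrable lebesgue (\<lambda>x. \<theta> x *\<^sub>R ((g :: real^3 \<Rightarrow> complex^3) x $ j))"
proof -
  have "axis j 1 \<in> (Basis :: (real^3) set)" by simp
  from test_functions_L2[OF test_functions_partial[OF assms(1) this]]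
  show "integrable lebesgue (\<lambda>x. frechet_derivative \<theta> (at x) (axis j 1) *\<^sub>R u x)"
    by (rule L2_scaleR(1)[OF _ assms(2)])
  show "integrable lebesgue (\<lambda>x. \<theta> x *\<^sub>R (g x $ j))"
    by (rule L2_scaleR(1)[OF test_functions_L2[OF assms(1)] L2_component[OF assms(3)]])
qed

lemma has_weak_gradient_add:
  assumes "u \<in> L2" "v \<in> L2" "g \<in> L2" "h \<in> L2" "has_weak_gradient u g" "has_weak_gradient v h"
  shows "has_weak_gradient (\<lambda>x. u x + v x) (\<lambda>x. g x + h x)"
  unfolding has_weak_gradient_def
proof (intro ballI allI)
  fix \<theta> j assume \<theta>: "\<theta> \<in> test_functions (UNIV :: (real^3) set)"
  note i = has_weak_gradient_integrable[OF \<theta> assms(1,3), of j] has_weak_gradient_integrable[OF \<theta> assms(2,4), of j]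
  show "(\<integral>x. frechet_derivative \<theta> (at x) (axis j 1) *\<^sub>R (u x + v x) \<partial>lebesgue) =
      - (\<integral>x. \<theta> x *\<^sub>R ((g x + h x) $ j) \<partial>lebesgue)"
    using assms(5,6) \<theta> i unfolding has_weak_gradient_def by (simp add: scaleR_add_right)
qed

lemma has_weak_gradient_scale:
  assumes "has_weak_gradient u g"
  shows "has_weak_gradient (\<lambda>x. c * u x) (\<lambda>x. c *s g x)"
  using assms unfolding has_weak_gradient_def
  by (simp add: mult_scaleR_right[symmetric] del: mult_scaleR_right)

lemma has_weak_gradient_cnj:
  assumes "has_weak_gradient u g"
  shows "has_weak_gradient (\<lambda>x. cnj (u x)) (\<lambda>x. \<chi> j. cnj (g x $ j))"
  unfolding has_weak_gradient_def
proof (intro ballI allI)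
  fix \<theta> j assume \<theta>: "\<theta> \<in> test_functions (UNIV :: (real^3) set)"
  have e: "(\<integral>x. frechet_derivative \<theta> (at x) (axis j 1) *\<^sub>R u x \<partial>lebesgue) =
      - (\<integral>x. \<theta> x *\<^sub>R (g x $ j) \<partial>lebesgue)"
    using assms \<theta> unfolding has_weak_gradient_def by blast
  have "(\<integral>x. frechet_derivative \<theta> (at x) (axis j 1) *\<^sub>R cnj (u x) \<partial>lebesgue) =
      (\<integral>x. cnj (frechet_derivative \<theta> (at x) (axis j 1) *\<^sub>R u x) \<partial>lebesgue)" by simp
  also have "\<dots> = cnj (- (\<integral>x. \<theta> x *\<^sub>R (g x $ j) \<partial>lebesgue))"
    using Bochner_Integration.integral_cnj[of lebesgue "\<lambda>x. frechet_derivative \<theta> (at x) (axis j 1) *\<^sub>R u x"] e by simp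
  also have "\<dots> = - (\<integral>x. cnj (\<theta> x *\<^sub>R (g x $ j)) \<partial>lebesgue)"
    using Bochner_Integration.integral_cnj[of lebesgue "\<lambda>x. \<theta> x *\<^sub>R (g x $ j)"] by simp
  finally show "(\<integral>x. frechet_derivative \<theta> (at x) (axis j 1) *\<^sub>R cnj (u x) \<partial>lebesgue) =
      - (\<integral>x. \<theta> x *\<^sub>R ((\<chi> j. cnj (g x $ j)) $ j) \<partial>lebesgue)" by simp
qed

lemma W12_L2: "u \<in> W12 \<Longrightarrow> u \<in> L2"
  by (simp add: W12_def)

lemma weak_gradient_works:
  assumes "u \<in> W12"
  shows "weak_gradient u \<in> L2" "has_weak_gradient u (weak_gradient u)"
proof -
  have "\<exists>g. g \<in> L2 \<and> has_weak_gradient u g" using assms by (auto simp: W12_def)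
  from someI_ex[OF this] show "weak_gradient u \<in> L2" "has_weak_gradient u (weak_gradient u)"
    by (auto simp: weak_gradient_def)
qed

lemma has_weak_gradient_unique:
  assumes "g \<in> L2" "h \<in> L2" "has_weak_gradient u g" "has_weak_gradient u h"
  shows "AE x in lebesgue. g x = h x"
proof -
  have "AE x in lebesgue. g x $ j - h x $ j = 0" for j
  proof (rule L2_fundamental)
    show "(\<lambda>x. g x $ j - h x $ j) \<in> L2"
      by (intro L2_diff L2_component assms)
    fix \<theta> :: "real^3 \<Rightarrow> real" assume \<theta>: "\<theta> \<in> test_functions UNIV"
    note i = L2_scaleR(1)[OF test_functions_L2[OF \<theta>] L2_component[OF assms(1)], of j]
      L2_scaleR(1)[OF test_functions_L2[OF \<theta>] L2_component[OF assms(2)], of j]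
    show "(\<integral>x. \<theta> x *\<^sub>R (g x $ j - h x $ j) \<partial>lebesgue) = 0"
      using assms(3,4) \<theta> i unfolding has_weak_gradient_def
      by (simp add: scaleR_diff_right)
  qed
  then have "AE x in lebesgue. \<forall>j\<in>UNIV. g x $ j - h x $ j = 0"
    by (intro AE_finite_all[THEN iffD2] ballI) simp
  then show ?thesis
    by eventually_elim (simp add: vec_eq_iff)
qed

text \<open>By uniqueness, exhibiting any weak gradient in L2 determines the chosen one up to a null
  set. The algebraic closure properties of \<open>W12\<close> all follow this pattern.\<close>

lemma weak_gradient_AE_eq:
  assumes "u \<in> L2" "g \<in> L2" "has_weak_gradient u g"
  shows "u \<in> W12" "AE x in lebesgue. weak_gradient u x = g x"
    "L2_norm (weak_gradient u) = L2_norm g"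
proof -
  show u: "u \<in> W12" using assms by (auto simp: W12_def)
  show ae: "AE x in lebesgue. weak_gradient u x = g x"
    using weak_gradient_works[OF u] assms(2,3) by (intro has_weak_gradient_unique)
  have "AE x in lebesgue. g x = weak_gradient u x"
    using ae by eventually_elim simp
  then show "L2_norm (weak_gradient u) = L2_norm g"
    by (rule L2_AE_cong(2)[OF _ assms(2)])
qed

lemma W12_norm_eq: "W12_norm u = sqrt ((L2_norm (weak_gradient u))\<^sup>2 + (L2_norm u)\<^sup>2)"
  by (simp add: W12_norm_def L2_norm_square)

lemma W12_norm_nonneg [simp]: "W12_norm u \<ge> 0"
  by (simp add: W12_norm_eq)

lemma L2_norm_le_W12_norm: "L2_norm u \<le> W12_norm u"
  and L2_norm_weak_gradient_le_W12_norm: "L2_norm (weak_gradient u) \<le> W12_norm u"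
  unfolding W12_norm_eq by (rule real_le_rsqrt, simp)+

lemma W12_add:
  assumes "u \<in> W12" "v \<in> W12"
  shows "(\<lambda>x. u x + v x) \<in> W12"
    "AE x in lebesgue. weak_gradient (\<lambda>x. u x + v x) x = weak_gradient u x + weak_gradient v x"
proof -
  note u = weak_gradient_works[OF assms(1)] W12_L2[OF assms(1)]
  note v = weak_gradient_works[OF assms(2)] W12_L2[OF assms(2)]
  show "(\<lambda>x. u x + v x) \<in> W12"
    "AE x in lebesgue. weak_gradient (\<lambda>x. u x + v x) x = weak_gradient u x + weak_gradient v x"
    by (rule weak_gradient_AE_eq[OF L2_add[OF u(3) v(3)] L2_add[OF u(1) v(1)]
        has_weak_gradient_add[OF u(3) v(3) u(1) v(1) u(2) v(2)]])+
qed

lemma L2_scale: 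
  assumes "u \<in> L2"
  shows "(\<lambda>x. (c::complex) * u x) \<in> L2" "L2_norm (\<lambda>x. c * u x) = norm c * L2_norm u"
proof -
  note [measurable] = L2D(1)[OF assms]
  show "(\<lambda>x. c * u x) \<in> L2"
    using L2D(2)[OF assms] by (simp add: L2_def norm_mult power_mult_distrib)
  show "L2_norm (\<lambda>x. c * u x) = norm c * L2_norm u"
    by (simp add: L2_norm_def norm_mult power_mult_distrib real_sqrt_mult)
qed

lemma norm_vector_scale: "norm (c *s (v::complex^3)) = norm c * norm v"
proof -
  have "(norm (c *s v))\<^sup>2 = (norm c * norm v)\<^sup>2"
    unfolding norm_cvec_square power_mult_distrib by (simp add: norm_mult power_mult_distrib sum_distrib_left)
  then show ?thesis by (simp add: power2_eq_iff_nonneg)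
qed

lemma norm_vector_cnj: "norm (\<chi> j. cnj ((v::complex^3) $ j)) = norm v"
proof -
  have "(norm (\<chi> j. cnj (v $ j)))\<^sup>2 = (norm v)\<^sup>2"
    unfolding norm_cvec_square by simp
  then show ?thesis by (simp add: power2_eq_iff_nonneg)
qed

lemma W12_scale:
  assumes "u \<in> W12"
  shows "(\<lambda>x. c * u x) \<in> W12" "AE x in lebesgue. weak_gradient (\<lambda>x. c * u x) x = c *s weak_gradient u x"
    "W12_norm (\<lambda>x. c * u x) = norm c * W12_norm u"
proof -
  note u = weak_gradient_works[OF assms] W12_L2[OF assms]
  note [measurable] = L2D(1)[OF u(1)]
  have "(\<lambda>x. c *s weak_gradient u x) \<in> borel_measurable lebesgue"
    by (rule borel_measurable_cvec) simp
  then have g: "(\<lambda>x. c *s weak_gradient u x) \<in> L2"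
    using L2D(2)[OF u(1)] by (simp add: L2_def norm_vector_scale power_mult_distrib)
  have n: "L2_norm (\<lambda>x. c *s weak_gradient u x) = norm c * L2_norm (weak_gradient u)"
    by (simp add: L2_norm_def norm_vector_scale power_mult_distrib real_sqrt_mult)
  note w = weak_gradient_AE_eq[OF L2_scale(1)[OF u(3)] g has_weak_gradient_scale[OF u(2)]]
  show "(\<lambda>x. c * u x) \<in> W12" "AE x in lebesgue. weak_gradient (\<lambda>x. c * u x) x = c *s weak_gradient u x"
    by (rule w(1), rule w(2))
  show "W12_norm (\<lambda>x. c * u x) = norm c * W12_norm u"
    unfolding W12_norm_eq w(3) n L2_scale(2)[OF u(3)] power_mult_distrib distrib_left[symmetric]
    by (simp add: real_sqrt_mult)
qed

lemma L2_cnj: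
  assumes "u \<in> L2"
  shows "(\<lambda>x. cnj (u x)) \<in> L2" "L2_norm (\<lambda>x. cnj (u x)) = L2_norm u"
proof -
  have "(\<lambda>x. cnj (u x)) \<in> borel_measurable lebesgue"
    by (rule borel_measurable_continuous_on[OF _ L2D(1)[OF assms], where f=cnj]) (intro continuous_intros)
  then show "(\<lambda>x. cnj (u x)) \<in> L2" "L2_norm (\<lambda>x. cnj (u x)) = L2_norm u"
    using L2D(2)[OF assms] by (simp_all add: L2_def L2_norm_def)
qed

text \<open>\<open>embed\<close> is bilinear, so an inner product appears as a pairing with a
  conjugate. Conjugation therefore has to preserve \<open>W12\<close> and its norm.\<close>

lemma W12_cnj:
  assumes "u \<in> W12"
  shows "(\<lambda>x. cnj (u x)) \<in> W12"
    "AE x in lebesgue. weak_gradient (\<lambda>x. cnj (u x)) x = (\<chi> j. cnj (weak_gradient u x $ j))"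
    "W12_norm (\<lambda>x. cnj (u x)) = W12_norm u"
proof -
  note u = weak_gradient_works[OF assms] W12_L2[OF assms]
  have "(\<lambda>x. \<chi> j. cnj (weak_gradient u x $ j)) \<in> borel_measurable lebesgue"
    by (rule borel_measurable_cvec) (simp add: L2D(1)[OF L2_cnj(1)[OF L2_component[OF u(1)]]])
  then have g: "(\<lambda>x. \<chi> j. cnj (weak_gradient u x $ j)) \<in> L2"
    using L2D(2)[OF u(1)] by (simp add: L2_def norm_vector_cnj)
  have n: "L2_norm (\<lambda>x. \<chi> j. cnj (weak_gradient u x $ j)) = L2_norm (weak_gradient u)"
    by (simp add: L2_norm_def norm_vector_cnj)
  note w = weak_gradient_AE_eq[OF L2_cnj(1)[OF u(3)] g has_weak_gradient_cnj[OF u(2)]]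
  show "(\<lambda>x. cnj (u x)) \<in> W12"
    "AE x in lebesgue. weak_gradient (\<lambda>x. cnj (u x)) x = (\<chi> j. cnj (weak_gradient u x $ j))"
    by (rule w(1), rule w(2))
  show "W12_norm (\<lambda>x. cnj (u x)) = W12_norm u"
    unfolding W12_norm_eq w(3) n L2_cnj(2)[OF u(3)] ..
qed

lemma W12_diff:
  assumes "u \<in> W12" "v \<in> W12"
  shows "(\<lambda>x. u x - v x) \<in> W12"
    "AE x in lebesgue. weak_gradient (\<lambda>x. u x - v x) x = weak_gradient u x - weak_gradient v x"
proof -
  note m = W12_scale[OF assms(2), of "-1"]
  have eq: "(\<lambda>x. u x + - 1 * v x) = (\<lambda>x. u x - v x)" by simp
  note a = W12_add[OF assms(1) m(1), unfolded eq]
  show "(\<lambda>x. u x - v x) \<in> W12" by (rule a(1))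
  show "AE x in lebesgue. weak_gradient (\<lambda>x. u x - v x) x = weak_gradient u x - weak_gradient v x"
    using a(2) m(2) by eventually_elim simp
qed

section \<open>The dual space\<close>

lemma W12_dualD:
  assumes "F \<in> W12_dual"
  shows "u \<in> W12 \<Longrightarrow> v \<in> W12 \<Longrightarrow> F (\<lambda>x. u x + v x) = F u + F v"
    and "u \<in> W12 \<Longrightarrow> F (\<lambda>x. c * u x) = c * F u"
    and "u \<in> W12 \<Longrightarrow> v \<in> W12 \<Longrightarrow> F (\<lambda>x. u x - v x) = F u - F v"
proof -
  show add: "u \<in> W12 \<Longrightarrow> v \<in> W12 \<Longrightarrow> F (\<lambda>x. u x + v x) = F u + F v" for u v
    using assms by (simp add: W12_dual_def)
  show scale: "u \<in> W12 \<Longrightarrow> F (\<lambda>x. c * u x) = c * F u" for u c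
    using assms by (simp add: W12_dual_def)
  show "u \<in> W12 \<Longrightarrow> v \<in> W12 \<Longrightarrow> F (\<lambda>x. u x - v x) = F u - F v"
    using add[of u "\<lambda>x. - 1 * v x"] scale[of v "- 1"] W12_scale(1)[of v "- 1"] by simp
qed

lemma W12_dual_bound:
  assumes F: "F \<in> W12_dual" and v: "v \<in> W12"
  shows "norm (F v) \<le> W12_dual_norm F * W12_norm v"
proof -
  obtain C where C: "\<And>u. u \<in> W12 \<Longrightarrow> norm (F u) \<le> C * W12_norm u"
    using F unfolding W12_dual_def by blast
  show ?thesis
  \<comment> \<open>A null vector of the seminorm cannot be normalised; for it, boundedness forces F
    v = 0.\<close>
  proof (cases "W12_norm v = 0")
    case True
    then show ?thesis using C[OF v] by simp
  next
    case False
    then have pos: "W12_norm v > 0" using W12_norm_nonneg[of v] by linarith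
    define c where "c = complex_of_real (1 / W12_norm v)"
    have c: "norm c = 1 / W12_norm v"
      using pos by (simp add: c_def norm_divide)
    have "W12_norm (\<lambda>x. c * v x) = 1"
      using pos by (simp add: W12_scale(3)[OF v] c)
    then have mem: "(\<lambda>x. c * v x) \<in> {v \<in> W12. W12_norm v \<le> 1}"
      using W12_scale(1)[OF v] by simp
    have "bdd_above ((\<lambda>v. norm (F v)) ` {v \<in> W12. W12_norm v \<le> 1})"
    proof (rule bdd_aboveI2)
      fix u assume u: "u \<in> {v \<in> W12. W12_norm v \<le> 1}"
      then have "norm (F u) \<le> C * W12_norm u" using C by simp
      also have "\<dots> \<le> \<bar>C\<bar> * 1" using u by (intro mult_mono) auto
      finally show "norm (F u) \<le> \<bar>C\<bar>" by simp
    qed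
    from cSUP_upper[OF mem this] have "norm (F (\<lambda>x. c * v x)) \<le> W12_dual_norm F"
      by (simp add: W12_dual_norm_def)
    moreover have "norm (F (\<lambda>x. c * v x)) = norm (F v) / W12_norm v"
      by (simp add: W12_dualD(2)[OF F v] norm_mult c)
    ultimately show ?thesis using pos by (simp add: field_simps)
  qed
qed

lemma W12_dual_diff:
  assumes "F \<in> W12_dual" "G \<in> W12_dual"
  shows "F - G \<in> W12_dual"
proof -
  obtain C where C: "\<And>u. u \<in> W12 \<Longrightarrow> norm (F u) \<le> C * W12_norm u"
    using assms(1) unfolding W12_dual_def by blast
  obtain D where D: "\<And>u. u \<in> W12 \<Longrightarrow> norm (G u) \<le> D * W12_norm u"
    using assms(2) unfolding W12_dual_def by blast
  have "norm ((F - G) u) \<le> (C + D) * W12_norm u" if "u \<in> W12" for u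
    using norm_triangle_ineq4[of "F u" "G u"] C[OF that] D[OF that] by (simp add: algebra_simps)
  then have "\<exists>C. \<forall>u\<in>W12. norm ((F - G) u) \<le> C * W12_norm u" by blast
  then show ?thesis
    unfolding W12_dual_def using W12_dualD(1,2)[OF assms(1)] W12_dualD(1,2)[OF assms(2)]
    by (simp add: algebra_simps)
qed

section \<open>Hardy's inequality\<close>

text \<open>Differentiation under the integral: the mean value inequality turns the bound on the
  derivative into a bound on the difference quotients, and dominated convergence applies along every
  sequence of parameters.\<close>

lemma has_field_derivative_integral:
  fixes f f' :: "real \<Rightarrow> 'a \<Rightarrow> real"
  assumes d: "d > 0"
    and int: "\<And>\<nu>. \<bar>\<nu> - \<mu>\<bar> < d \<Longrightarrow> integrable M (f \<nu>)"
    and deriv: "\<And>\<nu> x. \<bar>\<nu> - \<mu>\<bar> < d \<Longrightarrow> ((\<lambda>\<nu>. f \<nu> x) has_field_derivative f' \<nu> x) (at \<nu>)"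
    and bound: "\<And>\<nu> x. \<bar>\<nu> - \<mu>\<bar> < d \<Longrightarrow> \<bar>f' \<nu> x\<bar> \<le> w x"
    and w: "integrable M w" and m: "f' \<mu> \<in> borel_measurable M"
  shows "((\<lambda>\<nu>. \<integral>x. f \<nu> x \<partial>M) has_field_derivative (\<integral>x. f' \<mu> x \<partial>M)) (at \<mu>)"
  unfolding has_field_derivative_iff tendsto_at_iff_sequentially
proof (intro allI impI)
  fix X :: "nat \<Rightarrow> real"
  assume X: "\<forall>i. X i \<in> UNIV - {\<mu>}" and lim: "X \<longlonglongrightarrow> \<mu>"
  have "\<forall>\<^sub>F i in sequentially. dist (X i) \<mu> < d"
    using lim d by (rule tendstoD)
  then obtain N where "\<forall>i\<ge>N. dist (X i) \<mu> < d" by (auto simp: eventually_sequentially)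
  then have N: "\<bar>X (i + N) - \<mu>\<bar> < d" for i by (simp add: dist_real_def)
  \<comment> \<open>The domination must hold for every index, so the finitely many terms outside the
    d-ball are dropped.\<close>
  define Y where "Y i = X (i + N)" for i
  have Y: "\<bar>Y i - \<mu>\<bar> < d" "Y i \<noteq> \<mu>" for i
    using N X by (auto simp: Y_def)
  have limY: "Y \<longlonglongrightarrow> \<mu>"
    unfolding Y_def by (rule LIMSEQ_ignore_initial_segment[OF lim])
  have \<mu>: "\<bar>\<mu> - \<mu>\<bar> < d" using d by simp
  have ball: "z \<in> ball \<mu> d \<longleftrightarrow> \<bar>z - \<mu>\<bar> < d" for z
    by (simp add: dist_real_def abs_minus_commute)
  have fm: "f (Y i) \<in> borel_measurable M" "f \<mu> \<in> borel_measurable M" for i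
    using int[OF Y(1)] int[OF \<mu>] by (auto intro: borel_measurable_integrable)
  have "(\<lambda>i. \<integral>x. (f (Y i) x - f \<mu> x) / (Y i - \<mu>) \<partial>M) \<longlonglongrightarrow> (\<integral>x. f' \<mu> x \<partial>M)"
  proof (rule integral_dominated_convergence)
    show "AE x in M. (\<lambda>i. (f (Y i) x - f \<mu> x) / (Y i - \<mu>)) \<longlonglongrightarrow> f' \<mu> x"
    proof (intro always_eventually allI)
      fix x
      have "((\<lambda>\<nu>. (f \<nu> x - f \<mu> x) / (\<nu> - \<mu>)) \<longlongrightarrow> f' \<mu> x) (at \<mu>)"
        using deriv[OF \<mu>] by (simp add: has_field_derivative_iff)
      then show "(\<lambda>i. (f (Y i) x - f \<mu> x) / (Y i - \<mu>)) \<longlonglongrightarrow> f' \<mu> x"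
        unfolding tendsto_at_iff_sequentially using limY Y(2) by (auto simp: o_def)
    qed
    show "AE x in M. norm ((f (Y i) x - f \<mu> x) / (Y i - \<mu>)) \<le> w x" for i
    proof (intro always_eventually allI)
      fix x
      have "norm (f (Y i) x - f \<mu> x) \<le> w x * norm (Y i - \<mu>)"
      proof (rule field_differentiable_bound[where S="ball \<mu> d"])
        show "((\<lambda>\<nu>. f \<nu> x) has_field_derivative f' z x) (at z within ball \<mu> d)" if "z \<in> ball \<mu> d" for z
          using that unfolding ball by (rule has_field_derivative_at_within[OF deriv])
        show "norm (f' z x) \<le> w x" if "z \<in> ball \<mu> d" for z
          using that bound unfolding ball real_norm_def by blast
        show "Y i \<in> ball \<mu> d" "\<mu> \<in> ball \<mu> d"
          unfolding ball by (rule Y(1), rule \<mu>)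
      qed simp
      then show "norm ((f (Y i) x - f \<mu> x) / (Y i - \<mu>)) \<le> w x"
        using Y(2)[of i] by (simp add: field_simps)
    qed
    show "(\<lambda>x. (f (Y i) x - f \<mu> x) / (Y i - \<mu>)) \<in> borel_measurable M" for i
      using fm by (intro borel_measurable_divide borel_measurable_diff) auto
  qed (use m w in auto)
  moreover have "(\<integral>x. (f (Y i) x - f \<mu> x) / (Y i - \<mu>) \<partial>M) =
      ((\<integral>x. f (Y i) x \<partial>M) - (\<integral>x. f \<mu> x \<partial>M)) / (Y i - \<mu>)" for i
    using int[OF Y(1)] int[OF \<mu>] by simp
  ultimately have "(\<lambda>i. ((\<integral>x. f (X (i + N)) x \<partial>M) - (\<integral>x. f \<mu> x \<partial>M)) / (X (i + N) - \<mu>)) \<longlonglongrightarrow> (\<integral>x. f' \<mu> x \<partial>M)"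
    by (simp only: Y_def)
  then have "(\<lambda>i. ((\<integral>x. f (X i) x \<partial>M) - (\<integral>x. f \<mu> x \<partial>M)) / (X i - \<mu>)) \<longlonglongrightarrow> (\<integral>x. f' \<mu> x \<partial>M)"
    by (rule LIMSEQ_offset)
  then show "((\<lambda>\<nu>. ((\<integral>x. f \<nu> x \<partial>M) - (\<integral>x. f \<mu> x \<partial>M)) / (\<nu> - \<mu>)) \<circ> X) \<longlonglongrightarrow> (\<integral>x. f' \<mu> x \<partial>M)"
    by (simp add: o_def)
qed

lemma integral_dilation:
  fixes F :: "'a::euclidean_space \<Rightarrow> real"
  assumes F: "continuous_on UNIV F" and c: "c > 0"
  shows "(\<integral>x. F (p + c *\<^sub>R (x - p)) \<partial>lebesgue) = (\<integral>x. F x \<partial>lebesgue) / c ^ DIM('a)"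
proof -
  have [measurable]: "F \<in> borel_measurable borel" by (rule borel_measurable_continuous_onI[OF F])
  define t where "t = p - c *\<^sub>R p"
  have eq: "p + c *\<^sub>R (x - p) = t + c *\<^sub>R x" for x
    by (simp add: t_def algebra_simps)
  have "(\<integral>x. F x \<partial>lborel) = (\<integral>x. F x \<partial>(density (distr lborel borel (\<lambda>x. t + c *\<^sub>R x)) (\<lambda>_. ennreal (\<bar>c\<bar> ^ DIM('a)))))"
    using lborel_affine[of c t] c by (simp add: ennreal_power)
  also have "\<dots> = c ^ DIM('a) * (\<integral>x. F (t + c *\<^sub>R x) \<partial>lborel)"
    using c by (subst integral_density) (auto simp: integral_distr)
  finally have "(\<integral>x. F (t + c *\<^sub>R x) \<partial>lborel) = (\<integral>x. F x \<partial>lborel) / c ^ DIM('a)"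
    using c by (simp add: field_simps)
  moreover have "(\<lambda>x. F (t + c *\<^sub>R x)) \<in> borel_measurable lborel" by measurable
  ultimately show ?thesis
    by (simp add: eq integral_completion)
qed

lemma L2_Re:
  assumes "u \<in> L2"
  shows "(\<lambda>x. Re (u x)) \<in> L2" "L2_norm (\<lambda>x. Re (u x)) \<le> L2_norm u"
proof -
  note [measurable] = L2D(1)[OF assms]
  have le: "(Re (u x))\<^sup>2 \<le> (norm (u x))\<^sup>2" for x
    by (simp add: cmod_power2)
  have i: "integrable lebesgue (\<lambda>x. (norm (Re (u x)))\<^sup>2)"
    by (rule Bochner_Integration.integrable_bound[OF L2D(2)[OF assms]]) (use le in auto)
  then show "(\<lambda>x. Re (u x)) \<in> L2" by (simp add: L2_def)
  show "L2_norm (\<lambda>x. Re (u x)) \<le> L2_norm u"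
    unfolding L2_norm_def using i L2D(2)[OF assms] le
    by (intro real_sqrt_le_mono integral_mono) auto
qed

lemma weak_gradient_Re:
  assumes "u \<in> W12" and "\<eta> \<in> test_functions UNIV"
  shows "(\<integral>x. frechet_derivative \<eta> (at x) (axis j 1) * Re (u x) \<partial>lebesgue) =
    - (\<integral>x. \<eta> x * Re (weak_gradient u x $ j) \<partial>lebesgue)"
proof -
  note g = weak_gradient_works[OF assms(1)]
  note i = has_weak_gradient_integrable[OF assms(2) W12_L2[OF assms(1)] g(1), of j]
  have "(\<integral>x. frechet_derivative \<eta> (at x) (axis j 1) * Re (u x) \<partial>lebesgue) =
      Re (\<integral>x. frechet_derivative \<eta> (at x) (axis j 1) *\<^sub>R u x \<partial>lebesgue)"
    using integral_Re[OF i(1)] by simp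
  also have "\<dots> = Re (- (\<integral>x. \<eta> x *\<^sub>R (weak_gradient u x $ j) \<partial>lebesgue))"
    using g(2) assms(2) unfolding has_weak_gradient_def by simp
  also have "\<dots> = - (\<integral>x. \<eta> x * Re (weak_gradient u x $ j) \<partial>lebesgue)"
    using integral_Re[OF i(2)] by simp
  finally show ?thesis .
qed

lemma frechet_derivative_components:
  fixes \<theta> :: "real^3 \<Rightarrow> real"
  assumes "smooth \<theta>"
  shows "frechet_derivative \<theta> (at y) h = (\<Sum>j\<in>UNIV. h $ j * frechet_derivative \<theta> (at y) (axis j 1))"
proof -
  have lin: "linear (frechet_derivative \<theta> (at y))"
    by (rule linear_frechet_derivative[OF smooth_differentiable[OF assms]])
  have "h = (\<Sum>j\<in>UNIV. h $ j *\<^sub>R axis j 1)"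
    using basis_expansion[of h] by (simp add: scalar_mult_eq_scaleR)
  then have "frechet_derivative \<theta> (at y) h = frechet_derivative \<theta> (at y) (\<Sum>j\<in>UNIV. h $ j *\<^sub>R axis j 1)"
    by simp
  also have "\<dots> = (\<Sum>j\<in>UNIV. h $ j * frechet_derivative \<theta> (at y) (axis j 1))"
    by (simp add: linear_sum[OF lin] linear_scale[OF lin])
  finally show ?thesis .
qed

text \<open>The generator of the dilations about \<open>p\<close>, applied to the rescaled test function, is a
  divergence.\<close>

lemma dilation_derivative_is_divergence:
  fixes \<theta> :: "real^3 \<Rightarrow> real" and p :: "real^3"
  assumes "smooth \<theta>"
  defines "\<Theta> \<equiv> \<lambda>\<mu> x. \<theta> (p + \<mu> *\<^sub>R (x - p))"
  shows "((\<lambda>\<mu>. \<mu> ^ 3 * \<Theta> \<mu> x) has_field_derivative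
    (\<Sum>j\<in>UNIV. frechet_derivative (\<lambda>x. \<mu>\<^sup>2 * (x - p) $ j * \<Theta> \<mu> x) (at x) (axis j 1))) (at \<mu>)"
    and "frechet_derivative (\<lambda>x. \<mu>\<^sup>2 * (x - p) $ j * \<Theta> \<mu> x) (at x) (axis j 1) =
    \<mu>\<^sup>2 * \<Theta> \<mu> x + \<mu> ^ 3 * (x - p) $ j * frechet_derivative \<theta> (at (p + \<mu> *\<^sub>R (x - p))) (axis j 1)"
proof -
  let ?D = "frechet_derivative \<theta> (at (p + \<mu> *\<^sub>R (x - p)))"
  have lin: "linear ?D"
    by (rule linear_frechet_derivative[OF smooth_differentiable[OF assms(1)]])
  show e: "frechet_derivative (\<lambda>x. \<mu>\<^sup>2 * (x - p) $ j * \<Theta> \<mu> x) (at x) (axis j 1) =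
    \<mu>\<^sup>2 * \<Theta> \<mu> x + \<mu> ^ 3 * (x - p) $ j * ?D (axis j 1)" for j
  proof -
    have "((\<lambda>x. \<Theta> \<mu> x) has_derivative (\<lambda>h. ?D (\<mu> *\<^sub>R h))) (at x)"
      unfolding \<Theta>_def
      by (rule has_derivative_compose[OF _ smooth_has_derivative[OF assms(1)]])
        (auto intro!: derivative_eq_intros)
    moreover have "((\<lambda>x. \<mu>\<^sup>2 * (x - p) $ j) has_derivative (\<lambda>h. \<mu>\<^sup>2 * h $ j)) (at x)"
      by (auto intro!: derivative_eq_intros bounded_linear.has_derivative[OF bounded_linear_vec_nth])
    ultimately have "((\<lambda>x. \<mu>\<^sup>2 * (x - p) $ j * \<Theta> \<mu> x) has_derivative
        (\<lambda>h. \<mu>\<^sup>2 * (x - p) $ j * ?D (\<mu> *\<^sub>R h) + \<mu>\<^sup>2 * h $ j * \<Theta> \<mu> x)) (at x)"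
      by (rule has_derivative_mult[rotated])
    note e = fun_cong[OF frechet_derivative_at[OF this], of "axis j 1", symmetric]
    have sc: "?D (\<mu> *\<^sub>R axis j 1) = \<mu> * ?D (axis j 1)"
      by (simp add: linear_scale[OF lin])
    show ?thesis
      unfolding e sc by (simp add: power2_eq_square power3_eq_cube mult_ac)
  qed
  have "((\<lambda>\<mu>. \<Theta> \<mu> x) has_derivative (\<lambda>h. ?D (h *\<^sub>R (x - p)))) (at \<mu>)"
    unfolding \<Theta>_def
    by (rule has_derivative_compose[OF _ smooth_has_derivative[OF assms(1)]])
      (auto intro!: derivative_eq_intros)
  moreover have "(\<lambda>h. ?D (h *\<^sub>R (x - p))) = (*) (?D (x - p))"
    by (simp add: fun_eq_iff linear_scale[OF lin] mult.commute)
  ultimately have "((\<lambda>\<mu>. \<Theta> \<mu> x) has_field_derivative ?D (x - p)) (at \<mu>)"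
    by (simp only: has_field_derivative_def)
  then have "((\<lambda>\<mu>. \<mu> ^ 3 * \<Theta> \<mu> x) has_field_derivative 3 * \<mu>\<^sup>2 * \<Theta> \<mu> x + ?D (x - p) * \<mu> ^ 3) (at \<mu>)"
    by (auto intro!: derivative_eq_intros)
  \<comment> \<open>The 3 is the dimension: each of the three partial derivatives contributes the
    undifferentiated term once.\<close>
  also have "3 * \<mu>\<^sup>2 * \<Theta> \<mu> x + ?D (x - p) * \<mu> ^ 3 =
      (\<Sum>j\<in>UNIV. \<mu>\<^sup>2 * \<Theta> \<mu> x + \<mu> ^ 3 * (x - p) $ j * ?D (axis j 1))"
    unfolding frechet_derivative_components[OF assms(1), of _ "x - p"]
    by (simp add: sum.distrib sum_distrib_left sum_distrib_right mult_ac)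
  finally show "((\<lambda>\<mu>. \<mu> ^ 3 * \<Theta> \<mu> x) has_field_derivative
    (\<Sum>j\<in>UNIV. frechet_derivative (\<lambda>x. \<mu>\<^sup>2 * (x - p) $ j * \<Theta> \<mu> x) (at x) (axis j 1))) (at \<mu>)"
    by (simp only: e)
qed

lemma smooth_vec_nth: "smooth (\<lambda>x :: real^3. c * (x - p) $ j)"
proof -
  have "bounded_linear (\<lambda>x :: real^3. c * x $ j)"
    by (intro bounded_linear_const_mult bounded_linear_vec_nth)
  from smooth_add[OF smooth_bounded_linear[OF this] smooth_const[of "- c * p $ j"]]
  show ?thesis by (simp add: algebra_simps)
qed

lemma test_functions_dilation:
  fixes \<theta> :: "'a::euclidean_space \<Rightarrow> real"
  assumes "\<theta> \<in> test_functions UNIV" and "c \<noteq> 0"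
  shows "(\<lambda>x. \<theta> (p + c *\<^sub>R (x - p))) \<in> test_functions UNIV"
  using test_functions_affine[OF assms, of "p - c *\<^sub>R p"] by (simp add: algebra_simps)

lemma dilation_support:
  fixes \<eta> :: "'a::euclidean_space \<Rightarrow> real"
  assumes "\<eta> \<in> test_functions UNIV" and "c > 0"
  obtains R where "R > 0" "\<And>\<nu> x. \<nu> \<ge> c \<Longrightarrow> norm (x - p) > R \<Longrightarrow> \<eta> (p + \<nu> *\<^sub>R (x - p)) = 0"
proof -
  obtain R where R: "R > 0" "\<And>x. norm x > R \<Longrightarrow> \<eta> x = 0"
    using test_functions_ball_support[OF assms(1)] by metis
  show thesis
  \<comment> \<open>The radius comes from |p + \<nu>(x - p)| \<ge> \<nu> |x - p| - |p| with \<nu>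
    \<ge> c. Staying away from \<nu> = 0 is what keeps the supports in a single ball.\<close>
  proof (rule that[of "(R + norm p) / c"])
    show "(R + norm p) / c > 0" using R(1) assms(2) by (intro divide_pos_pos add_pos_nonneg) auto
    fix \<nu> x assume \<nu>: "\<nu> \<ge> c" and x: "norm (x - p) > (R + norm p) / c"
    have "R + norm p < norm (x - p) * c" using x assms(2) by (simp add: field_simps)
    also have "\<dots> \<le> norm (x - p) * \<nu>" using \<nu> by (simp add: mult_left_mono)
    also have "\<dots> = norm (\<nu> *\<^sub>R (x - p))" using \<nu> assms(2) by simp
    also have "\<dots> = norm ((p + \<nu> *\<^sub>R (x - p)) - p)" by simp
    also have "\<dots> \<le> norm (p + \<nu> *\<^sub>R (x - p)) + norm p" by (rule norm_triangle_ineq4)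
    finally show "\<eta> (p + \<nu> *\<^sub>R (x - p)) = 0" by (intro R(2)) simp
  qed
qed

text \<open>The weight scales with c^k and the volume element with c^3, whose square root is written
  \<open>c * sqrt c\<close>. The cases k = 0 and k = 1 are used.\<close>

lemma L2_norm_dilation:
  fixes \<theta> :: "real^3 \<Rightarrow> real"
  assumes "continuous_on UNIV \<theta>" and "c > 0"
  shows "L2_norm (\<lambda>x. norm (x - p) ^ k * \<theta> (p + c *\<^sub>R (x - p))) =
    L2_norm (\<lambda>x. norm (x - p) ^ k * \<theta> x) / (c ^ k * (c * sqrt c))"
proof -
  have "L2_norm (\<lambda>x. norm (x - p) ^ k * \<theta> (p + c *\<^sub>R (x - p))) =
      L2_norm (\<lambda>x. (norm ((p + c *\<^sub>R (x - p)) - p) ^ k * \<theta> (p + c *\<^sub>R (x - p))) * (1 / c ^ k))"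
    using assms(2) by (simp add: power_mult_distrib)
  also have "\<dots> = sqrt (\<integral>x. (norm ((p + c *\<^sub>R (x - p)) - p) ^ k * \<theta> (p + c *\<^sub>R (x - p)))\<^sup>2 \<partial>lebesgue) * (1 / c ^ k)"
    using assms(2) unfolding L2_norm_def real_norm_def power2_abs power_mult_distrib[of _ "1 / c ^ k"]
    by (simp add: real_sqrt_mult real_sqrt_divide)
  also have "(\<integral>x. (norm ((p + c *\<^sub>R (x - p)) - p) ^ k * \<theta> (p + c *\<^sub>R (x - p)))\<^sup>2 \<partial>lebesgue) =
      (\<integral>x. (norm (x - p) ^ k * \<theta> x)\<^sup>2 \<partial>lebesgue) / c ^ DIM(real^3)"
    by (rule integral_dilation[where F="\<lambda>x. (norm (x - p) ^ k * \<theta> x)\<^sup>2"])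
      (intro continuous_intros assms)+
  also have "sqrt (\<dots>) = sqrt (\<integral>x. (norm (x - p) ^ k * \<theta> x)\<^sup>2 \<partial>lebesgue) / (c * sqrt c)"
    using assms(2) by (simp add: real_sqrt_divide power3_eq_cube real_sqrt_mult)
  finally show ?thesis
    unfolding L2_norm_def by simp
qed

text \<open>Supplies the integrable majorant for differentiating the pairing under the integral: on
  a compact range of dilation factors away from 0, supports and sup norms are uniformly
  controlled.\<close>

lemma dilation_derivative_bound:
  fixes \<theta> :: "real^3 \<Rightarrow> real" and p :: "real^3"
  assumes \<theta>: "\<theta> \<in> test_functions UNIV" and c: "0 < c"
  shows "\<exists>C R. \<forall>\<nu>\<in>{c..d}. \<forall>x.
    \<bar>\<Sum>j\<in>UNIV. frechet_derivative (\<lambda>x. \<nu>\<^sup>2 * (x - p) $ j * \<theta> (p + \<nu> *\<^sub>R (x - p))) (at x) (axis j 1)\<bar>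
      \<le> C * indicator (cball p R) x"
proof -
  let ?d = "\<lambda>j y. frechet_derivative \<theta> (at y) (axis j 1)"
  have dt: "?d j \<in> test_functions UNIV" for j
    by (rule test_functions_partial[OF \<theta>]) simp
  obtain M where M: "M > 0" "\<And>x. \<bar>\<theta> x\<bar> \<le> M"
    using test_functions_bounded[OF \<theta>] by metis
  have "\<forall>j. \<exists>M. M > 0 \<and> (\<forall>x. \<bar>?d j x\<bar> \<le> M)"
    using test_functions_bounded[OF dt] by metis
  from choice[OF this] obtain M' where M': "\<And>j. M' j > 0" "\<And>j x. \<bar>?d j x\<bar> \<le> M' j"
    by auto
  obtain R where R: "R > 0" "\<And>\<nu> x. \<nu> \<ge> c \<Longrightarrow> norm (x - p) > R \<Longrightarrow> \<theta> (p + \<nu> *\<^sub>R (x - p)) = 0"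
    using dilation_support[OF \<theta> c, of p] by metis
  have "\<forall>j. \<exists>R. R > 0 \<and> (\<forall>\<nu> x. \<nu> \<ge> c \<longrightarrow> norm (x - p) > R \<longrightarrow> ?d j (p + \<nu> *\<^sub>R (x - p)) = 0)"
    using dilation_support[OF dt c, of p] by metis
  from choice[OF this] obtain R' where R': "\<And>j. R' j > 0"
    "\<And>j \<nu> x. \<nu> \<ge> c \<Longrightarrow> norm (x - p) > R' j \<Longrightarrow> ?d j (p + \<nu> *\<^sub>R (x - p)) = 0"
    by auto
  define S where "S = R + (\<Sum>j\<in>UNIV. R' j)"
  have S: "R \<le> S" "R' j \<le> S" for j
    unfolding S_def using R(1) R'(1) member_le_sum[of j UNIV R'] by (auto intro: sum_nonneg less_imp_le add_increasing)
  show ?thesis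
  proof (intro exI ballI allI)
    fix \<nu> x assume "\<nu> \<in> {c..d}"
    then have \<nu>: "c \<le> \<nu>" "\<nu> \<le> d" by simp_all
    have "\<bar>frechet_derivative (\<lambda>x. \<nu>\<^sup>2 * (x - p) $ j * \<theta> (p + \<nu> *\<^sub>R (x - p))) (at x) (axis j 1)\<bar>
        \<le> (d\<^sup>2 * M + d ^ 3 * S * M' j) * indicator (cball p S) x" for j
      unfolding dilation_derivative_is_divergence(2)[OF test_functions_smooth[OF \<theta>]]
    proof (cases "x \<in> cball p S")
      case True
      have n: "\<bar>(x - p) $ j\<bar> \<le> S"
        using True component_le_norm_cart[of "x - p" j] by (simp add: dist_norm norm_minus_commute)
      have "\<bar>\<nu>\<^sup>2 * \<theta> (p + \<nu> *\<^sub>R (x - p))\<bar> \<le> d\<^sup>2 * M"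
        unfolding abs_mult using \<nu> c M by (intro mult_mono) (auto simp: power_mono)
      moreover have "\<bar>\<nu> ^ 3 * (x - p) $ j * ?d j (p + \<nu> *\<^sub>R (x - p))\<bar> \<le> d ^ 3 * S * M' j"
        unfolding abs_mult using \<nu> c M' n S R(1) by (intro mult_mono) (auto simp: power_mono)
      ultimately show "\<bar>\<nu>\<^sup>2 * \<theta> (p + \<nu> *\<^sub>R (x - p)) + \<nu> ^ 3 * (x - p) $ j * ?d j (p + \<nu> *\<^sub>R (x - p))\<bar>
          \<le> (d\<^sup>2 * M + d ^ 3 * S * M' j) * indicator (cball p S) x"
        using True by simp
    next
      case False
      then have "norm (x - p) > S" by (simp add: dist_norm norm_minus_commute)
      then show "\<bar>\<nu>\<^sup>2 * \<theta> (p + \<nu> *\<^sub>R (x - p)) + \<nu> ^ 3 * (x - p) $ j * ?d j (p + \<nu> *\<^sub>R (x - p))\<bar>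
          \<le> (d\<^sup>2 * M + d ^ 3 * S * M' j) * indicator (cball p S) x"
        using R(2)[of \<nu> x] R'(2)[of \<nu> j x] S(1) S(2)[of j] \<nu>(1) False by simp
    qed
    then have "\<bar>\<Sum>j\<in>UNIV. frechet_derivative (\<lambda>x. \<nu>\<^sup>2 * (x - p) $ j * \<theta> (p + \<nu> *\<^sub>R (x - p))) (at x) (axis j 1)\<bar>
        \<le> (\<Sum>j\<in>UNIV. (d\<^sup>2 * M + d ^ 3 * S * M' j) * indicator (cball p S) x)"
      by (intro order_trans[OF sum_abs] sum_mono)
    then show "\<bar>\<Sum>j\<in>UNIV. frechet_derivative (\<lambda>x. \<nu>\<^sup>2 * (x - p) $ j * \<theta> (p + \<nu> *\<^sub>R (x - p))) (at x) (axis j 1)\<bar>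
        \<le> (\<Sum>j\<in>UNIV. d\<^sup>2 * M + d ^ 3 * S * M' j) * indicator (cball p S) x"
      by (simp only: sum_distrib_right)
  qed
qed

text \<open>The derivative of the dilated test function is the divergence of the field \<mu>^2 (x -
  p) \<theta>(p + \<mu>(x - p)). The weak gradient of u takes over the divergence, and
  Cauchy-Schwarz with the scaling law gives \<mu>^2 * \<mu>^(-5/2) = \<mu>^(-1/2), a rate that is
  integrable at 0.\<close>

lemma dilation_pairing_derivative:
  fixes \<theta> :: "real^3 \<Rightarrow> real" and p :: "real^3"
  assumes u: "u \<in> W12" and \<theta>: "\<theta> \<in> test_functions UNIV" and \<mu>: "\<mu> > 0"
  obtains D where
    "((\<lambda>\<mu>. \<integral>x. \<mu> ^ 3 * \<theta> (p + \<mu> *\<^sub>R (x - p)) * Re (u x) \<partial>lebesgue) has_field_derivative D) (at \<mu>)"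
    "\<bar>D\<bar> \<le> L2_norm (\<lambda>x. norm (x - p) * \<theta> x) * L2_norm (weak_gradient u) / sqrt \<mu>"
proof -
  define \<eta> where "\<eta> j \<nu> = (\<lambda>x. \<nu>\<^sup>2 * (x - p) $ j * \<theta> (p + \<nu> *\<^sub>R (x - p)))" for j \<nu>
  define q where "q \<nu> x = (\<Sum>j\<in>UNIV. frechet_derivative (\<eta> j \<nu>) (at x) (axis j 1))" for \<nu> x
  note g = weak_gradient_works(1)[OF u]
  note [measurable] = L2D(1)[OF W12_L2[OF u]] L2D(1)[OF g]
  have \<theta>\<nu>: "(\<lambda>x. \<theta> (p + \<nu> *\<^sub>R (x - p))) \<in> test_functions UNIV" if "\<nu> > 0" for \<nu>
    using that by (intro test_functions_dilation \<theta>) simp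
  have \<eta>: "\<eta> j \<nu> \<in> test_functions UNIV" if "\<nu> > 0" for j \<nu>
    unfolding \<eta>_def by (intro test_functions_mult smooth_vec_nth \<theta>\<nu> that)
  have \<eta>': "(\<lambda>x. frechet_derivative (\<eta> j \<nu>) (at x) (axis j 1)) \<in> test_functions UNIV" if "\<nu> > 0" for j \<nu>
    by (intro test_functions_partial \<eta> that) simp
  note \<rho> = L2_Re(1)[OF W12_L2[OF u]]
  have \<gamma>: "(\<lambda>x. Re (weak_gradient u x $ j)) \<in> L2" for j
    by (intro L2_Re L2_component g)
  \<comment> \<open>The neighbourhood of radius \<mu>/2 around \<mu> lies in [\<mu>/2, 2\<mu>],
    which is bounded away from 0 as the majorant requires.\<close>
  obtain C R where CR': "\<forall>\<nu>\<in>{\<mu> / 2..2 * \<mu>}. \<forall>x. \<bar>q \<nu> x\<bar> \<le> C * indicator (cball p R) x"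
    unfolding q_def \<eta>_def using dilation_derivative_bound[OF \<theta> half_gt_zero[OF \<mu>], of "2 * \<mu>" p] by blast
  then have CR: "\<bar>q \<nu> x\<bar> \<le> C * indicator (cball p R) x" if "\<mu> / 2 \<le> \<nu>" "\<nu> \<le> 2 * \<mu>" for \<nu> x
    using that by simp
  have near: "\<mu> / 2 \<le> \<nu>" "\<nu> \<le> 2 * \<mu>" "\<nu> > 0" if "\<bar>\<nu> - \<mu>\<bar> < \<mu> / 2" for \<nu>
    using that \<mu> by linarith+
  have d: "((\<lambda>\<mu>. \<integral>x. \<mu> ^ 3 * \<theta> (p + \<mu> *\<^sub>R (x - p)) * Re (u x) \<partial>lebesgue) has_field_derivative
      (\<integral>x. q \<mu> x * Re (u x) \<partial>lebesgue)) (at \<mu>)"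
  proof (rule has_field_derivative_integral)
    show "\<mu> / 2 > 0" using \<mu> by simp
    fix \<nu> assume "\<bar>\<nu> - \<mu>\<bar> < \<mu> / 2"
    note \<nu> = near[OF this]
    show "integrable lebesgue (\<lambda>x. \<nu> ^ 3 * \<theta> (p + \<nu> *\<^sub>R (x - p)) * Re (u x))"
      using L2_scaleR(1)[OF test_functions_L2[OF \<theta>\<nu>[OF \<nu>(3)]] \<rho>] by (simp add: mult.assoc)
    show "((\<lambda>\<nu>. \<nu> ^ 3 * \<theta> (p + \<nu> *\<^sub>R (x - p)) * Re (u x)) has_field_derivative q \<nu> x * Re (u x)) (at \<nu>)" for x
      unfolding q_def \<eta>_def
      by (rule DERIV_cmult_right[OF dilation_derivative_is_divergence(1)[OF test_functions_smooth[OF \<theta>]]])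
    show "\<bar>q \<nu> x * Re (u x)\<bar> \<le> C * (norm (indicator (cball p R) x :: real) * norm (Re (u x)))" for x
      using mult_right_mono[OF CR[OF \<nu>(1,2), of x], of "\<bar>Re (u x)\<bar>"] by (simp add: abs_mult mult.assoc)
  next
    show "integrable lebesgue (\<lambda>x. C * (norm (indicator (cball p R) x :: real) * norm (Re (u x))))"
      by (intro integrable_mult_right L2_integrable_norm_mult indicator_L2 \<rho>) simp
    have "q \<mu> \<in> borel_measurable lebesgue"
      unfolding q_def[abs_def] using \<eta>'[OF \<mu>]
      by (intro borel_measurable_sum L2D(1) test_functions_L2)
    then show "(\<lambda>x. q \<mu> x * Re (u x)) \<in> borel_measurable lebesgue" by measurable
  qed
  have "(\<integral>x. q \<mu> x * Re (u x) \<partial>lebesgue) =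
      (\<Sum>j\<in>UNIV. \<integral>x. frechet_derivative (\<eta> j \<mu>) (at x) (axis j 1) * Re (u x) \<partial>lebesgue)"
    unfolding q_def sum_distrib_right
    by (rule Bochner_Integration.integral_sum)
      (use L2_scaleR(1)[OF test_functions_L2[OF \<eta>'[OF \<mu>]] \<rho>] in simp)
  also have "\<dots> = - (\<Sum>j\<in>UNIV. \<integral>x. \<eta> j \<mu> x * Re (weak_gradient u x $ j) \<partial>lebesgue)"
    by (simp add: weak_gradient_Re[OF u \<eta>[OF \<mu>]] sum_negf)
  also have "(\<Sum>j\<in>UNIV. \<integral>x. \<eta> j \<mu> x * Re (weak_gradient u x $ j) \<partial>lebesgue) =
      (\<integral>x. (\<Sum>j\<in>UNIV. \<eta> j \<mu> x * Re (weak_gradient u x $ j)) \<partial>lebesgue)"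
    by (rule Bochner_Integration.integral_sum[symmetric])
      (use L2_scaleR(1)[OF test_functions_L2[OF \<eta>[OF \<mu>]] \<gamma>] in simp)
  finally have eq: "(\<integral>x. q \<mu> x * Re (u x) \<partial>lebesgue) =
      - (\<integral>x. (\<Sum>j\<in>UNIV. \<eta> j \<mu> x * Re (weak_gradient u x $ j)) \<partial>lebesgue)" .
  let ?\<Theta> = "\<lambda>x. norm (x - p) ^ 1 * \<theta> (p + \<mu> *\<^sub>R (x - p))"
  have pw: "\<bar>\<Sum>j\<in>UNIV. \<eta> j \<mu> x * Re (weak_gradient u x $ j)\<bar> \<le>
      \<mu>\<^sup>2 * (norm (?\<Theta> x) * norm (weak_gradient u x))" for x
  proof -
    \<comment> \<open>The sum over j is a multiple of the real inner product of x - p with the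
      vector of real parts. Cauchy-Schwarz in three dimensions then gives the full norm without a
      combinatorial factor.\<close>
    define \<gamma> where "\<gamma> = (\<chi> j. Re (weak_gradient u x $ j))"
    have "(norm \<gamma>)\<^sup>2 \<le> (norm (weak_gradient u x))\<^sup>2"
      unfolding norm_cvec_square
      by (simp add: \<gamma>_def norm_vec_def L2_set_def sum_nonneg cmod_power2 sum_mono)
    then have \<gamma>: "norm \<gamma> \<le> norm (weak_gradient u x)" by simp
    have "(\<Sum>j\<in>UNIV. \<eta> j \<mu> x * Re (weak_gradient u x $ j)) = \<mu>\<^sup>2 * \<theta> (p + \<mu> *\<^sub>R (x - p)) * ((x - p) \<bullet> \<gamma>)"
      by (simp add: \<eta>_def \<gamma>_def inner_vec_def sum_distrib_left mult_ac)
    also have "\<bar>\<dots>\<bar> \<le> \<mu>\<^sup>2 * \<bar>\<theta> (p + \<mu> *\<^sub>R (x - p))\<bar> * (norm (x - p) * norm (weak_gradient u x))"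
      unfolding abs_mult using \<gamma>
      by (intro mult_mono order_trans[OF Cauchy_Schwarz_ineq2]) auto
    finally show ?thesis by (simp add: abs_mult mult_ac)
  qed
  obtain M where M: "M > 0" "\<And>x. \<bar>\<theta> x\<bar> \<le> M"
    using test_functions_bounded[OF \<theta>] by metis
  obtain R where R: "R > 0" "\<And>\<nu> x. \<nu> \<ge> \<mu> \<Longrightarrow> norm (x - p) > R \<Longrightarrow> \<theta> (p + \<nu> *\<^sub>R (x - p)) = 0"
    using dilation_support[OF \<theta> \<mu>, of p] by metis
  have \<Theta>: "?\<Theta> \<in> L2"
  proof (rule L2_bounded_support)
    show "?\<Theta> \<in> borel_measurable lebesgue"
      by (intro borel_measurable_lebesgue_continuous continuous_intros smooth_continuous_on
          test_functions_smooth[OF \<theta>\<nu>[OF \<mu>]])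
    show "cball p R \<in> lmeasurable" by simp
    show z: "?\<Theta> x = 0" if "x \<notin> cball p R" for x
      using that R(2)[of \<mu> x] by (simp add: dist_norm norm_minus_commute)
    show "norm (?\<Theta> x) \<le> R * M" for x
    proof (cases "x \<in> cball p R")
      case True
      then have "norm (x - p) \<le> R" by (simp add: dist_norm norm_minus_commute)
      then show ?thesis
        using M(2) R(1) by (auto simp: abs_mult intro!: mult_mono)
    next
      case False
      show ?thesis unfolding z[OF False] using R(1) M(1) by simp
    qed
  qed
  have "\<bar>\<integral>x. q \<mu> x * Re (u x) \<partial>lebesgue\<bar> \<le>
      (\<integral>x. \<mu>\<^sup>2 * (norm (?\<Theta> x) * norm (weak_gradient u x)) \<partial>lebesgue)"
    unfolding eq abs_minus_cancel
    by (rule order_trans[OF integral_abs_bound], rule integral_mono)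
      (use pw L2_scaleR(1)[OF test_functions_L2[OF \<eta>[OF \<mu>]] \<gamma>] L2_integrable_norm_mult[OF \<Theta> g]
        in \<open>auto intro!: integrable_mult_right integrable_abs Bochner_Integration.integrable_sum\<close>)
  also have "\<dots> \<le> \<mu>\<^sup>2 * (L2_norm ?\<Theta> * L2_norm (weak_gradient u))"
    using L2_Cauchy_Schwarz[OF \<Theta> g] by (simp add: mult_left_mono del: power_one_right)
  also have "L2_norm ?\<Theta> = L2_norm (\<lambda>x. norm (x - p) * \<theta> x) / (\<mu> * (\<mu> * sqrt \<mu>))"
    using L2_norm_dilation[OF smooth_continuous_on[OF test_functions_smooth[OF \<theta>]] \<mu>, of p 1] by simp
  also have "\<mu>\<^sup>2 * (L2_norm (\<lambda>x. norm (x - p) * \<theta> x) / (\<mu> * (\<mu> * sqrt \<mu>)) * L2_norm (weak_gradient u)) =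
      L2_norm (\<lambda>x. norm (x - p) * \<theta> x) * L2_norm (weak_gradient u) / sqrt \<mu>"
    using \<mu> by (simp add: power2_eq_square)
  finally show thesis using d that by blast
qed

text \<open>Integrating the derivative of the pairing with the dilates of \<open>\<theta>\<close> from the scale \<open>0\<close>, where the
  pairing vanishes, to the scale \<open>1\<close>.\<close>

lemma hardy_dual:
  fixes \<theta> :: "real^3 \<Rightarrow> real" and p :: "real^3"
  assumes u: "u \<in> W12" and \<theta>: "\<theta> \<in> test_functions UNIV"
  shows "(\<integral>x. \<theta> x * Re (u x) \<partial>lebesgue) \<le>
    2 * (L2_norm (\<lambda>x. norm (x - p) * \<theta> x) * L2_norm (weak_gradient u))"
proof -
  let ?B = "L2_norm (\<lambda>x. norm (x - p) * \<theta> x) * L2_norm (weak_gradient u)"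
  define k where "k \<mu> = (\<integral>x. \<mu> ^ 3 * \<theta> (p + \<mu> *\<^sub>R (x - p)) * Re (u x) \<partial>lebesgue)" for \<mu>
  \<comment> \<open>The subtracted term is an antiderivative of the bound B / sqrt \<mu> on the
    derivative of \<open>k\<close>, so \<open>h\<close> is nonincreasing and no integral over \<mu>
    is formed.\<close>
  define h where "h \<mu> = k \<mu> - 2 * ?B * sqrt \<mu>" for \<mu>
  have "\<exists>D. (h has_field_derivative D) (at \<mu>) \<and> D \<le> 0" if "\<mu> > 0" for \<mu>
  proof -
    obtain D where D: "(k has_field_derivative D) (at \<mu>)" "\<bar>D\<bar> \<le> ?B / sqrt \<mu>"
      unfolding k_def[abs_def] by (rule dilation_pairing_derivative[OF u \<theta> \<open>\<mu> > 0\<close>, of p])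
    have "(h has_field_derivative D - 2 * ?B * (inverse (sqrt \<mu>) / 2)) (at \<mu>)"
      unfolding h_def[abs_def]
      by (rule DERIV_diff[OF D(1) DERIV_cmult[OF DERIV_real_sqrt[OF that]]])
    moreover have half: "2 * b * (inverse s / 2) = b / s" for b s :: real
      by (simp add: divide_inverse[of b])
    have "D - 2 * ?B * (inverse (sqrt \<mu>) / 2) \<le> 0"
      unfolding half using order_trans[OF abs_ge_self D(2)] by linarith
    ultimately show ?thesis by (intro exI conjI)
  qed
  then have dec: "h 1 \<le> h \<epsilon>" if "0 < \<epsilon>" "\<epsilon> \<le> 1" for \<epsilon>
    by (rule DERIV_nonpos_imp_nonincreasing[OF that(2)]) (use that(1) in \<open>simp add: less_le_trans\<close>)
  \<comment> \<open>The prefactor \<epsilon>^3 beats the growth \<epsilon>^(-3/2) of the norm of the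
    dilated test function, so the pairing vanishes in the limit.\<close>
  have k: "k \<epsilon> \<le> \<epsilon> * sqrt \<epsilon> * (L2_norm \<theta> * L2_norm u)" if "\<epsilon> > 0" for \<epsilon>
  proof -
    have t: "(\<lambda>x. \<theta> (p + \<epsilon> *\<^sub>R (x - p))) \<in> L2"
      by (rule test_functions_L2[OF test_functions_dilation[OF \<theta>]]) (use that in simp)
    have "k \<epsilon> = \<epsilon> ^ 3 * (\<integral>x. \<theta> (p + \<epsilon> *\<^sub>R (x - p)) * Re (u x) \<partial>lebesgue)"
      by (simp add: k_def mult.assoc)
    also have "\<dots> \<le> \<epsilon> ^ 3 * (L2_norm (\<lambda>x. \<theta> (p + \<epsilon> *\<^sub>R (x - p))) * L2_norm (\<lambda>x. Re (u x)))"
      using L2_scaleR(2)[OF t L2_Re(1)[OF W12_L2[OF u]]] that by (intro mult_left_mono) auto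
    also have "\<dots> \<le> \<epsilon> ^ 3 * (L2_norm (\<lambda>x. \<theta> (p + \<epsilon> *\<^sub>R (x - p))) * L2_norm u)"
      using that by (intro mult_left_mono L2_Re W12_L2 u) auto
    also have "L2_norm (\<lambda>x. \<theta> (p + \<epsilon> *\<^sub>R (x - p))) = L2_norm \<theta> / (\<epsilon> * sqrt \<epsilon>)"
      using L2_norm_dilation[OF smooth_continuous_on[OF test_functions_smooth[OF \<theta>]] that, of p 0] by simp
    also have "\<epsilon> ^ 3 * (L2_norm \<theta> / (\<epsilon> * sqrt \<epsilon>) * L2_norm u) = \<epsilon> * (\<epsilon> / sqrt \<epsilon>) * (L2_norm \<theta> * L2_norm u)"
      using that by (simp add: power3_eq_cube)
    also have "\<epsilon> / sqrt \<epsilon> = sqrt \<epsilon>" using that by (simp add: real_div_sqrt)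
    finally show ?thesis .
  qed
  have le: "h 1 \<le> \<epsilon> * sqrt \<epsilon> * (L2_norm \<theta> * L2_norm u)" if "0 < \<epsilon>" "\<epsilon> \<le> 1" for \<epsilon>
  proof -
    have "h \<epsilon> \<le> k \<epsilon>" using that by (simp add: h_def)
    then show ?thesis using dec[OF that] k[OF that(1)] by linarith
  qed
  have "h 1 \<le> 0"
  proof (rule tendsto_lowerbound)
    show "((\<lambda>\<epsilon>. \<epsilon> * sqrt \<epsilon> * (L2_norm \<theta> * L2_norm u)) \<longlongrightarrow> 0) (at_right 0)"
      by (auto intro!: tendsto_eq_intros)
    show "\<forall>\<^sub>F \<epsilon> in at_right 0. h 1 \<le> \<epsilon> * sqrt \<epsilon> * (L2_norm \<theta> * L2_norm u)"
      unfolding eventually_at_right_field by (intro exI[of _ 1]) (use le in auto)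
  qed simp
  then show ?thesis by (simp add: h_def k_def)
qed

lemma tendsto_indicator_exhausting:
  fixes x :: "real^3"
  assumes A: "\<And>k. A k = {x \<in> box (- (\<chi> i. real k)) (\<chi> i. real k). \<bar>r x\<bar> \<le> real k \<and> 1 \<le> real k * norm (x - p)}"
    and "x \<noteq> p"
  shows "\<forall>\<^sub>F k in sequentially. x \<in> A k"
proof -
  obtain k0 :: nat where k0: "x \<in> box (- (\<chi> i. real k0)) (\<chi> i. real k0)" "max \<bar>r x\<bar> (1 / norm (x - p)) \<le> real k0"
    by (rule exhausting_boxes[of x "max \<bar>r x\<bar> (1 / norm (x - p))"])
  have "x \<in> A k" if "k \<ge> k0" for k
  proof -
    have le: "real k0 \<le> real k" using that by simp
    have "x \<in> box (- (\<chi> i. real k)) (\<chi> i. real k)"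
      using k0(1) le unfolding mem_box_cart by (auto intro: less_le_trans le_less_trans[rotated])
    moreover have "1 / norm (x - p) \<le> real k" using k0(2) le by simp
    then have "1 \<le> real k * norm (x - p)" using assms(2) by (simp add: field_simps)
    moreover have "\<bar>r x\<bar> \<le> real k" using k0(2) le by simp
    ultimately show ?thesis by (simp only: A mem_Collect_eq simp_thms)
  qed
  then show ?thesis by (auto simp: eventually_sequentially)
qed

text \<open>Insert f = Re u / |x - p|^2, cut off to \<open>A\<close>, into the dual inequality. With
  X the integral in question, the left side is X and the norm of |x - p| f is sqrt X, so X \<le> 2 G
  sqrt X with G the L2 norm of the gradient, and X \<le> 4 G^2 follows. The cut-off makes f bounded,
  hence approximable by test functions, and X finite.\<close>

lemma hardy_truncated:
  fixes p :: "real^3"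
  assumes u: "u \<in> W12"
    and A: "A = {x \<in> box (- (\<chi> i. real k)) (\<chi> i. real k). \<bar>Re (u x)\<bar> \<le> real k \<and> 1 \<le> real k * norm (x - p)}"
  shows "A \<in> sets lebesgue"
    and "integrable lebesgue (\<lambda>x. indicator A x * ((Re (u x))\<^sup>2 / (norm (x - p))\<^sup>2))"
    and "(\<integral>x. indicator A x * ((Re (u x))\<^sup>2 / (norm (x - p))\<^sup>2) \<partial>lebesgue) \<le> 4 * (L2_norm (weak_gradient u))\<^sup>2"
proof -
  let ?G = "L2_norm (weak_gradient u)"
  let ?B = "box (- (\<chi> i. real k)) (\<chi> i. real k) :: (real^3) set"
  note \<rho> = L2_Re(1)[OF W12_L2[OF u]]
  note [measurable] = L2D(1)[OF \<rho>]
  have nm [measurable]: "(\<lambda>x. norm (x - p)) \<in> borel_measurable lebesgue"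
    by (intro borel_measurable_lebesgue_continuous continuous_intros)
  have [measurable]: "?B \<in> sets lebesgue" by simp
  show Am [measurable]: "A \<in> sets lebesgue" unfolding A by measurable
  define f where "f x = indicator A x * (Re (u x) / (norm (x - p))\<^sup>2)" for x
  have fm [measurable]: "f \<in> borel_measurable lebesgue" unfolding f_def by measurable
  have f1: "\<bar>f x\<bar> \<le> real k ^ 3" for x
  proof (cases "x \<in> A")
    case True
    then have x: "\<bar>Re (u x)\<bar> \<le> real k" "1 \<le> real k * norm (x - p)" unfolding A by auto
    then have n: "norm (x - p) \<noteq> 0" by auto
    have "1\<^sup>2 \<le> (real k * norm (x - p))\<^sup>2" using x(2) by (intro power_mono) auto
    then have "1 / (norm (x - p))\<^sup>2 \<le> (real k)\<^sup>2"
      using n by (simp add: field_simps)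
    then have "\<bar>Re (u x)\<bar> * (1 / (norm (x - p))\<^sup>2) \<le> real k * (real k)\<^sup>2"
      using x(1) by (intro mult_mono) auto
    then show ?thesis using True by (simp add: f_def power3_eq_cube power2_eq_square)
  qed (simp add: f_def)
  have f2: "f x = 0" if "x \<notin> ?B" for x
    using that by (simp add: f_def A)
  obtain \<theta> where \<theta>: "\<And>n. \<theta> n \<in> test_functions UNIV" "\<And>n x. \<bar>\<theta> n x\<bar> \<le> real k ^ 3 + 1"
    "\<And>n x. x \<notin> ?B \<Longrightarrow> \<theta> n x = 0" "AE x in lebesgue. (\<lambda>n. \<theta> n x) \<longlonglongrightarrow> f x"
    "(\<lambda>n. \<integral>x. \<theta> n x *\<^sub>R Re (u x) \<partial>lebesgue) \<longlonglongrightarrow> (\<integral>x. f x *\<^sub>R Re (u x) \<partial>lebesgue)"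
    by (rule L2_test_approx[OF \<rho> fm f1 f2]) blast+
  have bnd: "bounded ?B" by simp
  then obtain S where S: "S > 0" "\<And>x. x \<in> ?B \<Longrightarrow> norm (x - p) \<le> S"
  proof -
    obtain b where "\<And>x. x \<in> ?B \<Longrightarrow> norm x \<le> b" using bnd bounded_iff by metis
    then have "norm (x - p) \<le> \<bar>b\<bar> + norm p + 1" if "x \<in> ?B" for x
      using that norm_triangle_ineq4[of x p] by fastforce
    then show thesis using that[of "\<bar>b\<bar> + norm p + 1"] by (simp add: add_nonneg_pos)
  qed
  have \<theta>m [measurable]: "\<theta> n \<in> borel_measurable lebesgue" for n
    by (rule L2D(1)[OF test_functions_L2[OF \<theta>(1)]])
  \<comment> \<open>The weighted norms on the right of the dual inequality must converge too; |x -
    p| is at most \<open>S\<close> on the box, which gives a bounded majorant there.\<close>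
  have "(\<lambda>n. \<integral>x. (norm (norm (x - p) * \<theta> n x))\<^sup>2 \<partial>lebesgue) \<longlonglongrightarrow> (\<integral>x. (norm (norm (x - p) * f x))\<^sup>2 \<partial>lebesgue)"
  proof (rule integral_dominated_convergence)
    show "integrable lebesgue (\<lambda>x. (S * (real k ^ 3 + 1))\<^sup>2 * (indicator ?B x :: real))"
      by (intro integrable_mult_right) (simp add: lmeasurable_iff_integrable[symmetric])
    show "AE x in lebesgue. (\<lambda>n. (norm (norm (x - p) * \<theta> n x))\<^sup>2) \<longlonglongrightarrow> (norm (norm (x - p) * f x))\<^sup>2"
      using \<theta>(4) by eventually_elim (intro tendsto_intros)
    show "AE x in lebesgue. norm ((norm (norm (x - p) * \<theta> n x))\<^sup>2) \<le> (S * (real k ^ 3 + 1))\<^sup>2 * indicator ?B x" for n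
    proof (intro always_eventually allI)
      fix x show "norm ((norm (norm (x - p) * \<theta> n x))\<^sup>2) \<le> (S * (real k ^ 3 + 1))\<^sup>2 * indicator ?B x"
      proof (cases "x \<in> ?B")
        case True
        have "norm (norm (x - p) * \<theta> n x) \<le> S * (real k ^ 3 + 1)"
          unfolding norm_mult using S(2)[OF True] \<theta>(2)[of n x] S(1) by (intro mult_mono) auto
        then have "(norm (norm (x - p) * \<theta> n x))\<^sup>2 \<le> (S * (real k ^ 3 + 1))\<^sup>2"
          by (intro power_mono) auto
        then show ?thesis using True by simp
      qed (simp add: \<theta>(3))
    qed
  qed measurable
  then have lim: "(\<lambda>n. L2_norm (\<lambda>x. norm (x - p) * \<theta> n x)) \<longlonglongrightarrow> L2_norm (\<lambda>x. norm (x - p) * f x)"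
    unfolding L2_norm_def by (rule tendsto_real_sqrt)
  have le: "(\<integral>x. f x *\<^sub>R Re (u x) \<partial>lebesgue) \<le> 2 * (L2_norm (\<lambda>x. norm (x - p) * f x) * ?G)"
  proof (rule LIMSEQ_le[OF \<theta>(5)])
    show "(\<lambda>n. 2 * (L2_norm (\<lambda>x. norm (x - p) * \<theta> n x) * ?G)) \<longlonglongrightarrow> 2 * (L2_norm (\<lambda>x. norm (x - p) * f x) * ?G)"
      by (intro tendsto_intros lim)
    show "\<exists>N. \<forall>n\<ge>N. (\<integral>x. \<theta> n x *\<^sub>R Re (u x) \<partial>lebesgue) \<le> 2 * (L2_norm (\<lambda>x. norm (x - p) * \<theta> n x) * ?G)"
      using hardy_dual[OF u \<theta>(1)] by (simp only: real_scaleR_def) blast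
  qed
  let ?X = "\<integral>x. indicator A x * ((Re (u x))\<^sup>2 / (norm (x - p))\<^sup>2) \<partial>lebesgue"
  have e1: "f x *\<^sub>R Re (u x) = indicator A x * ((Re (u x))\<^sup>2 / (norm (x - p))\<^sup>2)" for x
    by (simp add: f_def power2_eq_square)
  have e2: "(norm (norm (x - p) * f x))\<^sup>2 = indicator A x * ((Re (u x))\<^sup>2 / (norm (x - p))\<^sup>2)" for x
    by (cases "x = p") (auto simp: f_def indicator_def power2_eq_square)
  have "f \<in> L2"
    by (rule L2_bounded_support[OF fm _ _ f2, where M="real k ^ 3"]) (use f1 in auto)
  from L2_scaleR(1)[OF this \<rho>]
  show "integrable lebesgue (\<lambda>x. indicator A x * ((Re (u x))\<^sup>2 / (norm (x - p))\<^sup>2))"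
    by (simp only: e1)
  have X0: "?X \<ge> 0" by (intro integral_nonneg_AE always_eventually) auto
  \<comment> \<open>The square of |x - p| f equals f Re u, so \<open>e1\<close> and
    \<open>e2\<close> express both sides by X.\<close>
  have "?X \<le> 2 * (sqrt ?X * ?G)"
    using le unfolding L2_norm_def[of "\<lambda>x. norm (x - p) * f x"] e1 e2 .
  then have "sqrt ?X * sqrt ?X \<le> (2 * ?G) * sqrt ?X"
    using X0 by (simp add: mult_ac)
  then have "sqrt ?X \<le> 2 * ?G"
    using mult_right_le_imp_le[of "sqrt ?X" "sqrt ?X" "2 * ?G"] L2_norm_nonneg[of "weak_gradient u"]
    by (cases "sqrt ?X > 0") linarith+
  then have "(sqrt ?X)\<^sup>2 \<le> (2 * ?G)\<^sup>2"
    using X0 by (intro power_mono) auto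
  then show "?X \<le> 4 * ?G\<^sup>2" using X0 by (simp add: power_mult_distrib)
qed

text \<open>Fatou's lemma over the exhausting truncations yields integrability and the bound at
  once.\<close>

lemma hardy_Re:
  fixes p :: "real^3"
  assumes u: "u \<in> W12"
  shows "integrable lebesgue (\<lambda>x. (Re (u x))\<^sup>2 / (norm (x - p))\<^sup>2)"
    and "(\<integral>x. (Re (u x))\<^sup>2 / (norm (x - p))\<^sup>2 \<partial>lebesgue) \<le> 4 * (L2_norm (weak_gradient u))\<^sup>2"
proof -
  let ?G = "4 * (L2_norm (weak_gradient u))\<^sup>2"
  define h where "h x = (Re (u x))\<^sup>2 / (norm (x - p))\<^sup>2" for x
  define A where "A k = {x \<in> box (- (\<chi> i. real k)) (\<chi> i. real k). \<bar>Re (u x)\<bar> \<le> real k \<and> 1 \<le> real k * norm (x - p)}" for k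
  have t: "A k \<in> sets lebesgue" "integrable lebesgue (\<lambda>x. indicator (A k) x * h x)"
    "(\<integral>x. indicator (A k) x * h x \<partial>lebesgue) \<le> ?G" for k
    unfolding h_def by (rule hardy_truncated[OF u A_def])+
  have [measurable]: "(\<lambda>x. norm (x - p)) \<in> borel_measurable lebesgue"
    by (intro borel_measurable_lebesgue_continuous continuous_intros)
  note [measurable] = L2D(1)[OF L2_Re(1)[OF W12_L2[OF u]]] t(1)
  have hm [measurable]: "h \<in> borel_measurable lebesgue" unfolding h_def[abs_def] by measurable
  have h0: "h x \<ge> 0" for x by (simp add: h_def)
  have "(\<integral>\<^sup>+x. ennreal (indicator (A k) x * h x) \<partial>lebesgue) \<le> ennreal ?G" for k
    using t(2,3)[of k] h0 by (subst nn_integral_eq_integral) (auto intro!: ennreal_leI)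
  then have le: "liminf (\<lambda>k. \<integral>\<^sup>+x. ennreal (indicator (A k) x * h x) \<partial>lebesgue) \<le> ennreal ?G"
    by (intro Liminf_le) (auto intro: always_eventually)
  have "ennreal (h x) = liminf (\<lambda>k. ennreal (indicator (A k) x * h x))" for x
  proof -
    have "(\<lambda>k. ennreal (indicator (A k) x * h x)) \<longlonglongrightarrow> ennreal (h x)"
    \<comment> \<open>At the pole, division by zero makes \<open>h\<close> vanish, so the sequence
      is constant although \<open>p\<close> lies in no truncation set.\<close>
    proof (cases "x = p")
      case True
      then show ?thesis by (simp add: h_def)
    next
      case False
      have "\<forall>\<^sub>F k in sequentially. x \<in> A k"
        by (rule tendsto_indicator_exhausting[OF A_def False])
      then have "\<forall>\<^sub>F k in sequentially. ennreal (indicator (A k) x * h x) = ennreal (h x)"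
        by eventually_elim simp
      then show ?thesis by (rule tendsto_eventually)
    qed
    then show ?thesis by (intro lim_imp_Liminf[symmetric]) auto
  qed
  then have "(\<integral>\<^sup>+x. ennreal (h x) \<partial>lebesgue) = (\<integral>\<^sup>+x. liminf (\<lambda>k. ennreal (indicator (A k) x * h x)) \<partial>lebesgue)"
    by simp
  also have "\<dots> \<le> liminf (\<lambda>k. \<integral>\<^sup>+x. ennreal (indicator (A k) x * h x) \<partial>lebesgue)"
    by (rule nn_integral_liminf) measurable
  finally have nn: "(\<integral>\<^sup>+x. ennreal (h x) \<partial>lebesgue) \<le> ennreal ?G" using le by order
  then have fin: "(\<integral>\<^sup>+x. ennreal (h x) \<partial>lebesgue) < \<infinity>"
    using ennreal_less_top le_less_trans by (metis infinity_ennreal_def)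
  have i: "integrable lebesgue h"
    using fin h0 by (intro integrableI_nonneg) auto
  then show "integrable lebesgue (\<lambda>x. (Re (u x))\<^sup>2 / (norm (x - p))\<^sup>2)"
    by (simp add: h_def[abs_def])
  have "ennreal (\<integral>x. h x \<partial>lebesgue) \<le> ennreal ?G"
    using nn nn_integral_eq_integral[OF i] h0 by simp
  then show "(\<integral>x. (Re (u x))\<^sup>2 / (norm (x - p))\<^sup>2 \<partial>lebesgue) \<le> ?G"
    unfolding h_def[symmetric] by (subst (asm) ennreal_le_iff) auto
qed

text \<open>The imaginary part of u is the real part of - i u, whose gradient has the same norm.
  Both parts are estimated by the full gradient, so the constant 4 is doubled.\<close>

lemma hardy:
  fixes p :: "real^3"
  assumes u: "u \<in> W12"
  shows "integrable lebesgue (\<lambda>x. (norm (u x))\<^sup>2 / (norm (x - p))\<^sup>2)"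
    and "(\<integral>x. (norm (u x))\<^sup>2 / (norm (x - p))\<^sup>2 \<partial>lebesgue) \<le> 8 * (L2_norm (weak_gradient u))\<^sup>2"
proof -
  note g = weak_gradient_works(1)[OF u]
  note w = W12_scale[OF u, of "- \<i>"]
  have n: "L2_norm (weak_gradient (\<lambda>x. - \<i> * u x)) = L2_norm (weak_gradient u)"
  proof -
    have "AE x in lebesgue. (norm (weak_gradient (\<lambda>x. - \<i> * u x) x))\<^sup>2 = (norm (weak_gradient u x))\<^sup>2"
      using w(2) by eventually_elim (simp add: norm_vector_scale)
    then have "(\<integral>x. (norm (weak_gradient (\<lambda>x. - \<i> * u x) x))\<^sup>2 \<partial>lebesgue) =
        (\<integral>x. (norm (weak_gradient u x))\<^sup>2 \<partial>lebesgue)"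
      by (intro integral_cong_AE borel_measurable_integrable L2D(2) g weak_gradient_works(1) w(1))
    then show ?thesis by (simp add: L2_norm_def)
  qed
  have eq: "(norm (u x))\<^sup>2 / (norm (x - p))\<^sup>2 =
      (Re (u x))\<^sup>2 / (norm (x - p))\<^sup>2 + (Re (- \<i> * u x))\<^sup>2 / (norm (x - p))\<^sup>2" for x
    by (simp add: cmod_power2 add_divide_distrib)
  note h = hardy_Re[OF u, of p] hardy_Re[OF w(1), of p]
  show "integrable lebesgue (\<lambda>x. (norm (u x))\<^sup>2 / (norm (x - p))\<^sup>2)"
    unfolding eq by (rule Bochner_Integration.integrable_add[OF h(1,3)])
  have "(\<integral>x. (norm (u x))\<^sup>2 / (norm (x - p))\<^sup>2 \<partial>lebesgue) =
    (\<integral>x. (Re (u x))\<^sup>2 / (norm (x - p))\<^sup>2 \<partial>lebesgue) + (\<integral>x. (Re (- \<i> * u x))\<^sup>2 / (norm (x - p))\<^sup>2 \<partial>lebesgue)"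
    unfolding eq by (rule Bochner_Integration.integral_add[OF h(1,3)])
  then show "(\<integral>x. (norm (u x))\<^sup>2 / (norm (x - p))\<^sup>2 \<partial>lebesgue) \<le> 8 * (L2_norm (weak_gradient u))\<^sup>2"
    using h(2,4) unfolding n by linarith
qed

section \<open>The nonlinearities\<close>

text \<open>Cauchy-Schwarz between v and u / |x - y|, then Hardy's inequality for u with its pole at
  x, with 8 \<le> 9 = 3^2. The bound is uniform in x and contains no derivative of v, so v can later
  be the difference of two solutions.\<close>

lemma coulomb_product_bound:
  fixes x :: "real^3"
  assumes v: "v \<in> L2" and u: "u \<in> W12"
  shows "integrable lebesgue (\<lambda>y. norm (v y) * norm (u y) / norm (x - y))"
    and "(\<integral>y. norm (v y) * norm (u y) / norm (x - y) \<partial>lebesgue) \<le> 3 * L2_norm v * W12_norm u"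
proof -
  have [measurable]: "(\<lambda>y. norm (x - y)) \<in> borel_measurable lebesgue"
    by (intro borel_measurable_lebesgue_continuous continuous_intros)
  note [measurable] = L2D(1)[OF v] L2D(1)[OF W12_L2[OF u]]
  have eq: "(norm (u y) / norm (x - y))\<^sup>2 = (norm (u y))\<^sup>2 / (norm (y - x))\<^sup>2" for y
    by (simp add: power_divide norm_minus_commute)
  note h = hardy[OF u, of x, folded eq]
  have m: "(\<lambda>y. norm (v y)) \<in> borel_measurable lebesgue" "(\<lambda>y. norm (u y) / norm (x - y)) \<in> borel_measurable lebesgue"
    by measurable
  have "integrable lebesgue (\<lambda>y. norm (v y) * (norm (u y) / norm (x - y)))"
    by (rule integrable_mult_square_integrable[OF m L2D(2)[OF v] h(1)])
  then show "integrable lebesgue (\<lambda>y. norm (v y) * norm (u y) / norm (x - y))" by simp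
  have "(\<integral>y. norm (v y) * (norm (u y) / norm (x - y)) \<partial>lebesgue) \<le>
      sqrt (\<integral>y. (norm (v y))\<^sup>2 \<partial>lebesgue) * sqrt (\<integral>y. (norm (u y) / norm (x - y))\<^sup>2 \<partial>lebesgue)"
    using integral_Cauchy_Schwarz[OF m L2D(2)[OF v] h(1)] by linarith
  also have "\<dots> \<le> L2_norm v * (3 * W12_norm u)"
  proof (rule mult_mono)
    have "(\<integral>y. (norm (u y) / norm (x - y))\<^sup>2 \<partial>lebesgue) \<le> 8 * (L2_norm (weak_gradient u))\<^sup>2" by (rule h(2))
    also have "\<dots> \<le> (3 * W12_norm u)\<^sup>2"
    proof -
      have "(L2_norm (weak_gradient u))\<^sup>2 \<le> (W12_norm u)\<^sup>2"
        by (intro power_mono L2_norm_weak_gradient_le_W12_norm) simp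
      moreover have "(3 * W12_norm u)\<^sup>2 = 9 * (W12_norm u)\<^sup>2" by (simp add: power_mult_distrib)
      ultimately show ?thesis using zero_le_power2[of "W12_norm u"] by linarith
    qed
    finally have "sqrt (\<integral>y. (norm (u y) / norm (x - y))\<^sup>2 \<partial>lebesgue) \<le> sqrt ((3 * W12_norm u)\<^sup>2)"
      by (rule real_sqrt_le_mono)
    then show "sqrt (\<integral>y. (norm (u y) / norm (x - y))\<^sup>2 \<partial>lebesgue) \<le> 3 * W12_norm u"
      by (simp only: real_sqrt_abs abs_mult abs_numeral abs_of_nonneg[OF W12_norm_nonneg])
  qed (auto simp: L2_norm_def)
  finally show "(\<integral>y. norm (v y) * norm (u y) / norm (x - y) \<partial>lebesgue) \<le> 3 * L2_norm v * W12_norm u"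
    by (simp add: mult_ac)
qed

text \<open>The Newtonian potential of the density |u|^2, up to sign and physical constants; it is
  the real weight in \<open>g1\<close>.\<close>

definition potential :: "(real^3 \<Rightarrow> complex) \<Rightarrow> real^3 \<Rightarrow> real"
  where "potential u x = (\<integral>y. (norm (u y))\<^sup>2 / norm (x - y) \<partial>lebesgue)"

lemma potential_bounds:
  assumes "u \<in> W12"
  shows "0 \<le> potential u x" "potential u x \<le> 3 * (W12_norm u)\<^sup>2"
    "integrable lebesgue (\<lambda>y. (norm (u y))\<^sup>2 / norm (x - y))"
proof -
  show "0 \<le> potential u x" unfolding potential_def by (intro integral_nonneg_AE always_eventually) simp
  have "potential u x \<le> 3 * L2_norm u * W12_norm u"
    using coulomb_product_bound(2)[OF W12_L2[OF assms] assms, of x] by (simp add: potential_def power2_eq_square)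
  also have "\<dots> \<le> 3 * W12_norm u * W12_norm u"
    using L2_norm_le_W12_norm[of u] by (intro mult_right_mono) auto
  finally show "potential u x \<le> 3 * (W12_norm u)\<^sup>2" by (simp add: power2_eq_square)
  show "integrable lebesgue (\<lambda>y. (norm (u y))\<^sup>2 / norm (x - y))"
    using coulomb_product_bound(1)[OF W12_L2[OF assms] assms, of x] by (simp add: power2_eq_square)
qed

text \<open>Measurability of a parameter integral needs a jointly Borel integrand, whereas |u| is
  only Lebesgue measurable. Replacing it by an almost everywhere equal Borel function leaves the
  potential unchanged at every x.\<close>

lemma borel_measurable_potential:
  assumes "u \<in> L2"
  shows "potential u \<in> borel_measurable lebesgue"
proof -
  have "(\<lambda>y. norm (u y)) \<in> borel_measurable (completion lborel)"
    using L2D(1)[OF assms] by measurable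
  then obtain r where r [measurable]: "r \<in> borel_measurable lborel" and ae: "AE y in lborel. norm (u y) = r y"
    using completion_ex_borel_measurable_real by blast
  have [measurable]: "r \<in> borel_measurable borel" using r by simp
  have "potential u x = (\<integral>y. (r y)\<^sup>2 / norm (x - y) \<partial>lborel)" for x
  proof -
    have nm: "(\<lambda>y. norm (x - y)) \<in> borel_measurable lebesgue"
      by (intro borel_measurable_lebesgue_continuous continuous_intros)
    have rm: "r \<in> borel_measurable lebesgue" by (rule measurable_completion[OF r])
    note [measurable] = nm rm L2D(1)[OF assms]
    have "potential u x = (\<integral>y. (r y)\<^sup>2 / norm (x - y) \<partial>lebesgue)"
      unfolding potential_def
    proof (rule integral_cong_AE)
      show "AE y in lebesgue. (norm (u y))\<^sup>2 / norm (x - y) = (r y)\<^sup>2 / norm (x - y)"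
        using AE_completion[OF ae] by eventually_elim simp
    qed measurable
    also have "\<dots> = (\<integral>y. (r y)\<^sup>2 / norm (x - y) \<partial>lborel)"
      by (rule integral_completion) measurable
    finally show ?thesis .
  qed
  moreover have "(\<lambda>x. \<integral>y. (r y)\<^sup>2 / norm (x - y) \<partial>lborel) \<in> borel_measurable lborel"
    by measurable
  ultimately show ?thesis
    by (intro measurable_completion) (simp add: fun_eq_iff cong: measurable_cong)
qed

lemma abs_norm_square_diff_le:
  fixes a b :: "'a::real_normed_vector"
  shows "\<bar>(norm a)\<^sup>2 - (norm b)\<^sup>2\<bar> \<le> norm (a - b) * norm a + norm (a - b) * norm b"
proof -
  have "\<bar>(norm a)\<^sup>2 - (norm b)\<^sup>2\<bar> = \<bar>norm a - norm b\<bar> * (norm a + norm b)"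
    by (simp add: power2_eq_square square_diff_square_factored abs_mult mult.commute)
  also have "\<dots> \<le> norm (a - b) * (norm a + norm b)"
    by (intro mult_right_mono norm_triangle_ineq3) simp
  finally show ?thesis by (simp add: distrib_left)
qed

text \<open>The difference of the densities is at most |w| |u| + |w| |v| with w = u - v. Each
  summand falls under the Coulomb estimate with w as the L2 factor, contributing 3 R times the L2
  norm of w.\<close>

lemma potential_diff_bound:
  assumes u: "u \<in> W12" "W12_norm u \<le> R" and v: "v \<in> W12" "W12_norm v \<le> R"
  shows "\<bar>potential u x - potential v x\<bar> \<le> 6 * R * L2_norm (\<lambda>x. u x - v x)"
proof -
  define w where "w x = u x - v x" for x
  have w: "w \<in> L2" unfolding w_def by (intro L2_diff W12_L2 u v)
  note iu = potential_bounds(3)[OF u(1), of x] and iv = potential_bounds(3)[OF v(1), of x]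
  note cu = coulomb_product_bound[OF w u(1), of x] and cv = coulomb_product_bound[OF w v(1), of x]
  have "\<bar>potential u x - potential v x\<bar> =
      \<bar>\<integral>y. (norm (u y))\<^sup>2 / norm (x - y) - (norm (v y))\<^sup>2 / norm (x - y) \<partial>lebesgue\<bar>"
    unfolding potential_def using iu iv by simp
  also have "\<dots> \<le> (\<integral>y. \<bar>(norm (u y))\<^sup>2 / norm (x - y) - (norm (v y))\<^sup>2 / norm (x - y)\<bar> \<partial>lebesgue)"
    by (rule integral_abs_bound)
  also have "\<dots> \<le> (\<integral>y. norm (w y) * norm (u y) / norm (x - y) + norm (w y) * norm (v y) / norm (x - y) \<partial>lebesgue)"
  proof (rule integral_mono)
    show "integrable lebesgue (\<lambda>y. \<bar>(norm (u y))\<^sup>2 / norm (x - y) - (norm (v y))\<^sup>2 / norm (x - y)\<bar>)"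
      by (intro integrable_abs Bochner_Integration.integrable_diff iu iv)
    show "integrable lebesgue (\<lambda>y. norm (w y) * norm (u y) / norm (x - y) + norm (w y) * norm (v y) / norm (x - y))"
      by (intro Bochner_Integration.integrable_add cu cv)
    show "\<bar>(norm (u y))\<^sup>2 / norm (x - y) - (norm (v y))\<^sup>2 / norm (x - y)\<bar> \<le>
        norm (w y) * norm (u y) / norm (x - y) + norm (w y) * norm (v y) / norm (x - y)" for y
      using divide_right_mono[OF abs_norm_square_diff_le[of "u y" "v y"], of "norm (x - y)"]
      by (simp add: w_def diff_divide_distrib[symmetric] add_divide_distrib)
  qed
  also have "\<dots> = (\<integral>y. norm (w y) * norm (u y) / norm (x - y) \<partial>lebesgue) + (\<integral>y. norm (w y) * norm (v y) / norm (x - y) \<partial>lebesgue)"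
    by (rule Bochner_Integration.integral_add[OF cu(1) cv(1)])
  also have "\<dots> \<le> 3 * L2_norm w * W12_norm u + 3 * L2_norm w * W12_norm v"
    using cu(2) cv(2) by linarith
  also have "\<dots> \<le> 3 * L2_norm w * R + 3 * L2_norm w * R"
    using u(2) v(2) by (intro add_mono mult_left_mono) auto
  finally show ?thesis by (simp add: w_def[abs_def] mult_ac)
qed

text \<open>Common to \<open>g1\<close> and \<open>g2\<close>, which multiply by a bounded real
  weight, a function in the first case and a constant in the second. The splitting is A u - B v = A
  (u - v) + (A - B) v.\<close>

lemma embed_weighted_diff_bound:
  fixes A B :: "real^3 \<Rightarrow> real"
  assumes u: "u \<in> L2" and v: "v \<in> L2" and z: "z \<in> L2"
    and m: "A \<in> borel_measurable lebesgue" "B \<in> borel_measurable lebesgue"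
    and A: "\<And>x. \<bar>A x\<bar> \<le> a" and B: "\<And>x. \<bar>B x\<bar> \<le> a" and d: "\<And>x. \<bar>A x - B x\<bar> \<le> d"
  shows "norm (embed (\<lambda>x. u x * of_real (A x)) z - embed (\<lambda>x. v x * of_real (B x)) z) \<le>
    (a * L2_norm (\<lambda>x. u x - v x) + d * L2_norm v) * L2_norm z"
proof -
  note [measurable] = L2D(1)[OF u] L2D(1)[OF v] L2D(1)[OF z] m
  have w: "(\<lambda>x. u x - v x) \<in> L2" by (rule L2_diff[OF u v])
  have a0: "a \<ge> 0" using A[of 0] by linarith
  have d0: "d \<ge> 0" using d[of 0] by linarith
  have i: "integrable lebesgue (\<lambda>x. f x * of_real (C x) * z x)"
    if f: "f \<in> L2" and [measurable]: "C \<in> borel_measurable lebesgue" and C: "\<And>x. \<bar>C x\<bar> \<le> a" for f C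
  proof (rule Bochner_Integration.integrable_bound)
    note [measurable] = L2D(1)[OF f]
    show "integrable lebesgue (\<lambda>x. a * (norm (f x) * norm (z x)))"
      by (intro integrable_mult_right L2_integrable_norm_mult f z)
    show "(\<lambda>x. f x * of_real (C x) * z x) \<in> borel_measurable lebesgue" by measurable
    have "norm (f x * of_real (C x) * z x) \<le> a * (norm (f x) * norm (z x))" for x
      using mult_right_mono[OF C[of x], of "norm (f x) * norm (z x)"] by (simp add: norm_mult mult_ac)
    then show "AE x in lebesgue. norm (f x * of_real (C x) * z x) \<le> norm (a * (norm (f x) * norm (z x)))"
      using a0 by (simp add: abs_of_nonneg)
  qed
  note iu = i[OF u m(1) A] and iv = i[OF v m(2) B]
  have "norm (embed (\<lambda>x. u x * of_real (A x)) z - embed (\<lambda>x. v x * of_real (B x)) z) =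
      norm (\<integral>x. u x * of_real (A x) * z x - v x * of_real (B x) * z x \<partial>lebesgue)"
    unfolding embed_def using iu iv by simp
  also have "\<dots> \<le> (\<integral>x. norm (u x * of_real (A x) * z x - v x * of_real (B x) * z x) \<partial>lebesgue)"
    by (rule integral_norm_bound)
  also have "\<dots> \<le> (\<integral>x. a * (norm (u x - v x) * norm (z x)) + d * (norm (v x) * norm (z x)) \<partial>lebesgue)"
  proof (rule integral_mono)
    show "integrable lebesgue (\<lambda>x. norm (u x * of_real (A x) * z x - v x * of_real (B x) * z x))"
      by (intro integrable_norm Bochner_Integration.integrable_diff iu iv)
    show "integrable lebesgue (\<lambda>x. a * (norm (u x - v x) * norm (z x)) + d * (norm (v x) * norm (z x)))"
      by (intro Bochner_Integration.integrable_add integrable_mult_right L2_integrable_norm_mult w v z)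
    fix x
    have "u x * of_real (A x) * z x - v x * of_real (B x) * z x =
        of_real (A x) * ((u x - v x) * z x) + of_real (A x - B x) * (v x * z x)"
      by (simp add: algebra_simps)
    then have "norm (u x * of_real (A x) * z x - v x * of_real (B x) * z x) \<le>
        \<bar>A x\<bar> * (norm (u x - v x) * norm (z x)) + \<bar>A x - B x\<bar> * (norm (v x) * norm (z x))"
      using norm_triangle_ineq[of "of_real (A x) * ((u x - v x) * z x)" "of_real (A x - B x) * (v x * z x)"]
      by (simp only: norm_mult norm_of_real)
    also have "\<dots> \<le> a * (norm (u x - v x) * norm (z x)) + d * (norm (v x) * norm (z x))"
      by (intro add_mono mult_right_mono A d) auto
    finally show "norm (u x * of_real (A x) * z x - v x * of_real (B x) * z x) \<le>
        a * (norm (u x - v x) * norm (z x)) + d * (norm (v x) * norm (z x))" .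
  qed
  also have "\<dots> = a * (\<integral>x. norm (u x - v x) * norm (z x) \<partial>lebesgue) + d * (\<integral>x. norm (v x) * norm (z x) \<partial>lebesgue)"
    using L2_integrable_norm_mult[OF w z] L2_integrable_norm_mult[OF v z] by simp
  also have "\<dots> \<le> a * (L2_norm (\<lambda>x. u x - v x) * L2_norm z) + d * (L2_norm v * L2_norm z)"
    by (intro add_mono mult_left_mono L2_Cauchy_Schwarz w v z a0 d0)
  finally show ?thesis by (simp add: algebra_simps)
qed

lemma g1_diff_bound:
  assumes u: "u \<in> W12" "W12_norm u \<le> R" and v: "v \<in> W12" "W12_norm v \<le> R" and z: "z \<in> L2"
  shows "norm (embed (g1 u) z - embed (g1 v) z) \<le> 9 * R\<^sup>2 * L2_norm (\<lambda>x. u x - v x) * L2_norm z"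
proof -
  have R: "R \<ge> 0" using u(2) W12_norm_nonneg[of u] by linarith
  have V: "\<bar>potential f x\<bar> \<le> 3 * R\<^sup>2" if "f \<in> W12" "W12_norm f \<le> R" for f x
  proof -
    have "(W12_norm f)\<^sup>2 \<le> R\<^sup>2" using that(2) by (intro power_mono) auto
    then show ?thesis using potential_bounds(1,2)[OF that(1), of x] by linarith
  qed
  have "g1 f = (\<lambda>x. f x * of_real (potential f x))" for f
    by (simp add: g1_def potential_def)
  then have "norm (embed (g1 u) z - embed (g1 v) z) \<le>
      (3 * R\<^sup>2 * L2_norm (\<lambda>x. u x - v x) + 6 * R * L2_norm (\<lambda>x. u x - v x) * L2_norm v) * L2_norm z"
    using embed_weighted_diff_bound[OF W12_L2[OF u(1)] W12_L2[OF v(1)] z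
        borel_measurable_potential[OF W12_L2[OF u(1)]] borel_measurable_potential[OF W12_L2[OF v(1)]]
        V[OF u] V[OF v] potential_diff_bound[OF u v]] by simp
  also have "\<dots> \<le> (3 * R\<^sup>2 * L2_norm (\<lambda>x. u x - v x) + 6 * R * L2_norm (\<lambda>x. u x - v x) * R) * L2_norm z"
    using R order_trans[OF L2_norm_le_W12_norm v(2)] by (intro mult_right_mono add_left_mono mult_left_mono) auto
  also have "\<dots> = 9 * R\<^sup>2 * L2_norm (\<lambda>x. u x - v x) * L2_norm z"
    by (simp add: power2_eq_square algebra_simps)
  finally show ?thesis .
qed

text \<open>The double integral of \<open>g2\<close>, arranged so that the inner integral is the
  potential and its bounds apply.\<close>

definition self_energy :: "(real^3 \<Rightarrow> complex) \<Rightarrow> real"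
  where "self_energy u = (\<integral>z. (norm (u z))\<^sup>2 * potential u z \<partial>lebesgue)"

lemma g2_eq: "g2 u = (\<lambda>x. u x * of_real (self_energy u))"
proof -
  have "(\<integral>y. (norm (u y))\<^sup>2 * (norm (u z))\<^sup>2 / norm (z - y) \<partial>lebesgue) = (norm (u z))\<^sup>2 * potential u z" for z
  proof -
    have "(\<integral>y. (norm (u y))\<^sup>2 * (norm (u z))\<^sup>2 / norm (z - y) \<partial>lebesgue) =
        (\<integral>y. (norm (u z))\<^sup>2 * ((norm (u y))\<^sup>2 / norm (z - y)) \<partial>lebesgue)"
      by (simp add: mult_ac)
    also have "\<dots> = (norm (u z))\<^sup>2 * potential u z"
      unfolding potential_def by (rule Bochner_Integration.integral_mult_right_zero)
    finally show ?thesis .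
  qed
  then show ?thesis by (simp add: g2_def self_energy_def)
qed

lemma self_energy_integrable:
  assumes "u \<in> W12"
  shows "integrable lebesgue (\<lambda>z. (norm (u z))\<^sup>2 * potential u z)"
proof (rule Bochner_Integration.integrable_bound)
  note [measurable] = L2D(1)[OF W12_L2[OF assms]] borel_measurable_potential[OF W12_L2[OF assms]]
  show "integrable lebesgue (\<lambda>z. 3 * (W12_norm u)\<^sup>2 * (norm (u z))\<^sup>2)"
    by (intro integrable_mult_right L2D(2) W12_L2 assms)
  show "(\<lambda>z. (norm (u z))\<^sup>2 * potential u z) \<in> borel_measurable lebesgue" by measurable
  have "norm ((norm (u z))\<^sup>2 * potential u z) \<le> norm (3 * (W12_norm u)\<^sup>2 * (norm (u z))\<^sup>2)" for z
    using potential_bounds(1,2)[OF assms, of z] mult_right_mono[of "potential u z" "3 * (W12_norm u)\<^sup>2" "(norm (u z))\<^sup>2"]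
    by (simp add: abs_mult mult_ac)
  then show "AE z in lebesgue. norm ((norm (u z))\<^sup>2 * potential u z) \<le> norm (3 * (W12_norm u)\<^sup>2 * (norm (u z))\<^sup>2)"
    by simp
qed

lemma self_energy_bound:
  assumes "u \<in> W12" "W12_norm u \<le> R"
  shows "\<bar>self_energy u\<bar> \<le> 3 * R ^ 4"
proof -
  have sq: "(W12_norm u)\<^sup>2 \<le> R\<^sup>2" using assms(2) by (intro power_mono) auto
  have L: "(L2_norm u)\<^sup>2 \<le> R\<^sup>2"
    using order_trans[OF L2_norm_le_W12_norm assms(2)] by (intro power_mono) auto
  have nonneg: "0 \<le> self_energy u"
    unfolding self_energy_def using potential_bounds(1)[OF assms(1)]
    by (intro integral_nonneg_AE always_eventually) auto
  have "self_energy u \<le> (\<integral>z. 3 * R\<^sup>2 * (norm (u z))\<^sup>2 \<partial>lebesgue)"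
    unfolding self_energy_def
  proof (rule integral_mono[OF self_energy_integrable[OF assms(1)]])
    show "integrable lebesgue (\<lambda>z. 3 * R\<^sup>2 * (norm (u z))\<^sup>2)"
      by (intro integrable_mult_right L2D(2) W12_L2 assms)
    have "potential u z \<le> 3 * R\<^sup>2" for z
      using potential_bounds(2)[OF assms(1), of z] sq by linarith
    then show "(norm (u z))\<^sup>2 * potential u z \<le> 3 * R\<^sup>2 * (norm (u z))\<^sup>2" for z
      using mult_right_mono[of "potential u z" "3 * R\<^sup>2" "(norm (u z))\<^sup>2"] by (simp add: mult.commute)
  qed
  also have "(\<integral>z. 3 * R\<^sup>2 * (norm (u z))\<^sup>2 \<partial>lebesgue) = 3 * R\<^sup>2 * (L2_norm u)\<^sup>2"
    by (simp add: L2_norm_square)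
  also have "3 * R\<^sup>2 * (L2_norm u)\<^sup>2 \<le> 3 * R\<^sup>2 * R\<^sup>2"
    using L by (intro mult_left_mono) auto
  also have "3 * R\<^sup>2 * R\<^sup>2 = 3 * R ^ 4" by (simp add: power_add[symmetric])
  finally show ?thesis using nonneg by linarith
qed

text \<open>Split into a change of the density against the potential of u, and a change of the
  potential against the density of v. With W the L2 norm of u - v, this gives 3 R^2 * 2 R W + 6 R W
  * R^2 = 12 R^3 W.\<close>

lemma self_energy_diff_bound:
  assumes u: "u \<in> W12" "W12_norm u \<le> R" and v: "v \<in> W12" "W12_norm v \<le> R"
  shows "\<bar>self_energy u - self_energy v\<bar> \<le> 12 * R ^ 3 * L2_norm (\<lambda>x. u x - v x)"
proof -
  define w where "w x = u x - v x" for x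
  let ?W = "L2_norm w"
  have w: "w \<in> L2" unfolding w_def by (intro L2_diff W12_L2 u v)
  have R: "R \<ge> 0" using u(2) W12_norm_nonneg[of u] by linarith
  note u2 = W12_L2[OF u(1)] and v2 = W12_L2[OF v(1)]
  have sq: "(W12_norm u)\<^sup>2 \<le> R\<^sup>2" using u(2) by (intro power_mono) auto
  have Lu: "L2_norm u \<le> R" and Lv: "L2_norm v \<le> R"
    using order_trans[OF L2_norm_le_W12_norm u(2)] order_trans[OF L2_norm_le_W12_norm v(2)] by auto
  note i = L2_integrable_norm_mult[OF w u2] L2_integrable_norm_mult[OF w v2] L2D(2)[OF v2]
  have "\<bar>self_energy u - self_energy v\<bar> =
      \<bar>\<integral>z. (norm (u z))\<^sup>2 * potential u z - (norm (v z))\<^sup>2 * potential v z \<partial>lebesgue\<bar>"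
    unfolding self_energy_def using self_energy_integrable[OF u(1)] self_energy_integrable[OF v(1)] by simp
  also have "\<dots> \<le> (\<integral>z. \<bar>(norm (u z))\<^sup>2 * potential u z - (norm (v z))\<^sup>2 * potential v z\<bar> \<partial>lebesgue)"
    by (rule integral_abs_bound)
  also have "\<dots> \<le> (\<integral>z. 3 * R\<^sup>2 * (norm (w z) * norm (u z) + norm (w z) * norm (v z)) + 6 * R * ?W * (norm (v z))\<^sup>2 \<partial>lebesgue)"
  proof (rule integral_mono)
    show "integrable lebesgue (\<lambda>z. \<bar>(norm (u z))\<^sup>2 * potential u z - (norm (v z))\<^sup>2 * potential v z\<bar>)"
      by (intro integrable_abs Bochner_Integration.integrable_diff self_energy_integrable u v)
    show "integrable lebesgue (\<lambda>z. 3 * R\<^sup>2 * (norm (w z) * norm (u z) + norm (w z) * norm (v z)) + 6 * R * ?W * (norm (v z))\<^sup>2)"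
      by (intro Bochner_Integration.integrable_add integrable_mult_right i)
    fix z
    have V: "\<bar>potential u z\<bar> \<le> 3 * R\<^sup>2" using potential_bounds(1,2)[OF u(1), of z] sq by linarith
    have "(norm (u z))\<^sup>2 * potential u z - (norm (v z))\<^sup>2 * potential v z =
        potential u z * ((norm (u z))\<^sup>2 - (norm (v z))\<^sup>2) + (potential u z - potential v z) * (norm (v z))\<^sup>2"
      by (simp add: algebra_simps)
    then have "\<bar>(norm (u z))\<^sup>2 * potential u z - (norm (v z))\<^sup>2 * potential v z\<bar> \<le>
        \<bar>potential u z\<bar> * \<bar>(norm (u z))\<^sup>2 - (norm (v z))\<^sup>2\<bar> + \<bar>potential u z - potential v z\<bar> * (norm (v z))\<^sup>2"
      using abs_triangle_ineq[of "potential u z * ((norm (u z))\<^sup>2 - (norm (v z))\<^sup>2)" "(potential u z - potential v z) * (norm (v z))\<^sup>2"]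
      by (simp add: abs_mult)
    also have "\<dots> \<le> 3 * R\<^sup>2 * (norm (w z) * norm (u z) + norm (w z) * norm (v z)) + 6 * R * ?W * (norm (v z))\<^sup>2"
      using V abs_norm_square_diff_le[of "u z" "v z"] potential_diff_bound[OF u v, of z] R
      unfolding w_def[abs_def] by (intro add_mono mult_mono) auto
    finally show "\<bar>(norm (u z))\<^sup>2 * potential u z - (norm (v z))\<^sup>2 * potential v z\<bar> \<le>
      3 * R\<^sup>2 * (norm (w z) * norm (u z) + norm (w z) * norm (v z)) + 6 * R * ?W * (norm (v z))\<^sup>2" .
  qed
  also have "\<dots> = 3 * R\<^sup>2 * ((\<integral>z. norm (w z) * norm (u z) \<partial>lebesgue) + (\<integral>z. norm (w z) * norm (v z) \<partial>lebesgue)) + 6 * R * ?W * (L2_norm v)\<^sup>2"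
    using i by (simp add: L2_norm_square)
  also have "\<dots> \<le> 3 * R\<^sup>2 * (?W * R + ?W * R) + 6 * R * ?W * R\<^sup>2"
  proof (intro add_mono mult_left_mono)
    show "(\<integral>z. norm (w z) * norm (u z) \<partial>lebesgue) \<le> ?W * R"
      using L2_Cauchy_Schwarz[OF w u2] mult_left_mono[OF Lu, of ?W] by simp
    show "(\<integral>z. norm (w z) * norm (v z) \<partial>lebesgue) \<le> ?W * R"
      using L2_Cauchy_Schwarz[OF w v2] mult_left_mono[OF Lv, of ?W] by simp
    show "(L2_norm v)\<^sup>2 \<le> R\<^sup>2" using Lv by (intro power_mono) auto
  qed (use R in auto)
  also have "\<dots> = 12 * R ^ 3 * ?W"
    by (simp add: power2_eq_square power3_eq_cube)
  finally show ?thesis by (simp add: w_def[abs_def])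
qed

lemma g2_diff_bound:
  assumes u: "u \<in> W12" "W12_norm u \<le> R" and v: "v \<in> W12" "W12_norm v \<le> R" and z: "z \<in> L2"
  shows "norm (embed (g2 u) z - embed (g2 v) z) \<le> 15 * R ^ 4 * L2_norm (\<lambda>x. u x - v x) * L2_norm z"
proof -
  have R: "R \<ge> 0" using u(2) W12_norm_nonneg[of u] by linarith
  have "norm (embed (g2 u) z - embed (g2 v) z) \<le>
      (3 * R ^ 4 * L2_norm (\<lambda>x. u x - v x) + 12 * R ^ 3 * L2_norm (\<lambda>x. u x - v x) * L2_norm v) * L2_norm z"
    unfolding g2_eq
    by (rule embed_weighted_diff_bound[OF W12_L2[OF u(1)] W12_L2[OF v(1)] z borel_measurable_const borel_measurable_const
        self_energy_bound[OF u] self_energy_bound[OF v] self_energy_diff_bound[OF u v]])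
  also have "\<dots> \<le> (3 * R ^ 4 * L2_norm (\<lambda>x. u x - v x) + 12 * R ^ 3 * L2_norm (\<lambda>x. u x - v x) * R) * L2_norm z"
    using R order_trans[OF L2_norm_le_W12_norm v(2)] by (intro mult_right_mono add_left_mono mult_left_mono) auto
  also have "\<dots> = 15 * R ^ 4 * L2_norm (\<lambda>x. u x - v x) * L2_norm z"
    by (simp add: power4_eq_xxxx power3_eq_cube algebra_simps)
  finally show ?thesis .
qed

section \<open>The Laplacian\<close>

lemma gradient_product_integrable:
  assumes "g \<in> L2" "h \<in> L2"
  shows "integrable lebesgue (\<lambda>x. \<Sum>j\<in>UNIV. (g :: real^3 \<Rightarrow> complex^3) x $ j * h x $ j)"
  by (intro Bochner_Integration.integrable_sum L2_mult(1) L2_component assms)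

lemma laplacian_diff:
  assumes "u \<in> W12" "v \<in> W12" "z \<in> W12"
  shows "laplacian (\<lambda>x. u x - v x) z = laplacian u z - laplacian v z"
proof -
  note g = weak_gradient_works(1)
  note d = W12_diff[OF assms(1,2)]
  have "(\<integral>x. (\<Sum>j\<in>UNIV. weak_gradient (\<lambda>x. u x - v x) x $ j * weak_gradient z x $ j) \<partial>lebesgue) =
      (\<integral>x. (\<Sum>j\<in>UNIV. weak_gradient u x $ j * weak_gradient z x $ j) - (\<Sum>j\<in>UNIV. weak_gradient v x $ j * weak_gradient z x $ j) \<partial>lebesgue)"
  proof (rule integral_cong_AE)
    show "AE x in lebesgue. (\<Sum>j\<in>UNIV. weak_gradient (\<lambda>x. u x - v x) x $ j * weak_gradient z x $ j) =
        (\<Sum>j\<in>UNIV. weak_gradient u x $ j * weak_gradient z x $ j) - (\<Sum>j\<in>UNIV. weak_gradient v x $ j * weak_gradient z x $ j)"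
      using d(2) by eventually_elim (simp add: left_diff_distrib sum_subtractf)
  qed (intro borel_measurable_integrable Bochner_Integration.integrable_diff gradient_product_integrable g assms d(1))+
  also have "\<dots> = (\<integral>x. (\<Sum>j\<in>UNIV. weak_gradient u x $ j * weak_gradient z x $ j) \<partial>lebesgue) -
      (\<integral>x. (\<Sum>j\<in>UNIV. weak_gradient v x $ j * weak_gradient z x $ j) \<partial>lebesgue)"
    by (intro Bochner_Integration.integral_diff gradient_product_integrable g assms)
  finally show ?thesis by (simp add: laplacian_def)
qed

text \<open>The gradient commutes with conjugation and the bilinear form is symmetric, so the form
  becomes hermitian once one argument is conjugated.\<close>

lemma laplacian_hermitian:
  assumes "u \<in> W12" "v \<in> W12"
  shows "laplacian u (\<lambda>x. cnj (v x)) = cnj (laplacian v (\<lambda>x. cnj (u x)))"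
proof -
  have "(\<integral>x. (\<Sum>j\<in>UNIV. weak_gradient u x $ j * weak_gradient (\<lambda>x. cnj (v x)) x $ j) \<partial>lebesgue) =
      (\<integral>x. cnj (\<Sum>j\<in>UNIV. weak_gradient v x $ j * weak_gradient (\<lambda>x. cnj (u x)) x $ j) \<partial>lebesgue)"
  proof (rule integral_cong_AE)
    show "AE x in lebesgue. (\<Sum>j\<in>UNIV. weak_gradient u x $ j * weak_gradient (\<lambda>x. cnj (v x)) x $ j) =
        cnj (\<Sum>j\<in>UNIV. weak_gradient v x $ j * weak_gradient (\<lambda>x. cnj (u x)) x $ j)"
      using W12_cnj(2)[OF assms(1)] W12_cnj(2)[OF assms(2)] by eventually_elim (simp add: mult.commute)
    show "(\<lambda>x. cnj (\<Sum>j\<in>UNIV. weak_gradient v x $ j * weak_gradient (\<lambda>x. cnj (u x)) x $ j)) \<in> borel_measurable lebesgue"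
      by (rule borel_measurable_integrable[OF integrable_cnj])
        (intro gradient_product_integrable weak_gradient_works(1) W12_cnj(1) assms)
  qed (intro borel_measurable_integrable gradient_product_integrable weak_gradient_works(1) W12_cnj(1) assms)
  then show ?thesis by (simp only: laplacian_def Bochner_Integration.integral_cnj complex_cnj_minus)
qed

text \<open>The equation at a single time, with a = hbar / (2 m) and b = 4 pi G m^2 / hbar as real
  parameters, so that the energy algebra can be done without reference to time.\<close>

definition solves_equation ::
    "real \<Rightarrow> real \<Rightarrow> (real^3 \<Rightarrow> complex) \<Rightarrow> ((real^3 \<Rightarrow> complex) \<Rightarrow> complex) \<Rightarrow> bool"
  where "solves_equation a b u P \<longleftrightarrow> (\<forall>v\<in>W12. \<i> * P v =
    - complex_of_real a * laplacian u v
    + \<i> * complex_of_real b * embed (g1 u) v - \<i> * complex_of_real b * embed (g2 u) v)"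

text \<open>The dispersive part is anti-selfadjoint, so it drops out of the symmetrised energy identity.\<close>

lemma symmetrised_energy_bound:
  assumes u: "\<And>i::bool. u i \<in> W12" "\<And>i. W12_norm (u i) \<le> R"
    and v: "\<And>i::bool. v i \<in> W12" "\<And>i. W12_norm (v i) \<le> R"
    and P: "\<And>i. solves_equation a b (u i) (P i)"
    and Q: "\<And>i. solves_equation a b (v i) (Q i)"
  defines "w \<equiv> \<lambda>x. u True x - u False x" and "z \<equiv> \<lambda>x. v True x - v False x"
  shows "\<bar>Re (P True (\<lambda>x. cnj (z x)) - P False (\<lambda>x. cnj (z x))) +
      Re (Q True (\<lambda>x. cnj (w x)) - Q False (\<lambda>x. cnj (w x)))\<bar> \<le>
    2 * \<bar>b\<bar> * (9 * R\<^sup>2 + 15 * R ^ 4) * L2_norm w * L2_norm z"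
proof -
  let ?K = "9 * R\<^sup>2 + 15 * R ^ 4"
  \<comment> \<open>Multiplying the equation by - i isolates the time derivative; the Laplacian
    keeps an imaginary coefficient and the nonlinear terms get a real one.\<close>
  have solve: "F y = \<i> * of_real a * laplacian f y + of_real b * (embed (g1 f) y - embed (g2 f) y)"
    if "solves_equation a b f F" "y \<in> W12" for F f y
  proof -
    have "F y = - \<i> * (\<i> * F y)" by simp
    also have "\<i> * F y = - complex_of_real a * laplacian f y
        + \<i> * complex_of_real b * embed (g1 f) y - \<i> * complex_of_real b * embed (g2 f) y"
      using that unfolding solves_equation_def by blast
    also have "- \<i> * \<dots> = \<i> * of_real a * laplacian f y + of_real b * (embed (g1 f) y - embed (g2 f) y)"
      by (simp add: algebra_simps)
    finally show ?thesis .
  qed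
  have w: "w \<in> W12" and z: "z \<in> W12"
    unfolding w_def z_def by (intro W12_diff u v)+
  let ?zc = "\<lambda>x. cnj (z x)" and ?wc = "\<lambda>x. cnj (w x)"
  note zc = W12_cnj(1)[OF z] and wc = W12_cnj(1)[OF w]
  define N where "N = (embed (g1 (u True)) ?zc - embed (g1 (u False)) ?zc) - (embed (g2 (u True)) ?zc - embed (g2 (u False)) ?zc)"
  define N' where "N' = (embed (g1 (v True)) ?wc - embed (g1 (v False)) ?wc) - (embed (g2 (v True)) ?wc - embed (g2 (v False)) ?wc)"
  have "P True ?zc - P False ?zc = \<i> * of_real a * laplacian w ?zc + of_real b * N"
    unfolding solve[OF P zc] w_def laplacian_diff[OF u(1) u(1) zc] N_def by (simp add: algebra_simps)
  moreover have "Q True ?wc - Q False ?wc = \<i> * of_real a * cnj (laplacian w ?zc) + of_real b * N'"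
    unfolding laplacian_hermitian[OF w z] complex_cnj_cnj
    unfolding solve[OF Q wc] z_def laplacian_diff[OF v(1) v(1) wc] N'_def by (simp add: algebra_simps)
  \<comment> \<open>The two Laplacian contributions are i a L and i a times the conjugate of L, so
    their sum is 2 i a Re L, purely imaginary because a is real.\<close>
  ultimately have eq: "Re (P True ?zc - P False ?zc) + Re (Q True ?wc - Q False ?wc) = b * Re N + b * Re N'"
    by simp
  have N: "norm N \<le> ?K * L2_norm w * L2_norm z"
  proof -
    have "norm N \<le> 9 * R\<^sup>2 * L2_norm w * L2_norm ?zc + 15 * R ^ 4 * L2_norm w * L2_norm ?zc"
      unfolding N_def w_def
      by (intro order_trans[OF norm_triangle_ineq4] add_mono g1_diff_bound g2_diff_bound u W12_L2 zc)
    then show ?thesis by (simp add: L2_cnj(2)[OF W12_L2[OF z]] algebra_simps)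
  qed
  have N': "norm N' \<le> ?K * L2_norm w * L2_norm z"
  proof -
    have "norm N' \<le> 9 * R\<^sup>2 * L2_norm z * L2_norm ?wc + 15 * R ^ 4 * L2_norm z * L2_norm ?wc"
      unfolding N'_def z_def
      by (intro order_trans[OF norm_triangle_ineq4] add_mono g1_diff_bound g2_diff_bound v W12_L2 wc)
    then show ?thesis by (simp add: L2_cnj(2)[OF W12_L2[OF w]] algebra_simps)
  qed
  have "\<bar>b * Re N + b * Re N'\<bar> \<le> \<bar>b\<bar> * norm N + \<bar>b\<bar> * norm N'"
    by (intro order_trans[OF abs_triangle_ineq] add_mono) (auto simp: abs_mult intro!: mult_left_mono abs_Re_le_cmod)
  also have "\<dots> \<le> \<bar>b\<bar> * (?K * L2_norm w * L2_norm z) + \<bar>b\<bar> * (?K * L2_norm w * L2_norm z)"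
    by (intro add_mono mult_left_mono N N') auto
  finally have "\<bar>b * Re N + b * Re N'\<bar> \<le> 2 * \<bar>b\<bar> * ?K * L2_norm w * L2_norm z" by (simp add: mult_ac)
  then show ?thesis unfolding eq .
qed

section \<open>Evaluating dual-valued functions\<close>

lemma W12_dual_add:
  assumes "F \<in> W12_dual" "G \<in> W12_dual"
  shows "F + G \<in> W12_dual"
proof -
  obtain C where C: "\<And>u. u \<in> W12 \<Longrightarrow> norm (F u) \<le> C * W12_norm u"
    using assms(1) unfolding W12_dual_def by blast
  obtain D where D: "\<And>u. u \<in> W12 \<Longrightarrow> norm (G u) \<le> D * W12_norm u"
    using assms(2) unfolding W12_dual_def by blast
  have "norm ((F + G) u) \<le> (C + D) * W12_norm u" if "u \<in> W12" for u
    using norm_triangle_ineq[of "F u" "G u"] C[OF that] D[OF that] by (simp add: algebra_simps)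
  then have "\<exists>C. \<forall>u\<in>W12. norm ((F + G) u) \<le> C * W12_norm u" by blast
  then show ?thesis
    unfolding W12_dual_def using W12_dualD(1,2)[OF assms(1)] W12_dualD(1,2)[OF assms(2)]
    by (simp add: algebra_simps)
qed

lemma W12_dual_scaleR:
  assumes "F \<in> W12_dual"
  shows "c *\<^sub>R F \<in> W12_dual"
proof -
  obtain C where C: "\<And>u. u \<in> W12 \<Longrightarrow> norm (F u) \<le> C * W12_norm u"
    using assms(1) unfolding W12_dual_def by blast
  have "norm ((c *\<^sub>R F) u) \<le> (\<bar>c\<bar> * C) * W12_norm u" if "u \<in> W12" for u
    using mult_left_mono[OF C[OF that], of "\<bar>c\<bar>"] by (simp add: scaleR_fun_def mult.assoc)
  then have "\<exists>C. \<forall>u\<in>W12. norm ((c *\<^sub>R F) u) \<le> C * W12_norm u" by blast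
  then show ?thesis
    unfolding W12_dual_def using W12_dualD(1,2)[OF assms(1)]
    by (simp add: scaleR_fun_def scaleR_add_right)
qed

lemma W12_dual_0: "0 \<in> W12_dual"
  unfolding W12_dual_def by (auto intro: exI[of _ 0])

lemma W12_dual_sum: "(\<And>i. i \<in> A \<Longrightarrow> F i \<in> W12_dual) \<Longrightarrow> (\<Sum>i\<in>A. F i) \<in> W12_dual"
  by (induction A rule: infinite_finite_induct) (simp_all add: W12_dual_0 W12_dual_add)

text \<open>The integrand will be a dual norm of a vector-valued difference, whose measurability is
  not at hand. One inequality survives without it: divide any simple function below c g by c and
  compare under the supremum that defines the integral.\<close>

lemma nn_integral_cmult_le:
  assumes "c > 0"
  shows "(\<integral>\<^sup>+x. ennreal c * g x \<partial>M) \<le> ennreal c * (\<integral>\<^sup>+x. g x \<partial>M)"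
  unfolding nn_integral_def[of M "\<lambda>x. ennreal c * g x"]
proof (rule SUP_least)
  fix h assume "h \<in> {h. simple_function M h \<and> h \<le> (\<lambda>x. ennreal c * g x)}"
  then have h: "simple_function M h" "\<And>x. h x \<le> ennreal c * g x" by (auto simp: le_fun_def)
  note [measurable] = borel_measurable_simple_function[OF h(1)]
  have inv: "ennreal c * ennreal (1 / c) = 1"
    using assms by (simp add: ennreal_mult[symmetric] ennreal_1[symmetric] del: ennreal_1)
  have le: "ennreal (1 / c) * h x \<le> g x" for x
  proof -
    have "ennreal (1 / c) * h x \<le> ennreal (1 / c) * (ennreal c * g x)"
      by (intro mult_left_mono h(2)) simp
    also have "\<dots> = g x" using inv by (simp add: mult.assoc[symmetric] mult.commute)
    finally show ?thesis .
  qed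
  have "integral\<^sup>S M h = (\<integral>\<^sup>+x. h x \<partial>M)" by (rule nn_integral_eq_simple_integral[OF h(1), symmetric])
  also have "\<dots> = (\<integral>\<^sup>+x. ennreal c * (ennreal (1 / c) * h x) \<partial>M)"
    using inv by (simp add: mult.assoc[symmetric])
  also have "\<dots> = ennreal c * (\<integral>\<^sup>+x. ennreal (1 / c) * h x \<partial>M)"
    by (rule nn_integral_cmult) measurable
  also have "\<dots> \<le> ennreal c * (\<integral>\<^sup>+x. g x \<partial>M)"
    by (intro mult_left_mono nn_integral_mono le) simp
  finally show "integral\<^sup>S M h \<le> ennreal c * (\<integral>\<^sup>+x. g x \<partial>M)" .
qed

text \<open>The everywhere defined \<open>lim\<close> is measurable, and completeness of the
  restricted Lebesgue measure passes this on to the almost everywhere limit.\<close>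

lemma borel_measurable_AE_limit:
  fixes f :: "nat \<Rightarrow> real \<Rightarrow> complex"
  assumes "I \<in> sets lebesgue"
    and "\<And>n. f n \<in> borel_measurable (lebesgue_on I)"
    and "AE t in lebesgue_on I. (\<lambda>n. f n t) \<longlonglongrightarrow> g t"
  shows "g \<in> borel_measurable (lebesgue_on I)"
proof -
  interpret complete_measure "lebesgue_on I"
    by (rule complete_measure_lebesgue_on[OF assms(1)])
  show ?thesis
  proof (rule borel_measurable_AE_cong)
    show "(\<lambda>t. lim (\<lambda>n. f n t)) \<in> borel_measurable (lebesgue_on I)"
      by (intro borel_measurable_lim_metric assms)
    show "AE t in lebesgue_on I. lim (\<lambda>n. f n t) = g t"
      using assms(3) by eventually_elim (rule limI)
  qed
qed

lemma simple_function_eval_measurable: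
  assumes "simple_function M s"
  shows "(\<lambda>t. (s t v :: complex)) \<in> borel_measurable M"
  using simple_function_compose1[OF assms, of "\<lambda>F. F v"] by (rule borel_measurable_simple_function)

lemma tendsto_dual_eval:
  assumes F: "F \<in> W12_dual" and s: "\<And>n. s n \<in> W12_dual"
    and lim: "(\<lambda>n. W12_dual_norm (F - s n)) \<longlonglongrightarrow> 0" and v: "v \<in> W12"
  shows "(\<lambda>n. s n v) \<longlonglongrightarrow> F v"
proof (rule LIM_zero_cancel, rule Lim_null_comparison)
  show "(\<lambda>n. W12_dual_norm (F - s n) * W12_norm v) \<longlonglongrightarrow> 0"
    using tendsto_mult_right[OF lim, of "W12_norm v"] by simp
  have "norm (s n v - F v) \<le> W12_dual_norm (F - s n) * W12_norm v" for n
    using W12_dual_bound[OF W12_dual_diff[OF F s] v, of n] by (simp add: norm_minus_commute)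
  then show "\<forall>\<^sub>F n in sequentially. norm (s n v - F v) \<le> W12_dual_norm (F - s n) * W12_norm v"
    by simp
qed

lemma strongly_measurable_dual_eval:
  assumes I: "I \<in> sets lebesgue" and f: "strongly_measurable I W12_dual W12_dual_norm f" and v: "v \<in> W12"
  shows "(\<lambda>t. f t v) \<in> borel_measurable (lebesgue_on I)"
proof -
  have dual: "AE t in lebesgue_on I. f t \<in> W12_dual"
    using f by (simp add: strongly_measurable_def)
  obtain s where s: "\<And>n. simple_function (lebesgue_on I) (s n)" "\<And>n. s n ` I \<subseteq> W12_dual"
    and lim: "AE t in lebesgue_on I. (\<lambda>n. W12_dual_norm (f t - s n t)) \<longlonglongrightarrow> 0"
    using f unfolding strongly_measurable_def by blast
  have "AE t in lebesgue_on I. t \<in> I"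
    by (rule AE_I2) simp
  with dual lim have "AE t in lebesgue_on I. (\<lambda>n. s n t v) \<longlonglongrightarrow> f t v"
  proof eventually_elim
    case (elim t)
    then have "s n t \<in> W12_dual" for n using s(2)[of n] by blast
    then show ?case by (rule tendsto_dual_eval[OF elim(1) _ elim(2) v])
  qed
  then show ?thesis
    by (rule borel_measurable_AE_limit[OF I simple_function_eval_measurable[OF s(1)]])
qed

text \<open>Evaluation at v is linear and continuous for the dual norm, so the simple functions that
  approximate f evaluate to simple functions that approximate the scalar integrand, and their
  integrals evaluate accordingly.\<close>

lemma has_bochner_integral_dual_eval:
  assumes I: "I \<in> sets lebesgue" and f: "has_bochner_integral_in I W12_dual W12_dual_norm f x"
    and v: "v \<in> W12"
  shows "has_bochner_integral (lebesgue_on I) (\<lambda>t. f t v) (x v)"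
proof -
  let ?M = "lebesgue_on I"
  \<comment> \<open>The added 1 makes the constant strictly positive, as pulling it out of the
    integral requires, even when v has norm 0.\<close>
  define V where "V = W12_norm v + 1"
  have sp: "space ?M = I" by simp
  have sm: "strongly_measurable I W12_dual W12_dual_norm f" and x: "x \<in> W12_dual"
    using f by (simp_all add: has_bochner_integral_in_def)
  have dual: "AE t in ?M. f t \<in> W12_dual"
    using sm by (simp add: strongly_measurable_def)
  obtain s where s: "\<And>n. Bochner_Integration.simple_bochner_integrable ?M (s n)" "\<And>n. s n ` I \<subseteq> W12_dual"
    and lim: "(\<lambda>n. \<integral>\<^sup>+t. ennreal (W12_dual_norm (f t - s n t)) \<partial>?M) \<longlonglongrightarrow> 0"
    and lim': "(\<lambda>n. W12_dual_norm (Bochner_Integration.simple_bochner_integral ?M (s n) - x)) \<longlonglongrightarrow> 0"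
    using f unfolding has_bochner_integral_in_def by blast
  have inI: "AE t in ?M. t \<in> I" by (rule AE_I2) simp
  have V: "V > 0" unfolding V_def using W12_norm_nonneg[of v] by linarith
  show ?thesis
  proof (rule has_bochner_integral.intros)
    show "(\<lambda>t. f t v) \<in> borel_measurable ?M"
      by (rule strongly_measurable_dual_eval[OF I sm v])
    show "Bochner_Integration.simple_bochner_integrable ?M (\<lambda>t. s n t v)" for n
      by (rule simple_bochner_integrable_compose2[OF _ s(1) s(1), where p="\<lambda>F G. F v"]) simp
    have le: "(\<integral>\<^sup>+t. ennreal (norm (f t v - s n t v)) \<partial>?M) \<le> ennreal V * (\<integral>\<^sup>+t. ennreal (W12_dual_norm (f t - s n t)) \<partial>?M)" for n
    proof -
      have "(\<integral>\<^sup>+t. ennreal (norm (f t v - s n t v)) \<partial>?M) \<le> (\<integral>\<^sup>+t. ennreal V * ennreal (W12_dual_norm (f t - s n t)) \<partial>?M)"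
      proof (rule nn_integral_mono_AE)
        show "AE t in ?M. ennreal (norm (f t v - s n t v)) \<le> ennreal V * ennreal (W12_dual_norm (f t - s n t))"
          using dual inI
        proof eventually_elim
          case (elim t)
          then have st: "s n t \<in> W12_dual" using s(2)[of n] by blast
          have b: "norm (f t v - s n t v) \<le> W12_dual_norm (f t - s n t) * W12_norm v"
            using W12_dual_bound[OF W12_dual_diff[OF elim(1) st] v] by simp
          show ?case
          \<comment> \<open>The case distinction replaces a proof that the dual norm is nonnegative:
            a negative value would force the left side to be 0.\<close>
          proof (cases "W12_dual_norm (f t - s n t) \<ge> 0")
            case True
            then have "W12_dual_norm (f t - s n t) * W12_norm v \<le> V * W12_dual_norm (f t - s n t)"
              by (simp add: V_def algebra_simps)
            with b have "norm (f t v - s n t v) \<le> V * W12_dual_norm (f t - s n t)" by linarith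
            moreover have "ennreal V * ennreal (W12_dual_norm (f t - s n t)) = ennreal (V * W12_dual_norm (f t - s n t))"
              using V True by (intro ennreal_mult[symmetric]) auto
            ultimately show ?thesis by (simp only: ennreal_leI)
          next
            case False
            then have "W12_dual_norm (f t - s n t) * W12_norm v \<le> 0"
              by (simp add: mult_nonpos_nonneg)
            with b have "norm (f t v - s n t v) = 0" using norm_ge_zero[of "f t v - s n t v"] by linarith
            then show ?thesis by simp
          qed
        qed
      qed
      also have "\<dots> \<le> ennreal V * (\<integral>\<^sup>+t. ennreal (W12_dual_norm (f t - s n t)) \<partial>?M)"
        by (rule nn_integral_cmult_le[OF V])
      finally show ?thesis .
    qed
    have up: "(\<lambda>n. ennreal V * (\<integral>\<^sup>+t. ennreal (W12_dual_norm (f t - s n t)) \<partial>?M)) \<longlonglongrightarrow> 0"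
      using ennreal_tendsto_cmult[OF _ lim, of "ennreal V"] by simp
    show "(\<lambda>n. \<integral>\<^sup>+t. ennreal (norm (f t v - s n t v)) \<partial>?M) \<longlonglongrightarrow> 0"
      by (rule tendsto_sandwich[OF always_eventually always_eventually tendsto_const up]) (simp_all add: le)
    have lin: "linear (\<lambda>F :: (real^3 \<Rightarrow> complex) \<Rightarrow> complex. F v)"
      by (rule linearI) (simp_all add: scaleR_fun_def)
    have S: "Bochner_Integration.simple_bochner_integral ?M (s n) \<in> W12_dual" for n
      unfolding simple_bochner_integral_def sp using s(2)[of n]
      by (intro W12_dual_sum W12_dual_scaleR) blast
    have "(\<lambda>n. Bochner_Integration.simple_bochner_integral ?M (s n) v) \<longlonglongrightarrow> x v"
    proof (rule LIM_zero_cancel, rule Lim_null_comparison)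
      show "(\<lambda>n. W12_dual_norm (Bochner_Integration.simple_bochner_integral ?M (s n) - x) * W12_norm v) \<longlonglongrightarrow> 0"
        using tendsto_mult_right[OF lim', of "W12_norm v"] by simp
      have "norm (Bochner_Integration.simple_bochner_integral ?M (s n) v - x v) \<le>
          W12_dual_norm (Bochner_Integration.simple_bochner_integral ?M (s n) - x) * W12_norm v" for n
        using W12_dual_bound[OF W12_dual_diff[OF S x] v, of n] by simp
      then show "\<forall>\<^sub>F n in sequentially. norm (Bochner_Integration.simple_bochner_integral ?M (s n) v - x v) \<le>
          W12_dual_norm (Bochner_Integration.simple_bochner_integral ?M (s n) - x) * W12_norm v"
        by simp
    qed
    then show "(\<lambda>n. Bochner_Integration.simple_bochner_integral ?M (\<lambda>t. s n t v)) \<longlonglongrightarrow> x v"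
      by (simp add: simple_bochner_integral_linear[OF lin s(1)])
  qed
qed

lemma weak_time_derivative_eval:
  assumes I: "I \<in> sets lebesgue" and f: "has_weak_time_derivative I W12_dual W12_dual_norm f f'"
    and v: "v \<in> W12" and \<theta>: "\<theta> \<in> test_functions (interior I)"
  shows "(\<integral>t. deriv \<theta> t *\<^sub>R f t v \<partial>lebesgue_on I) = - (\<integral>t. \<theta> t *\<^sub>R f' t v \<partial>lebesgue_on I)"
proof -
  obtain x where x: "has_bochner_integral_in I W12_dual W12_dual_norm (\<lambda>t. deriv \<theta> t *\<^sub>R f t) x"
    "has_bochner_integral_in I W12_dual W12_dual_norm (\<lambda>t. \<theta> t *\<^sub>R f' t) (- x)"
    using f \<theta> unfolding has_weak_time_derivative_def by blast
  from has_bochner_integral_dual_eval[OF I x(1) v] has_bochner_integral_dual_eval[OF I x(2) v]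
  show ?thesis by (simp add: scaleR_fun_def has_bochner_integral_iff)
qed

section \<open>The fundamental theorem of calculus for weak derivatives\<close>

lemma deriv_smooth_step:
  shows "(smooth_step has_field_derivative deriv smooth_step y) (at y)"
    and "continuous_on S (deriv smooth_step)"
    and "y < 0 \<or> 1 < y \<Longrightarrow> deriv smooth_step y = 0"
proof -
  have "frechet_derivative smooth_step (at y) z = frechet_derivative smooth_step (at y) 1 * z" for y z
    using linear_scale[OF linear_frechet_derivative[OF smooth_differentiable[OF smooth_smooth_step]], of y z 1]
    by simp
  then have lin: "frechet_derivative smooth_step (at y) = (*) (frechet_derivative smooth_step (at y) 1)" for y
    by (rule ext)
  have d: "(smooth_step has_field_derivative frechet_derivative smooth_step (at y) 1) (at y)" for y
    using smooth_has_derivative[OF smooth_smooth_step, of y] lin[of y]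
    by (simp only: has_field_derivative_def)
  have e: "deriv smooth_step = (\<lambda>y. frechet_derivative smooth_step (at y) 1)"
    by (rule ext) (rule DERIV_imp_deriv[OF d])
  show "(smooth_step has_field_derivative deriv smooth_step y) (at y)" unfolding e by (rule d)
  show "continuous_on S (deriv smooth_step)"
    unfolding e by (intro smooth_continuous_on smooth_partial smooth_smooth_step) simp
  assume "y < 0 \<or> 1 < y"
  then show "deriv smooth_step y = 0"
  proof
    assume y: "y < 0"
    have "((\<lambda>x. 0) has_field_derivative 0) (at y)" by simp
    then have "(smooth_step has_field_derivative 0) (at y)"
      by (rule has_field_derivative_transform_within_open[where S="{..<0}"]) (use y in \<open>auto simp: smooth_step_0\<close>)
    then show ?thesis by (rule DERIV_imp_deriv)
  next
    assume y: "1 < y"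
    have "((\<lambda>x. 1) has_field_derivative 0) (at y)" by simp
    then have "(smooth_step has_field_derivative 0) (at y)"
      by (rule has_field_derivative_transform_within_open[where S="{1<..}"]) (use y in \<open>auto simp: smooth_step_1\<close>)
    then show ?thesis by (rule DERIV_imp_deriv)
  qed
qed

lemma deriv_smooth_step_bounded:
  obtains B where "B > 0" "\<And>y. \<bar>deriv smooth_step y\<bar> \<le> B"
proof -
  have "compact (deriv smooth_step ` {0..1})"
    by (intro compact_continuous_image deriv_smooth_step(2)) simp
  then obtain B where B: "B > 0" "\<And>y. y \<in> deriv smooth_step ` {0..1} \<Longrightarrow> norm y \<le> B"
    using compact_imp_bounded bounded_pos by metis
  have "\<bar>deriv smooth_step y\<bar> \<le> B" for y
  proof (cases "y < 0 \<or> 1 < y")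
    case True
    then show ?thesis using B(1) by (simp add: deriv_smooth_step(3))
  next
    case False
    then show ?thesis using B(2)[of "deriv smooth_step y"] by auto
  qed
  then show thesis using B(1) that by blast
qed

text \<open>A kernel of height n B on an interval of length 2/n has L1 norm at most 2 B, which takes
  the place of positivity. The point c may be an endpoint, with all the mass on one side.\<close>

lemma approximate_identity_tendsto:
  fixes f :: "real \<Rightarrow> complex" and k :: "nat \<Rightarrow> real \<Rightarrow> real"
  assumes f: "continuous_on {s..t} f" and c: "c \<in> {s..t}"
    and k: "\<And>n. continuous_on {s..t} (k n)"
    and one: "\<forall>\<^sub>F n in sequentially. (\<integral>x. k n x \<partial>lebesgue_on {s..t}) = 1"
    and B: "\<And>n x. \<bar>k n x\<bar> \<le> real n * B" and supp: "\<And>n x. 1 < real n * \<bar>x - c\<bar> \<Longrightarrow> k n x = 0"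
  shows "(\<lambda>n. \<integral>x. k n x *\<^sub>R f x \<partial>lebesgue_on {s..t}) \<longlonglongrightarrow> f c"
proof (rule tendstoI)
  fix e :: real assume e: "e > 0"
  let ?M = "lebesgue_on {s..t}"
  have B0: "B \<ge> 0" using B[of 1 0] by simp
  \<comment> \<open>The final estimate is 2 B e', at most e / 2; the summand 1 avoids division by
    zero when B = 0.\<close>
  define e' where "e' = e / (2 * B + 1) / 2"
  have e': "e' > 0" using e B0 by (simp add: e'_def)
  obtain d where d: "d > 0" "\<And>x. x \<in> {s..t} \<Longrightarrow> dist x c < d \<Longrightarrow> dist (f x) (f c) < e'"
    using f c e' unfolding continuous_on_iff by blast
  obtain N :: nat where N: "1 / d < real N" using reals_Archimedean2 by blast
  show "\<forall>\<^sub>F n in sequentially. dist (\<integral>x. k n x *\<^sub>R f x \<partial>?M) (f c) < e"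
    using one eventually_ge_at_top[of N] eventually_gt_at_top[of 0]
  proof eventually_elim
    case (elim n)
    have n: "1 / real n < d"
    proof -
      have "1 / d < real n" using N elim(2) by linarith
      then show ?thesis using d(1) elim(3) by (simp add: field_simps)
    qed
    let ?J = "{c - 1 / real n..c + 1 / real n} \<inter> {s..t}"
    have J: "?J \<in> lmeasurable" by simp
    have ik: "integrable ?M (k n)" by (rule continuous_imp_integrable_real[OF k])
    have ikf: "integrable ?M (\<lambda>x. k n x *\<^sub>R f x)"
      by (rule continuous_imp_integrable_real) (intro continuous_intros k f)
    have ikc: "integrable ?M (\<lambda>x. k n x *\<^sub>R f c)"
      using ik by simp
    have "(\<integral>x. k n x *\<^sub>R f x \<partial>?M) - f c = (\<integral>x. k n x *\<^sub>R f x \<partial>?M) - (\<integral>x. k n x *\<^sub>R f c \<partial>?M)"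
      using ik elim(1) by simp
    also have "\<dots> = (\<integral>x. k n x *\<^sub>R f x - k n x *\<^sub>R f c \<partial>?M)"
      by (rule Bochner_Integration.integral_diff[OF ikf ikc, symmetric])
    finally have eq: "(\<integral>x. k n x *\<^sub>R f x \<partial>?M) - f c = (\<integral>x. k n x *\<^sub>R f x - k n x *\<^sub>R f c \<partial>?M)" .
    have "norm ((\<integral>x. k n x *\<^sub>R f x \<partial>?M) - f c) \<le> (\<integral>x. norm (k n x *\<^sub>R f x - k n x *\<^sub>R f c) \<partial>?M)"
      unfolding eq by (rule integral_norm_bound)
    also have "\<dots> \<le> (\<integral>x. real n * B * e' * indicator ?J x \<partial>?M)"
    proof (rule integral_mono)
      show "integrable ?M (\<lambda>x. norm (k n x *\<^sub>R f x - k n x *\<^sub>R f c))"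
        by (intro integrable_norm Bochner_Integration.integrable_diff ikf ikc)
      show "integrable ?M (\<lambda>x. real n * B * e' * indicator ?J x)"
        using fmeasurableD2[OF J] J
        by (intro integrable_mult_right integrable_real_indicator)
          (auto simp: sets_restrict_space_iff emeasure_restrict_space top.not_eq_extremum fmeasurable_def)
      fix x assume "x \<in> space ?M"
      then have x: "x \<in> {s..t}" by simp
      show "norm (k n x *\<^sub>R f x - k n x *\<^sub>R f c) \<le> real n * B * e' * indicator ?J x"
      proof (cases "1 < real n * \<bar>x - c\<bar>")
        case True
        then have "k n x = 0" by (rule supp)
        then show ?thesis using B0 e' by simp
      next
        case False
        then have xc: "\<bar>x - c\<bar> \<le> 1 / real n" using elim(3) by (simp add: field_simps)
        then have "dist (f x) (f c) < e'" using n by (intro d(2) x) (simp add: dist_real_def)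
        then have "norm (k n x *\<^sub>R (f x - f c)) \<le> (real n * B) * e'"
          unfolding norm_scaleR by (intro mult_mono B) (auto simp: dist_norm B0)
        moreover have "x \<in> ?J" using xc x by (simp add: abs_le_iff)
        ultimately show ?thesis by (simp add: scaleR_diff_right)
      qed
    qed
    also have "\<dots> = real n * B * e' * measure ?M ?J"
      by (simp add: Int_assoc)
    also have "\<dots> \<le> real n * B * e' * (2 / real n)"
    proof (intro mult_left_mono)
      have "measure ?M ?J = measure lebesgue ?J"
        by (rule measure_restrict_space) auto
      also have "\<dots> \<le> measure lebesgue {c - 1 / real n..c + 1 / real n}"
        by (intro measure_mono_fmeasurable) auto
      finally show "measure ?M ?J \<le> 2 / real n" by simp
    qed (use B0 e' in auto)
    also have "\<dots> = 2 * B * e'" using elim(3) by simp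
    also have "\<dots> \<le> (2 * B + 1) * e'" using e' by simp
    also have "(2 * B + 1) * e' = e / 2" using B0 by (simp add: e'_def field_simps)
    also have "\<dots> < e" using e by simp
    finally show ?case by (simp add: dist_norm)
  qed
qed

lemma integral_lebesgue_on_subset:
  fixes h :: "'a::euclidean_space \<Rightarrow> 'b::{banach, second_countable_topology}"
  assumes "J \<in> sets lebesgue" "I \<in> sets lebesgue" "J \<subseteq> I" "\<And>x. x \<notin> J \<Longrightarrow> h x = 0"
  shows "integral\<^sup>L (lebesgue_on I) h = integral\<^sup>L (lebesgue_on J) h"
proof -
  have eq: "indicator I x *\<^sub>R h x = indicator J x *\<^sub>R h x" for x
    using assms(3) assms(4)[of x] by (auto simp: indicator_def)
  show ?thesis using assms(1,2) by (simp add: integral_restrict_space eq del: scaleR_cancel_right)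
qed

lemma AE_lebesgue_on_subset:
  assumes "J \<in> sets lebesgue" "I \<in> sets lebesgue" "J \<subseteq> I" "AE x in lebesgue_on I. P x"
  shows "AE x in lebesgue_on J. P x"
proof -
  have "AE x in lebesgue. x \<in> I \<longrightarrow> P x"
    using assms(2,4) by (simp add: AE_restrict_space_iff)
  then have "AE x in lebesgue. x \<in> J \<longrightarrow> P x"
    by eventually_elim (use assms(3) in blast)
  then show ?thesis using assms(1) by (simp add: AE_restrict_space_iff)
qed

lemma borel_measurable_lebesgue_on_subset:
  assumes "J \<in> sets lebesgue" "I \<in> sets lebesgue" "J \<subseteq> I" "f \<in> borel_measurable (lebesgue_on I)"
  shows "f \<in> borel_measurable (lebesgue_on J)"
  using measurable_restrict_mono[OF assms(4,3)] .

text \<open>Test with trapezoids that rise at s and fall at t. Their derivatives are differences of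
  approximate identities at s and t, which recover f s - f t, while the trapezoids themselves tend
  to the indicator of the interval.\<close>

lemma weak_derivative_FTC:
  fixes f F g :: "real \<Rightarrow> complex"
  assumes I: "I \<in> sets lebesgue" and st: "s < t" "{s..t} \<subseteq> interior I"
    and f: "continuous_on {s..t} f" and F: "AE x in lebesgue_on I. F x = f x"
    and g: "g \<in> borel_measurable (lebesgue_on I)" and M: "AE x in lebesgue_on I. norm (g x) \<le> M"
    and weak: "\<And>\<theta>. \<theta> \<in> test_functions (interior I) \<Longrightarrow>
      (\<integral>x. deriv \<theta> x *\<^sub>R F x \<partial>lebesgue_on I) = - (\<integral>x. \<theta> x *\<^sub>R g x \<partial>lebesgue_on I)"
  shows "f t - f s = (\<integral>x. g x \<partial>lebesgue_on {s..t})"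
proof -
  let ?J = "lebesgue_on {s..t}"
  have sub: "{s..t} \<subseteq> I" using st(2) interior_subset by blast
  have J: "{s..t} \<in> sets lebesgue" by simp
  note on_J = AE_lebesgue_on_subset[OF J I sub]
  have fm: "f \<in> borel_measurable ?J"
    by (rule borel_measurable_integrable[OF continuous_imp_integrable_real[OF f]])
  have Fm: "F \<in> borel_measurable ?J"
  proof (rule complete_measure.borel_measurable_AE_cong[OF complete_measure_lebesgue_on[OF J] fm])
    show "AE x in ?J. f x = F x" using on_J[OF F] by eventually_elim simp
  qed
  have gm: "g \<in> borel_measurable ?J"
    by (rule borel_measurable_lebesgue_on_subset[OF J I sub g])
  define k l :: "nat \<Rightarrow> real \<Rightarrow> real"
    where "k n x = real n * deriv smooth_step (real n * (x - s))"
      and "l n x = real n * deriv smooth_step (real n * (t - x))" for n x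
  \<comment> \<open>Writing the trapezoid as a sum minus 1 makes its derivative split into
    \<open>k n\<close> and \<open>l n\<close>. It vanishes outside [s, t] once n (t - s) \<ge> 1,
    because one of the two steps is then already complete.\<close>
  define \<theta> where "\<theta> n x = smooth_step (real n * (x - s)) + (smooth_step (real n * (t - x)) + - 1)" for n :: nat and x
  have kd: "((\<lambda>x. smooth_step (real n * (x - s))) has_field_derivative k n x) (at x)" for n x
    unfolding k_def
    by (rule DERIV_cong[OF DERIV_chain'[OF _ deriv_smooth_step(1)]]) (auto intro!: derivative_eq_intros)
  have ld: "((\<lambda>x. smooth_step (real n * (t - x))) has_field_derivative - l n x) (at x)" for n x
    unfolding l_def
    by (rule DERIV_cong[OF DERIV_chain'[OF _ deriv_smooth_step(1)]]) (auto intro!: derivative_eq_intros)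
  have d: "deriv (\<theta> n) x = k n x - l n x" for n x
  proof (rule DERIV_imp_deriv)
    show "(\<theta> n has_field_derivative k n x - l n x) (at x)"
      unfolding \<theta>_def[abs_def]
      using DERIV_add[OF kd[of n x] DERIV_add[OF ld[of n x] DERIV_const[of "- 1"]]] by simp
  qed
  have k_cont: "continuous_on {s..t} (k n)" and l_cont: "continuous_on {s..t} (l n)" for n
    unfolding k_def l_def
    by (intro continuous_intros continuous_on_compose2[OF deriv_smooth_step(2)[of UNIV]]; simp)+
  obtain N :: nat where N: "1 / (t - s) < real N" using reals_Archimedean2 by blast
  have large: "1 \<le> real n * (t - s)" if "n \<ge> N" for n
  proof -
    have "1 / (t - s) < real n" using N that by linarith
    then show ?thesis using st(1) by (simp add: field_simps)
  qed
  have \<theta>0: "\<theta> n x = 0" if "n \<ge> N" "x \<notin> {s..t}" for n x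
  proof (cases "x < s")
    case True
    then have "real n * (t - s) \<le> real n * (t - x)" by (intro mult_left_mono) auto
    then have "smooth_step (real n * (t - x)) = 1" using large[OF that(1)] by (intro smooth_step_1) linarith
    moreover have "smooth_step (real n * (x - s)) = 0"
      using True by (intro smooth_step_0 mult_nonneg_nonpos) auto
    ultimately show ?thesis by (simp add: \<theta>_def)
  next
    case False
    then have x: "x > t" using that(2) by auto
    then have "real n * (t - s) \<le> real n * (x - s)" by (intro mult_left_mono) auto
    then have "smooth_step (real n * (x - s)) = 1" using large[OF that(1)] by (intro smooth_step_1) linarith
    moreover have "smooth_step (real n * (t - x)) = 0"
      using x by (intro smooth_step_0 mult_nonneg_nonpos) auto
    ultimately show ?thesis by (simp add: \<theta>_def)
  qed
  have test: "\<theta> n \<in> test_functions (interior I)" if "n \<ge> N" for n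
  proof (rule test_functionsI[OF _ _ st(2) \<theta>0[OF that]])
    show "smooth (\<theta> n)"
      unfolding \<theta>_def[abs_def]
      by (intro smooth_add smooth_smooth_step_affine smooth_smooth_step_affine' smooth_const)
  qed auto
  obtain B where B: "\<And>y. \<bar>deriv smooth_step y\<bar> \<le> B"
    using deriv_smooth_step_bounded by blast
  have one: "(\<integral>x. k n x \<partial>?J) = 1" "(\<integral>x. l n x \<partial>?J) = 1" if "n \<ge> N" for n
  proof -
    have "(k n has_integral smooth_step (real n * (t - s)) - smooth_step (real n * (s - s))) {s..t}"
      using kd[of n] st(1)
      by (intro fundamental_theorem_of_calculus)
        (auto simp: has_real_derivative_iff_has_vector_derivative[symmetric] intro: has_field_derivative_at_within)
    then show "(\<integral>x. k n x \<partial>?J) = 1"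
      using lebesgue_integral_eq_integral[OF continuous_imp_integrable_real[OF k_cont[of n]] J]
        smooth_step_1[OF large[OF that]]
      by (simp add: integral_unique smooth_step_0)
    have "((\<lambda>x. - l n x) has_integral smooth_step (real n * (t - t)) - smooth_step (real n * (t - s))) {s..t}"
      using ld[of n] st(1)
      by (intro fundamental_theorem_of_calculus)
        (auto simp: has_real_derivative_iff_has_vector_derivative[symmetric] intro: has_field_derivative_at_within)
    from has_integral_neg[OF this] show "(\<integral>x. l n x \<partial>?J) = 1"
      using lebesgue_integral_eq_integral[OF continuous_imp_integrable_real[OF l_cont[of n]] J]
        smooth_step_1[OF large[OF that]]
      by (simp add: integral_unique smooth_step_0)
  qed
  have bound: "\<bar>k n x\<bar> \<le> real n * B" "\<bar>l n x\<bar> \<le> real n * B" for n x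
    unfolding k_def l_def abs_mult using B by (simp_all add: mult_left_mono)
  have supp: "k n x = 0" if "1 < real n * \<bar>x - s\<bar>" for n x
  proof -
    have "1 < \<bar>real n * (x - s)\<bar>" using that by (simp add: abs_mult)
    then have "real n * (x - s) < 0 \<or> 1 < real n * (x - s)" by linarith
    then show ?thesis unfolding k_def by (simp only: deriv_smooth_step(3) mult_zero_right)
  qed
  have supp': "l n x = 0" if "1 < real n * \<bar>x - t\<bar>" for n x
  proof -
    have "1 < \<bar>real n * (t - x)\<bar>" using that by (simp add: abs_mult abs_minus_commute)
    then have "real n * (t - x) < 0 \<or> 1 < real n * (t - x)" by linarith
    then show ?thesis unfolding l_def by (simp only: deriv_smooth_step(3) mult_zero_right)
  qed
  have ev_one: "\<forall>\<^sub>F n in sequentially. (\<integral>x. k n x \<partial>?J) = 1" "\<forall>\<^sub>F n in sequentially. (\<integral>x. l n x \<partial>?J) = 1"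
    using one by (auto simp: eventually_sequentially)
  have "(\<lambda>n. (\<integral>x. k n x *\<^sub>R f x \<partial>?J) - (\<integral>x. l n x *\<^sub>R f x \<partial>?J)) \<longlonglongrightarrow> f s - f t"
    by (intro tendsto_diff approximate_identity_tendsto[OF f _ k_cont ev_one(1) bound(1) supp]
        approximate_identity_tendsto[OF f _ l_cont ev_one(2) bound(2) supp']) (use st(1) in auto)
  moreover have "\<forall>\<^sub>F n in sequentially. (\<integral>x. k n x *\<^sub>R f x \<partial>?J) - (\<integral>x. l n x *\<^sub>R f x \<partial>?J) = - (\<integral>x. \<theta> n x *\<^sub>R g x \<partial>?J)"
    using eventually_ge_at_top[of N]
  proof eventually_elim
    case (elim n)
    have dz: "deriv (\<theta> n) x = 0" if "x \<notin> {s..t}" for x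
    proof (rule DERIV_imp_deriv)
      have "((\<lambda>x. 0) has_field_derivative 0) (at x)" by simp
      then show "(\<theta> n has_field_derivative 0) (at x)"
        by (rule has_field_derivative_transform_within_open[where S="- {s..t}"])
          (use that \<theta>0[OF elim] in auto)
    qed
    have ik: "integrable ?J (\<lambda>x. k n x *\<^sub>R f x)" and il: "integrable ?J (\<lambda>x. l n x *\<^sub>R f x)"
      by (intro continuous_imp_integrable_real continuous_intros k_cont l_cont f)+
    have dm: "deriv (\<theta> n) \<in> borel_measurable ?J"
    proof -
      have "deriv (\<theta> n) = (\<lambda>x. k n x - l n x)" by (rule ext) (rule d)
      moreover have "(\<lambda>x. k n x - l n x) \<in> borel_measurable ?J"
        by (intro borel_measurable_integrable continuous_imp_integrable_real continuous_intros k_cont l_cont)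
      ultimately show ?thesis by simp
    qed
    have "(\<integral>x. k n x *\<^sub>R f x \<partial>?J) - (\<integral>x. l n x *\<^sub>R f x \<partial>?J) = (\<integral>x. deriv (\<theta> n) x *\<^sub>R f x \<partial>?J)"
      unfolding d scaleR_diff_left by (rule Bochner_Integration.integral_diff[OF ik il, symmetric])
    also have "\<dots> = (\<integral>x. deriv (\<theta> n) x *\<^sub>R F x \<partial>?J)"
    proof (rule integral_cong_AE)
      show "AE x in ?J. deriv (\<theta> n) x *\<^sub>R f x = deriv (\<theta> n) x *\<^sub>R F x"
        using on_J[OF F] by eventually_elim simp
    qed (intro borel_measurable_scaleR dm fm Fm)+
    also have "\<dots> = (\<integral>x. deriv (\<theta> n) x *\<^sub>R F x \<partial>lebesgue_on I)"
      by (rule integral_lebesgue_on_subset[OF J I sub, symmetric]) (simp add: dz)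
    also have "\<dots> = - (\<integral>x. \<theta> n x *\<^sub>R g x \<partial>lebesgue_on I)"
      by (rule weak[OF test[OF elim]])
    also have "(\<integral>x. \<theta> n x *\<^sub>R g x \<partial>lebesgue_on I) = (\<integral>x. \<theta> n x *\<^sub>R g x \<partial>?J)"
      by (rule integral_lebesgue_on_subset[OF J I sub]) (simp add: \<theta>0[OF elim])
    finally show ?case .
  qed
  ultimately have "(\<lambda>n. - (\<integral>x. \<theta> n x *\<^sub>R g x \<partial>?J)) \<longlonglongrightarrow> f s - f t"
    by (rule Lim_transform_eventually)
  moreover have "(\<lambda>n. - (\<integral>x. \<theta> n x *\<^sub>R g x \<partial>?J)) \<longlonglongrightarrow> - (\<integral>x. g x \<partial>?J)"
  proof (intro tendsto_minus integral_dominated_convergence)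
    show "integrable ?J (\<lambda>x. \<bar>M\<bar>)"
      by (rule continuous_imp_integrable_real) (rule continuous_on_const)
    \<comment> \<open>At the two endpoints the trapezoids do not tend to 1; these points form a null
      set.\<close>
    have ends: "AE x in ?J. x \<notin> {s, t}"
    proof -
      have "AE x in lebesgue. x \<notin> {s, t}"
        by (rule AE_not_in) (simp add: negligible_iff_null_sets[symmetric])
      then have "AE x in lebesgue. x \<in> {s..t} \<longrightarrow> x \<notin> {s, t}" by eventually_elim blast
      then show ?thesis by (subst AE_restrict_space_iff) simp_all
    qed
    have "AE x in ?J. x \<in> {s..t}" by (rule AE_I2) simp
    with ends show "AE x in ?J. (\<lambda>n. \<theta> n x *\<^sub>R g x) \<longlonglongrightarrow> g x"
    proof eventually_elim
      case (elim x)
      then have x: "x - s > 0" "t - x > 0" by auto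
      have "(\<lambda>n. \<theta> n x *\<^sub>R g x) \<longlonglongrightarrow> (1 + (1 + - 1)) *\<^sub>R g x"
        unfolding \<theta>_def by (intro tendsto_intros smooth_step_tendsto x)
      then show ?case by simp
    qed
    show "AE x in ?J. norm (\<theta> n x *\<^sub>R g x) \<le> \<bar>M\<bar>" for n
      using on_J[OF M]
    proof eventually_elim
      case (elim x)
      have "\<bar>\<theta> n x\<bar> \<le> 1"
        unfolding \<theta>_def using smooth_step_ge_0[of "real n * (x - s)"] smooth_step_le_1[of "real n * (x - s)"]
          smooth_step_ge_0[of "real n * (t - x)"] smooth_step_le_1[of "real n * (t - x)"] by linarith
      then have "\<bar>\<theta> n x\<bar> * norm (g x) \<le> 1 * \<bar>M\<bar>"
        using elim by (intro mult_mono) auto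
      then show ?case by simp
    qed
    have "\<theta> n \<in> borel_measurable ?J" for n
    proof (rule borel_measurable_integrable[OF continuous_imp_integrable_real])
      have "smooth (\<theta> n)"
        unfolding \<theta>_def[abs_def]
        by (intro smooth_add smooth_smooth_step_affine smooth_smooth_step_affine' smooth_const)
      then show "continuous_on {s..t} (\<theta> n)" by (rule smooth_continuous_on)
    qed
    then show "(\<lambda>x. \<theta> n x *\<^sub>R g x) \<in> borel_measurable ?J" for n
      by (intro borel_measurable_scaleR gm)
  qed (rule gm)
  ultimately have "f s - f t = - (\<integral>x. g x \<partial>?J)" by (rule LIMSEQ_unique)
  then have "- (f s - f t) = (\<integral>x. g x \<partial>?J)" by simp
  then show ?thesis by simp
qed

section \<open>The energy identity\<close>

lemma integral_lebesgue_on_Icc_subset: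
  fixes q :: "real \<Rightarrow> real"
  assumes "a \<le> s" "t \<le> b"
  shows "(\<integral>x. q x \<partial>lebesgue_on {s..t}) = (\<integral>x. (if s \<le> x \<and> x \<le> t then q x else 0) \<partial>lebesgue_on {a..b})"
proof -
  have "(\<integral>x. (if s \<le> x \<and> x \<le> t then q x else 0) \<partial>lebesgue_on {a..b}) =
      (\<integral>x. (if s \<le> x \<and> x \<le> t then q x else 0) \<partial>lebesgue_on {s..t})"
    by (rule integral_lebesgue_on_subset) (use assms in auto)
  also have "\<dots> = (\<integral>x. q x \<partial>lebesgue_on {s..t})"
    by (rule Bochner_Integration.integral_cong) auto
  finally show ?thesis ..
qed

text \<open>Turns a one-dimensional integral of increments into an iterated integral over a square,
  ready for Fubini. The identity holds only for almost every y, so measurability of the extension of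
  \<open>c\<close> by 0 is inherited from the inner integral.\<close>

lemma AE_iterated_integral_eq:
  fixes c :: "real \<Rightarrow> real" and F :: "real \<Rightarrow> real \<Rightarrow> real" and a b :: real
  defines "M \<equiv> lebesgue_on {a..b}"
  assumes st: "a \<le> s" "t \<le> b" and c: "continuous_on {s..t} c"
    and F: "integrable (M \<Otimes>\<^sub>M M) (\<lambda>(x, y). F x y)"
    and eq: "AE y in M. (if s \<le> y \<and> y \<le> t then c y else 0) = (\<integral>x. F x y \<partial>M)"
  shows "integral {s..t} c = (\<integral>y. (\<integral>x. F x y \<partial>M) \<partial>M)"
proof -
  interpret finite_measure M unfolding M_def by (rule finite_measure_lebesgue_on) simp
  interpret pair_sigma_finite M M ..
  have i: "integrable M (\<lambda>y. \<integral>x. F x y \<partial>M)"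
    using integrable_snd[OF F] .
  have m: "(\<lambda>y. if s \<le> y \<and> y \<le> t then c y else 0) \<in> borel_measurable M"
    unfolding M_def
  proof (rule complete_measure.borel_measurable_AE_cong)
    show "(\<lambda>y. \<integral>x. F x y \<partial>M) \<in> borel_measurable (lebesgue_on {a..b})"
      using i unfolding M_def by (rule borel_measurable_integrable)
    show "AE y in lebesgue_on {a..b}. (\<integral>x. F x y \<partial>M) = (if s \<le> y \<and> y \<le> t then c y else 0)"
      using eq unfolding M_def by eventually_elim simp
  qed (rule complete_measure_lebesgue_on, simp)
  have "integral {s..t} c = (\<integral>y. c y \<partial>lebesgue_on {s..t})"
    by (rule lebesgue_integral_eq_integral[OF continuous_imp_integrable_real[OF c], symmetric]) simp
  also have "\<dots> = (\<integral>y. (if s \<le> y \<and> y \<le> t then c y else 0) \<partial>M)"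
    unfolding M_def by (rule integral_lebesgue_on_Icc_subset[OF st])
  also have "\<dots> = (\<integral>y. (\<integral>x. F x y \<partial>M) \<partial>M)"
    by (rule integral_cong_AE[OF m borel_measurable_integrable[OF i] eq])
  finally show "integral {s..t} c = (\<integral>y. (\<integral>x. F x y \<partial>M) \<partial>M)" .
qed

text \<open>Both terms of $\Phi(t+h,t+h)-\Phi(t,t)$ are integrals of \<open>D\<close> in its first variable. After
  integrating over \<open>t\<close> and exchanging the variables in one of them, the two regions of
  integration agree up to two squares of side \<open>h\<close>.\<close>

lemma diagonal_increment_bound:
  fixes \<Phi> D :: "real \<Rightarrow> real \<Rightarrow> real" and a b :: real
  defines "M \<equiv> lebesgue_on {a..b}"
  assumes ab: "0 < h" "h \<le> b - a"
    and cont: "continuous_on ({a..b} \<times> {a..b}) (\<lambda>p. \<Phi> (fst p) (snd p))"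
    and sym: "\<And>s r. s \<in> {a..b} \<Longrightarrow> r \<in> {a..b} \<Longrightarrow> \<Phi> s r = \<Phi> r s"
    and meas: "(\<lambda>p. D (fst p) (snd p)) \<in> borel_measurable (M \<Otimes>\<^sub>M M)"
    and C: "\<And>s r. \<bar>D s r\<bar> \<le> C" and K: "\<And>s r. \<bar>D s r + D r s\<bar> \<le> K"
    and ftc: "AE r in M. \<forall>s\<in>{a..b}. \<forall>t\<in>{s..b}. \<Phi> t r - \<Phi> s r = (\<integral>x. D x r \<partial>lebesgue_on {s..t})"
  shows "\<bar>integral {a..b - h} (\<lambda>t. \<Phi> (t + h) (t + h) - \<Phi> t t)\<bar> \<le> h * (K * (b - a) + 2 * C * h)"
proof -
  interpret finite_measure M unfolding M_def by (rule finite_measure_lebesgue_on) simp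
  interpret P: pair_sigma_finite M M ..
  interpret Pf: finite_measure "M \<Otimes>\<^sub>M M"
    by (intro finite_measure_pair_measure finite_measure_axioms)
  have sp: "space M = {a..b}" by (simp add: M_def)
  have C0: "C \<ge> 0" and K0: "K \<ge> 0" using C[of 0 0] K[of 0 0] by linarith+
  have idM [measurable]: "(\<lambda>x. x) \<in> borel_measurable M"
    unfolding M_def by (rule borel_measurable_integrable[OF continuous_imp_integrable_real]) (rule continuous_on_id)
  have fs [measurable]: "(\<lambda>p. fst p) \<in> borel_measurable (M \<Otimes>\<^sub>M M)" "(\<lambda>p. snd p) \<in> borel_measurable (M \<Otimes>\<^sub>M M)"
    using measurable_compose[OF measurable_fst idM] measurable_compose[OF measurable_snd idM] by simp_all
  note [measurable] = meas
  have ifs: "continuous_on S (\<lambda>t. \<Phi> (f t) (g t))"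
    if "continuous_on S f" "continuous_on S g" "\<And>t. t \<in> S \<Longrightarrow> f t \<in> {a..b}" "\<And>t. t \<in> S \<Longrightarrow> g t \<in> {a..b}"
    for f g :: "real \<Rightarrow> real" and S
  proof -
    have "(\<lambda>t. (f t, g t)) ` S \<subseteq> {a..b} \<times> {a..b}"
      using that(3,4) by (intro image_subsetI) simp
    then show ?thesis
      using continuous_on_compose2[OF cont continuous_on_Pair[OF that(1,2)]] by simp
  qed
  \<comment> \<open>Integrated over s, \<open>F1\<close> gives \<Phi>(t+h,t) - \<Phi>(t,t) and
    \<open>F2\<close> gives \<Phi>(t,t) - \<Phi>(t-h,t), each on its admissible range of t.
    Exchanging the arguments of \<open>F2\<close> puts D(t,s) on the strip t \<le> s \<le> t + h
    where \<open>F1\<close> carries D(s,t).\<close>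
  define F1 where "F1 s t = (if t \<le> s \<and> s \<le> t + h \<and> t \<le> b - h then D s t else 0)" for s t
  define F2 where "F2 s t = (if t - h \<le> s \<and> s \<le> t \<and> a + h \<le> t then D s t else 0)" for s t
  have Fm: "(\<lambda>(s, t). F1 s t) \<in> borel_measurable (M \<Otimes>\<^sub>M M)" "(\<lambda>(s, t). F2 s t) \<in> borel_measurable (M \<Otimes>\<^sub>M M)"
    unfolding F1_def F2_def split_beta' by measurable
  have FC: "\<bar>F1 s t\<bar> \<le> C" "\<bar>F2 s t\<bar> \<le> C" for s t
    using C C0 by (auto simp: F1_def F2_def)
  have Fi: "integrable (M \<Otimes>\<^sub>M M) (\<lambda>(s, t). F1 s t)" "integrable (M \<Otimes>\<^sub>M M) (\<lambda>(s, t). F2 s t)"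
    using Fm FC by (auto intro!: Pf.integrable_const_bound[of _ C])
  have X1: "integral {a..b - h} (\<lambda>t. \<Phi> (t + h) t - \<Phi> t t) = (\<integral>t. (\<integral>s. F1 s t \<partial>M) \<partial>M)"
    unfolding M_def
  proof (rule AE_iterated_integral_eq[OF _ _ _ Fi(1)[unfolded M_def]])
    show "continuous_on {a..b - h} (\<lambda>t. \<Phi> (t + h) t - \<Phi> t t)"
      by (intro continuous_intros ifs) (use ab in auto)
    have "AE t in M. t \<in> {a..b}" by (rule AE_I2) (simp add: sp)
    with ftc have "AE t in M. (if a \<le> t \<and> t \<le> b - h then \<Phi> (t + h) t - \<Phi> t t else 0) = (\<integral>s. F1 s t \<partial>M)"
    proof eventually_elim
      case (elim t)
      show ?case
      proof (cases "t \<le> b - h")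
        case True
        have "\<Phi> (t + h) t - \<Phi> t t = (\<integral>x. D x t \<partial>lebesgue_on {t..t + h})"
          using elim True ab by auto
        also have "\<dots> = (\<integral>s. F1 s t \<partial>M)"
          unfolding M_def F1_def using True elim(2)
          by (subst integral_lebesgue_on_Icc_subset[of a t "t + h" b]) auto
        finally show ?thesis using True elim(2) by simp
      qed (simp add: F1_def)
    qed
    then show "AE t in lebesgue_on {a..b}. (if a \<le> t \<and> t \<le> b - h then \<Phi> (t + h) t - \<Phi> t t else 0) =
        (\<integral>s. F1 s t \<partial>lebesgue_on {a..b})"
      unfolding M_def .
  qed (use ab in auto)
  have X2: "integral {a + h..b} (\<lambda>t. \<Phi> t t - \<Phi> (t - h) t) = (\<integral>t. (\<integral>s. F2 s t \<partial>M) \<partial>M)"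
    unfolding M_def
  proof (rule AE_iterated_integral_eq[OF _ _ _ Fi(2)[unfolded M_def]])
    show "continuous_on {a + h..b} (\<lambda>t. \<Phi> t t - \<Phi> (t - h) t)"
      by (intro continuous_intros ifs) (use ab in auto)
    have "AE t in M. t \<in> {a..b}" by (rule AE_I2) (simp add: sp)
    with ftc have "AE t in M. (if a + h \<le> t \<and> t \<le> b then \<Phi> t t - \<Phi> (t - h) t else 0) = (\<integral>s. F2 s t \<partial>M)"
    proof eventually_elim
      case (elim t)
      show ?case
      proof (cases "a + h \<le> t")
        case True
        have "\<Phi> t t - \<Phi> (t - h) t = (\<integral>x. D x t \<partial>lebesgue_on {t - h..t})"
          using elim True ab by auto
        also have "\<dots> = (\<integral>s. F2 s t \<partial>M)"
          unfolding M_def F2_def using True elim(2)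
          by (subst integral_lebesgue_on_Icc_subset[of a "t - h" t b]) auto
        finally show ?thesis using True elim(2) by simp
      qed (simp add: F2_def)
    qed
    then show "AE t in lebesgue_on {a..b}. (if a + h \<le> t \<and> t \<le> b then \<Phi> t t - \<Phi> (t - h) t else 0) =
        (\<integral>s. F2 s t \<partial>lebesgue_on {a..b})"
      unfolding M_def .
  qed (use ab in auto)
  have swap: "(\<integral>t. (\<integral>s. F2 s t \<partial>M) \<partial>M) = (\<integral>t. (\<integral>s. F2 t s \<partial>M) \<partial>M)"
    by (rule P.Fubini_integral[OF Fi(2)])
  have I1: "integrable M (\<lambda>t. \<integral>s. F1 s t \<partial>M)"
    using P.integrable_snd[OF Fi(1)] .
  have I2': "integrable M (\<lambda>t. \<integral>s. F2 t s \<partial>M)"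
    using P.integrable_fst[OF Fi(2)] .
  \<comment> \<open>The ftc holds for a fixed second argument, here t + h; the translation by h
    renames it t, the form that \<open>F2\<close> represents.\<close>
  have shift: "integral {a..b - h} (\<lambda>t. \<Phi> (t + h) (t + h) - \<Phi> t (t + h)) = integral {a + h..b} (\<lambda>t. \<Phi> t t - \<Phi> (t - h) t)"
    using integral_shift_Icc_real[of a "b - h" "\<lambda>t. \<Phi> t t - \<Phi> (t - h) t" h] by (simp add: o_def add.commute)
  \<comment> \<open>The diagonal increment is broken at the off-diagonal corner, where \<Phi>(t,t+h)
    = \<Phi>(t+h,t) by symmetry. In both pieces only the first argument moves.\<close>
  have "integral {a..b - h} (\<lambda>t. \<Phi> (t + h) (t + h) - \<Phi> t t) =
      integral {a..b - h} (\<lambda>t. (\<Phi> (t + h) (t + h) - \<Phi> t (t + h)) + (\<Phi> (t + h) t - \<Phi> t t))"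
    by (rule Henstock_Kurzweil_Integration.integral_cong) (use sym ab in auto)
  also have "\<dots> = integral {a..b - h} (\<lambda>t. \<Phi> (t + h) (t + h) - \<Phi> t (t + h)) + integral {a..b - h} (\<lambda>t. \<Phi> (t + h) t - \<Phi> t t)"
    by (intro Henstock_Kurzweil_Integration.integral_add integrable_continuous_real continuous_intros ifs) (use ab in auto)
  also have "\<dots> = (\<integral>t. (\<integral>s. F2 t s \<partial>M) \<partial>M) + (\<integral>t. (\<integral>s. F1 s t \<partial>M) \<partial>M)"
    unfolding shift X1 X2 swap ..
  also have "\<dots> = (\<integral>t. (\<integral>s. F2 t s \<partial>M) + (\<integral>s. F1 s t \<partial>M) \<partial>M)"
    by (rule Bochner_Integration.integral_add[OF I2' I1, symmetric])
  finally have eq: "integral {a..b - h} (\<lambda>t. \<Phi> (t + h) (t + h) - \<Phi> t t) =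
    (\<integral>t. (\<integral>s. F2 t s \<partial>M) + (\<integral>s. F1 s t \<partial>M) \<partial>M)" .
  \<comment> \<open>Where both integrands are present, the symmetrised bound K applies. Near the
    ends of [a, b] one of them can be cut off by its range condition, and the other is controlled
    only by C, on a set of t of length at most h at each end.\<close>
  define B where "B t = K + C * indicator {b - h..b} t + C * indicator {a..a + h} t" for t :: real
  have B0: "B t \<ge> 0" for t using C0 K0 by (simp add: B_def)
  have inner: "\<bar>(\<integral>s. F2 t s \<partial>M) + (\<integral>s. F1 s t \<partial>M)\<bar> \<le> h * B t" if t: "t \<in> space M" for t
  proof -
    have m: "(\<lambda>s. F2 t s) \<in> borel_measurable M" "(\<lambda>s. F1 s t) \<in> borel_measurable M"
      using measurable_Pair2[OF Fm(2) t] measurable_Pair1[OF Fm(1) t] by simp_all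
    have i: "integrable M (\<lambda>s. F2 t s)" "integrable M (\<lambda>s. F1 s t)"
      using m FC by (auto intro!: integrable_const_bound[of _ C])
    let ?J = "{t..t + h} \<inter> {a..b}"
    have J: "?J \<in> lmeasurable" by simp
    have "\<bar>(\<integral>s. F2 t s \<partial>M) + (\<integral>s. F1 s t \<partial>M)\<bar> = \<bar>\<integral>s. F2 t s + F1 s t \<partial>M\<bar>"
      using i by simp
    also have "\<dots> \<le> (\<integral>s. \<bar>F2 t s + F1 s t\<bar> \<partial>M)" by (rule integral_abs_bound)
    also have "\<dots> \<le> (\<integral>s. B t * indicator ?J s \<partial>M)"
    proof (rule integral_mono)
      show "integrable M (\<lambda>s. \<bar>F2 t s + F1 s t\<bar>)" using i by (intro integrable_abs Bochner_Integration.integrable_add)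
      show "integrable M (\<lambda>s. B t * indicator ?J s)"
        unfolding M_def using fmeasurableD2[OF J]
        by (intro integrable_mult_right integrable_real_indicator)
          (auto simp: sets_restrict_space_iff emeasure_restrict_space top.not_eq_extremum)
      fix s assume s: "s \<in> space M"
      have "\<bar>F2 t s + F1 s t\<bar> \<le> B t" if "s \<in> ?J"
      proof (cases "a + h \<le> s"; cases "t \<le> b - h")
        assume "a + h \<le> s" "t \<le> b - h"
        then show ?thesis using that K[of t s] C0 by (auto simp: F1_def F2_def B_def indicator_def)
      next
        assume "a + h \<le> s" "\<not> t \<le> b - h"
        then show ?thesis using that C[of t s] C0 K0 by (auto simp: F1_def F2_def B_def indicator_def)
      next
        assume "\<not> a + h \<le> s" "t \<le> b - h"
        then show ?thesis using that C[of s t] C0 K0 t sp by (auto simp: F1_def F2_def B_def indicator_def)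
      next
        assume "\<not> a + h \<le> s" "\<not> t \<le> b - h"
        then show ?thesis using that B0[of t] by (auto simp: F1_def F2_def)
      qed
      moreover have "F2 t s + F1 s t = 0" if "s \<notin> ?J"
        using that s sp by (auto simp: F1_def F2_def)
      ultimately show "\<bar>F2 t s + F1 s t\<bar> \<le> B t * indicator ?J s"
        by (cases "s \<in> ?J") simp_all
    qed
    also have "\<dots> = B t * measure M ?J" by (simp add: sp Int_assoc)
    also have "\<dots> \<le> B t * h"
    proof (rule mult_left_mono[OF _ B0])
      have "measure M ?J = measure lebesgue ?J"
        unfolding M_def by (rule measure_restrict_space) auto
      also have "\<dots> \<le> measure lebesgue {t..t + h}"
        by (intro measure_mono_fmeasurable) auto
      finally show "measure M ?J \<le> h" using ab(1) by simp
    qed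
    finally show ?thesis by (simp add: mult.commute)
  qed
  have Ji: "integrable M (indicator J :: real \<Rightarrow> real)" "(\<integral>t. indicator J t \<partial>M) \<le> c"
    if "J \<in> lmeasurable" "J \<subseteq> {a..b}" "measure lebesgue J = c" for J :: "real set" and c
  proof -
    have sub: "J \<inter> {a..b} = J" using that(2) by blast
    show "integrable M (indicator J :: real \<Rightarrow> real)"
      unfolding M_def using fmeasurableD2[OF that(1)] that(1,2) sub
      by (intro integrable_real_indicator)
        (auto simp: sets_restrict_space_iff emeasure_restrict_space top.not_eq_extremum)
    have "(\<integral>t. indicator J t \<partial>M) = measure M J" by (simp add: sp sub)
    also have "\<dots> = measure lebesgue J"
      unfolding M_def by (rule measure_restrict_space) (use that in auto)
    finally show "(\<integral>t. indicator J t \<partial>M) \<le> c" using that(3) by simp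
  qed
  have J1: "integrable M (indicator {b - h..b} :: real \<Rightarrow> real)" "(\<integral>t. indicator {b - h..b} t \<partial>M) \<le> h"
    and J2: "integrable M (indicator {a..a + h} :: real \<Rightarrow> real)" "(\<integral>t. indicator {a..a + h} t \<partial>M) \<le> h"
    using ab by (intro Ji; simp)+
  have Kc: "integrable M (\<lambda>t. K)" by (rule integrable_const)
  have "\<bar>\<integral>t. (\<integral>s. F2 t s \<partial>M) + (\<integral>s. F1 s t \<partial>M) \<partial>M\<bar> \<le> (\<integral>t. \<bar>(\<integral>s. F2 t s \<partial>M) + (\<integral>s. F1 s t \<partial>M)\<bar> \<partial>M)"
    by (rule integral_abs_bound)
  also have "\<dots> \<le> (\<integral>t. h * B t \<partial>M)"
    by (rule integral_mono)
      (use I1 I2' J1 J2 Kc inner in \<open>auto simp: B_def intro!: integrable_abs Bochner_Integration.integrable_add integrable_mult_right\<close>)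
  also have "\<dots> = h * (K * measure M {a..b} + C * (\<integral>t. indicator {b - h..b} t \<partial>M) + C * (\<integral>t. indicator {a..a + h} t \<partial>M))"
    using J1 J2 Kc by (simp add: B_def sp)
  also have "\<dots> \<le> h * (K * (b - a) + C * h + C * h)"
  proof (intro mult_left_mono add_mono J1(2) J2(2))
    have "measure M {a..b} = measure lebesgue {a..b}"
      unfolding M_def by (rule measure_restrict_space) auto
    then show "measure M {a..b} \<le> b - a" using ab by simp
  qed (use ab C0 K0 in auto)
  finally show ?thesis unfolding eq by (simp add: algebra_simps)
qed

text \<open>The integral of N(t + h) - N(t) telescopes to the integral of N over the last window of
  length h minus that over the first. By continuity this is close to h (N b - N a), so division by h
  turns the averaged estimate into a pointwise one, up to an arbitrary error.\<close>

lemma diagonal_lipschitz: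
  fixes \<Phi> D :: "real \<Rightarrow> real \<Rightarrow> real" and a b :: real
  defines "M \<equiv> lebesgue_on {a..b}"
  assumes ab: "a < b"
    and cont: "continuous_on ({a..b} \<times> {a..b}) (\<lambda>p. \<Phi> (fst p) (snd p))"
    and sym: "\<And>s r. s \<in> {a..b} \<Longrightarrow> r \<in> {a..b} \<Longrightarrow> \<Phi> s r = \<Phi> r s"
    and meas: "(\<lambda>p. D (fst p) (snd p)) \<in> borel_measurable (M \<Otimes>\<^sub>M M)"
    and C: "\<And>s r. \<bar>D s r\<bar> \<le> C" and K: "\<And>s r. \<bar>D s r + D r s\<bar> \<le> K"
    and ftc: "AE r in M. \<forall>s\<in>{a..b}. \<forall>t\<in>{s..b}. \<Phi> t r - \<Phi> s r = (\<integral>x. D x r \<partial>lebesgue_on {s..t})"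
  shows "\<bar>\<Phi> b b - \<Phi> a a\<bar> \<le> K * (b - a)"
proof -
  define N where "N t = \<Phi> t t" for t
  have Nc: "continuous_on {a..b} N"
    unfolding N_def by (rule continuous_on_compose2[OF cont, of _ "\<lambda>t. (t, t)", simplified]) (auto intro!: continuous_intros)
  have C0: "C \<ge> 0" using C[of 0 0] by linarith
  have "\<bar>N b - N a\<bar> \<le> K * (b - a) + e" if e: "e > 0" for e
  proof -
    obtain d1 where d1: "d1 > 0" "\<And>x. x \<in> {a..b} \<Longrightarrow> dist x a < d1 \<Longrightarrow> dist (N x) (N a) < e / 4"
      using Nc e ab unfolding continuous_on_iff by (metis atLeastAtMost_iff less_eq_real_def order_refl zero_less_divide_iff zero_less_numeral)
    obtain d2 where d2: "d2 > 0" "\<And>x. x \<in> {a..b} \<Longrightarrow> dist x b < d2 \<Longrightarrow> dist (N x) (N b) < e / 4"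
      using Nc e ab unfolding continuous_on_iff by (metis atLeastAtMost_iff less_eq_real_def order_refl zero_less_divide_iff zero_less_numeral)
    \<comment> \<open>Chosen so that N stays within e / 4 of its end value on either window and 2 C
      h \<le> e / 2; the three errors add up to e.\<close>
    define h where "h = min (min (d1 / 2) (d2 / 2)) (min (b - a) (e / (4 * C + 1) / 2))"
    have h: "0 < h" "h < d1" "h < d2" "h \<le> b - a" "h \<le> e / (4 * C + 1) / 2"
    proof -
      have "h \<le> d1 / 2" "h \<le> d2 / 2" "h \<le> b - a" "h \<le> e / (4 * C + 1) / 2"
        unfolding h_def by (meson min.cobounded1 min.cobounded2 order_trans)+
      then show "h < d1" "h < d2" "h \<le> b - a" "h \<le> e / (4 * C + 1) / 2"
        using d1(1) d2(1) by linarith+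
      have "e / (4 * C + 1) / 2 > 0" using e C0 by (intro divide_pos_pos) auto
      then show "0 < h" unfolding h_def using d1(1) d2(1) ab by simp
    qed
    have "h * (4 * C + 1) \<le> e / 2" using h(5) C0 by (simp add: field_simps)
    moreover have "h * (4 * C + 1) = 2 * (2 * C * h) + h" by (simp add: algebra_simps)
    ultimately have Ch: "2 * C * h \<le> e / 2" using h(1) mult_nonneg_nonneg[OF C0 less_imp_le[OF h(1)]] by linarith
    have sub: "{a..b - h} \<subseteq> {a..b}" "{a + h..b} \<subseteq> {a..b}" "{b - h..b} \<subseteq> {a..b}" "{a..a + h} \<subseteq> {a..b}"
      using h(1,4) by auto
    note ints = continuous_on_subset[OF Nc sub(1), THEN integrable_continuous_real]
      continuous_on_subset[OF Nc sub(2), THEN integrable_continuous_real]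
      continuous_on_subset[OF Nc sub(3), THEN integrable_continuous_real]
      continuous_on_subset[OF Nc sub(4), THEN integrable_continuous_real]
      integrable_continuous_real[OF Nc]
    have s1: "integral {a..b - h} N + integral {b - h..b} N = integral {a..b} N"
      by (rule Henstock_Kurzweil_Integration.integral_combine[OF _ _ ints(5)]) (use h in auto)
    have s2: "integral {a..a + h} N + integral {a + h..b} N = integral {a..b} N"
      by (rule Henstock_Kurzweil_Integration.integral_combine[OF _ _ ints(5)]) (use h in auto)
    have sh: "integral {a..b - h} (\<lambda>t. N (t + h)) = integral {a + h..b} N"
      using integral_shift_Icc_real[of a "b - h" N h] by (simp add: o_def add.commute)
    have ish: "(\<lambda>t. N (t + h)) integrable_on {a..b - h}"
      by (intro integrable_continuous_real continuous_on_compose2[OF Nc] continuous_intros) (use h in auto)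
    have "integral {a..b - h} (\<lambda>t. \<Phi> (t + h) (t + h) - \<Phi> t t) = integral {a..b - h} (\<lambda>t. N (t + h)) - integral {a..b - h} N"
      unfolding N_def[symmetric] by (rule Henstock_Kurzweil_Integration.integral_diff[OF ish ints(1)])
    also have "\<dots> = integral {b - h..b} N - integral {a..a + h} N"
      using s1 s2 sh by linarith
    finally have inc: "\<bar>integral {b - h..b} N - integral {a..a + h} N\<bar> \<le> h * (K * (b - a) + 2 * C * h)"
      using diagonal_increment_bound[OF h(1,4) cont sym meas[unfolded M_def] C K ftc[unfolded M_def]] by simp
    have e1: "\<bar>integral {b - h..b} N - h * N b\<bar> \<le> h * (e / 4)"
    proof -
      have c: "(\<lambda>t. N b) integrable_on {b - h..b}" by (rule integrable_const_ivl)
      have "integral {b - h..b} N - h * N b = integral {b - h..b} (\<lambda>t. N t - N b)"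
        using Henstock_Kurzweil_Integration.integral_diff[OF ints(3) c] h(1) by simp
      moreover have "norm (integral {b - h..b} (\<lambda>t. N t - N b)) \<le> (e / 4) * (b - (b - h))"
      proof (rule integral_bound)
        show "norm (N t - N b) \<le> e / 4" if "t \<in> {b - h..b}" for t
          using d2(2)[of t] that sub(3) h(3) by (force simp: dist_real_def)
      qed (use h(1) in \<open>auto intro!: continuous_intros continuous_on_subset[OF Nc sub(3)]\<close>)
      ultimately show ?thesis by (simp add: mult.commute)
    qed
    have e2: "\<bar>integral {a..a + h} N - h * N a\<bar> \<le> h * (e / 4)"
    proof -
      have c: "(\<lambda>t. N a) integrable_on {a..a + h}" by (rule integrable_const_ivl)
      have "integral {a..a + h} N - h * N a = integral {a..a + h} (\<lambda>t. N t - N a)"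
        using Henstock_Kurzweil_Integration.integral_diff[OF ints(4) c] h(1) by simp
      moreover have "norm (integral {a..a + h} (\<lambda>t. N t - N a)) \<le> (e / 4) * (a + h - a)"
      proof (rule integral_bound)
        show "norm (N t - N a) \<le> e / 4" if "t \<in> {a..a + h}" for t
          using d1(2)[of t] that sub(4) h(2) by (force simp: dist_real_def)
      qed (use h(1) in \<open>auto intro!: continuous_intros continuous_on_subset[OF Nc sub(4)]\<close>)
      ultimately show ?thesis by (simp add: mult.commute)
    qed
    have "\<bar>h * N b - h * N a\<bar> \<le> h * (K * (b - a) + 2 * C * h) + h * (e / 4) + h * (e / 4)"
      using inc e1 e2 by linarith
    also have "\<dots> = h * (K * (b - a) + 2 * C * h + e / 2)"
      by (simp add: algebra_simps)
    also have "\<dots> \<le> h * (K * (b - a) + e)"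
      using Ch h(1) by (intro mult_left_mono) auto
    finally have "h * \<bar>N b - N a\<bar> \<le> h * (K * (b - a) + e)"
      using h(1) by (simp add: abs_mult right_diff_distrib[symmetric])
    then show ?thesis using h(1) by simp
  qed
  then show ?thesis unfolding N_def by (rule field_le_epsilon)
qed

lemma gronwall_zero:
  fixes N :: "real \<Rightarrow> real"
  assumes c: "c \<ge> 0" and cont: "continuous_on {a..b} N" and pos: "\<And>x. x \<in> {a..b} \<Longrightarrow> N x \<ge> 0"
    and zero: "N a = 0"
    and lip: "\<And>x y S. a \<le> x \<Longrightarrow> x < y \<Longrightarrow> y \<le> b \<Longrightarrow> (\<And>t. t \<in> {x..y} \<Longrightarrow> N t \<le> S) \<Longrightarrow> \<bar>N y - N x\<bar> \<le> c * S * (y - x)"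
    and x: "x \<in> {a..b}"
  shows "N x = 0"
proof -
  \<comment> \<open>Gives c \<delta> \<le> 1/2, with the summand 1 covering c = 0.\<close>
  define \<delta> where "\<delta> = 1 / (2 * c + 1)"
  have \<delta>: "\<delta> > 0" "c * \<delta> \<le> 1 / 2" using c by (auto simp: \<delta>_def field_simps)
  have "\<forall>x\<in>{a..b}. x \<le> a + real k * \<delta> \<longrightarrow> N x = 0" for k
  proof (induction k)
    case 0
    show ?case using zero by auto
  next
    case (Suc k)
    show ?case
    proof (intro ballI impI)
      fix x assume x: "x \<in> {a..b}" "x \<le> a + real (Suc k) * \<delta>"
      let ?y = "a + real k * \<delta>"
      show "N x = 0"
      proof (cases "x \<le> ?y")
        case True
        then show ?thesis using Suc x by blast
      next
        case False
        have ya: "a \<le> ?y" using \<delta> by simp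
        then have sub: "{?y..x} \<subseteq> {a..b}" using x by auto
        have Ny: "N ?y = 0" using Suc x False ya by auto
        obtain z where z: "z \<in> {?y..x}" "\<And>t. t \<in> {?y..x} \<Longrightarrow> N t \<le> N z"
        proof -
          have "{?y..x} \<noteq> {}" using False by simp
          from continuous_attains_sup[OF compact_Icc this continuous_on_subset[OF cont sub]]
          show thesis using that by blast
        qed
        have "N z = 0"
        proof (cases "z = ?y")
          case True
          then show ?thesis using Ny by simp
        next
          case False
          have "\<bar>N z - N ?y\<bar> \<le> c * N z * (z - ?y)"
            using z sub ya False by (intro lip) auto
          moreover have "c * N z * (z - ?y) \<le> c * N z * \<delta>"
          proof (rule mult_left_mono)
            have "z \<in> {a..b}" using z(1) sub by blast
            then show "0 \<le> c * N z" using c pos by simp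
            show "z - ?y \<le> \<delta>" using z(1) x(2) by (simp add: algebra_simps)
          qed
          moreover have "c * N z * \<delta> \<le> N z * (1 / 2)"
            using mult_left_mono[OF \<delta>(2), of "N z"] pos[of z] z(1) sub by (simp add: mult_ac subset_iff)
          ultimately have "N z \<le> N z / 2" using Ny by linarith
          then show ?thesis using pos[of z] z(1) sub by (simp add: subset_iff)
        qed
        then have "N x \<le> 0" using z(2)[of x] False by auto
        then show ?thesis using pos[OF x(1)] by linarith
      qed
    qed
  qed
  moreover obtain k :: nat where "(x - a) / \<delta> < real k" using reals_Archimedean2 by blast
  then have "x \<le> a + real k * \<delta>" using \<delta>(1) by (simp add: field_simps)
  ultimately show ?thesis using x by blast
qed

section \<open>Continuity of L2-valued functions and of their inner products\<close>

lemma continuous_L2_norm_diff: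
  assumes "continuous_L2 I f" "t \<in> I"
  shows "((\<lambda>s. L2_norm (\<lambda>x. f s x - f t x)) \<longlongrightarrow> 0) (at t within I)"
    "continuous (at t within I) (\<lambda>s. L2_norm (\<lambda>x. f s x - f t x))"
proof -
  show l: "((\<lambda>s. L2_norm (\<lambda>x. f s x - f t x)) \<longlongrightarrow> 0) (at t within I)"
    using assms by (simp add: continuous_L2_def fun_diff_def)
  have "L2_norm (\<lambda>x. f t x - f t x) = 0" by (simp add: L2_norm_def)
  with l show "continuous (at t within I) (\<lambda>s. L2_norm (\<lambda>x. f s x - f t x))"
    by (simp add: continuous_within)
qed

lemma continuous_L2_diff:
  assumes "continuous_L2 I f" "continuous_L2 I g"
  shows "continuous_L2 I (\<lambda>t x. f t x - g t x)"
  unfolding continuous_L2_def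
proof (intro ballI conjI)
  fix t assume t: "t \<in> I"
  have L2: "f s \<in> L2" "g s \<in> L2" if "s \<in> I" for s
    using assms that by (auto simp: continuous_L2_def)
  show "(\<lambda>x. f t x - g t x) \<in> L2" by (intro L2_diff L2 t)
  show "((\<lambda>s. L2_norm ((\<lambda>x. f s x - g s x) - (\<lambda>x. f t x - g t x))) \<longlongrightarrow> 0) (at t within I)"
  proof (rule Lim_null_comparison)
    show "((\<lambda>s. L2_norm (\<lambda>x. f s x - f t x) + L2_norm (\<lambda>x. g s x - g t x)) \<longlongrightarrow> 0) (at t within I)"
      by (rule tendsto_eq_intros continuous_L2_norm_diff(1)[OF assms(1) t] continuous_L2_norm_diff(1)[OF assms(2) t] | simp)+
    have "norm (L2_norm ((\<lambda>x. f s x - g s x) - (\<lambda>x. f t x - g t x))) \<le>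
        L2_norm (\<lambda>x. f s x - f t x) + L2_norm (\<lambda>x. g s x - g t x)" if s: "s \<in> I" for s
    proof -
      have fst: "(\<lambda>x. f s x - f t x) \<in> L2" and gst: "(\<lambda>x. g t x - g s x) \<in> L2"
        by (intro L2_diff L2 s t)+
      have "(\<lambda>x. f s x - g s x) - (\<lambda>x. f t x - g t x) = (\<lambda>x. (f s x - f t x) + (g t x - g s x))"
        by (simp add: fun_diff_def fun_eq_iff)
      moreover have "L2_norm (\<lambda>x. g t x - g s x) = L2_norm (\<lambda>x. g s x - g t x)"
        by (simp add: L2_norm_def norm_minus_commute)
      ultimately show ?thesis using L2_norm_triangle[OF fst gst] by simp
    qed
    then show "\<forall>\<^sub>F s in at t within I. norm (L2_norm ((\<lambda>x. f s x - g s x) - (\<lambda>x. f t x - g t x))) \<le>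
        L2_norm (\<lambda>x. f s x - f t x) + L2_norm (\<lambda>x. g s x - g t x)"
      by (auto simp: eventually_at_filter)
  qed
qed

lemma continuous_L2_pairing:
  assumes f: "continuous_L2 I f" and v: "v \<in> L2"
  shows "continuous_on I (\<lambda>t. embed (f t) v)"
  unfolding continuous_on_def
proof
  fix t assume t: "t \<in> I"
  have L2: "f s \<in> L2" if "s \<in> I" for s
    using f that by (auto simp: continuous_L2_def)
  show "((\<lambda>t. embed (f t) v) \<longlongrightarrow> embed (f t) v) (at t within I)"
  proof (rule LIM_zero_cancel, rule Lim_null_comparison)
    show "((\<lambda>s. L2_norm (\<lambda>x. f s x - f t x) * L2_norm v) \<longlongrightarrow> 0) (at t within I)"
      using tendsto_mult_right[OF continuous_L2_norm_diff(1)[OF f t], of "L2_norm v"] by simp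
    have "norm (embed (f s) v - embed (f t) v) \<le> L2_norm (\<lambda>x. f s x - f t x) * L2_norm v" if s: "s \<in> I" for s
    proof -
      have "embed (f s) v - embed (f t) v = (\<integral>x. (f s x - f t x) * v x \<partial>lebesgue)"
        unfolding embed_def left_diff_distrib
        by (rule Bochner_Integration.integral_diff[OF L2_mult(1)[OF L2[OF s] v] L2_mult(1)[OF L2[OF t] v], symmetric])
      then show ?thesis using L2_mult(2)[OF L2_diff[OF L2[OF s] L2[OF t]] v] by simp
    qed
    then show "\<forall>\<^sub>F s in at t within I. norm (embed (f s) v - embed (f t) v) \<le> L2_norm (\<lambda>x. f s x - f t x) * L2_norm v"
      by (auto simp: eventually_at_filter)
  qed
qed

text \<open>Joint continuity follows from changing one factor at a time; the norm of the moving
  factor is in turn bounded by its distance to the limit plus the norm of the limit.\<close>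

lemma continuous_L2_inner:
  assumes f: "continuous_L2 I f"
  shows "continuous_on (I \<times> I) (\<lambda>p. Re (embed (f (fst p)) (\<lambda>x. cnj (f (snd p) x))))"
proof -
  let ?\<Phi> = "\<lambda>s r. embed (f s) (\<lambda>x. cnj (f r x))"
  have L2: "f s \<in> L2" if "s \<in> I" for s
    using f that by (auto simp: continuous_L2_def)
  have "continuous_on (I \<times> I) (\<lambda>p. ?\<Phi> (fst p) (snd p))"
    unfolding continuous_on_def
  proof
    fix p assume p: "p \<in> I \<times> I"
    then have p1: "fst p \<in> I" and p2: "snd p \<in> I" by auto
    let ?F = "at p within I \<times> I"
    define d1 where "d1 s = L2_norm (\<lambda>x. f s x - f (fst p) x)" for s
    define d2 where "d2 r = L2_norm (\<lambda>x. f r x - f (snd p) x)" for r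
    have inI: "\<forall>\<^sub>F q in ?F. q \<in> I \<times> I" by (auto simp: eventually_at_filter)
    have z: "d1 (fst p) = 0" "d2 (snd p) = 0" by (simp_all add: d1_def d2_def L2_norm_def)
    have "((\<lambda>q. d1 (fst q)) \<longlongrightarrow> d1 (fst p)) ?F"
      by (rule continuous_within_tendsto_compose[OF continuous_L2_norm_diff(2)[OF f p1, folded d1_def]])
        (use inI in \<open>auto elim: eventually_mono intro!: tendsto_intros\<close>)
    then have l1: "((\<lambda>q. d1 (fst q)) \<longlongrightarrow> 0) ?F" by (simp add: z)
    have "((\<lambda>q. d2 (snd q)) \<longlongrightarrow> d2 (snd p)) ?F"
      by (rule continuous_within_tendsto_compose[OF continuous_L2_norm_diff(2)[OF f p2, folded d2_def]])
        (use inI in \<open>auto elim: eventually_mono intro!: tendsto_intros\<close>)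
    then have l2: "((\<lambda>q. d2 (snd q)) \<longlongrightarrow> 0) ?F" by (simp add: z)
    show "((\<lambda>q. ?\<Phi> (fst q) (snd q)) \<longlongrightarrow> ?\<Phi> (fst p) (snd p)) ?F"
    proof (rule LIM_zero_cancel, rule Lim_null_comparison)
      show "((\<lambda>q. d1 (fst q) * (d2 (snd q) + L2_norm (f (snd p))) + L2_norm (f (fst p)) * d2 (snd q)) \<longlongrightarrow> 0) ?F"
        by (rule tendsto_eq_intros l1 l2 | simp)+
      have "norm (?\<Phi> s r - ?\<Phi> (fst p) (snd p)) \<le> d1 s * (d2 r + L2_norm (f (snd p))) + L2_norm (f (fst p)) * d2 r"
        if s: "s \<in> I" and r: "r \<in> I" for s r
      proof -
        note fs = L2[OF s] and fr = L2[OF r] and f1 = L2[OF p1] and f2 = L2[OF p2]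
        have i1: "(\<lambda>x. f s x - f (fst p) x) \<in> L2" and i2: "(\<lambda>x. f r x - f (snd p) x) \<in> L2"
          by (intro L2_diff fs fr f1 f2)+
        note c = L2_cnj(1)[OF fr] and c2 = L2_cnj(1)[OF f2]
        have c12: "(\<lambda>x. cnj (f r x - f (snd p) x)) \<in> L2" "L2_norm (\<lambda>x. cnj (f r x - f (snd p) x)) = d2 r"
          using L2_cnj[OF i2] by (simp_all only: d2_def)
        have nr: "L2_norm (f r) \<le> d2 r + L2_norm (f (snd p))"
          using L2_norm_triangle[OF i2 f2] by (simp add: d2_def)
        have eq: "?\<Phi> s r - ?\<Phi> (fst p) (snd p) =
            (\<integral>x. (f s x - f (fst p) x) * cnj (f r x) \<partial>lebesgue) + (\<integral>x. f (fst p) x * cnj (f r x - f (snd p) x) \<partial>lebesgue)"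
        proof -
          have "?\<Phi> s r - ?\<Phi> (fst p) (snd p) =
              (\<integral>x. f s x * cnj (f r x) - f (fst p) x * cnj (f (snd p) x) \<partial>lebesgue)"
            unfolding embed_def
            by (rule Bochner_Integration.integral_diff[OF L2_mult(1)[OF fs c] L2_mult(1)[OF f1 c2], symmetric])
          also have "\<dots> = (\<integral>x. (f s x - f (fst p) x) * cnj (f r x) + f (fst p) x * cnj (f r x - f (snd p) x) \<partial>lebesgue)"
            by (simp add: algebra_simps)
          also have "\<dots> = (\<integral>x. (f s x - f (fst p) x) * cnj (f r x) \<partial>lebesgue) + (\<integral>x. f (fst p) x * cnj (f r x - f (snd p) x) \<partial>lebesgue)"
            by (rule Bochner_Integration.integral_add[OF L2_mult(1)[OF i1 c] L2_mult(1)[OF f1 c12(1)]])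
          finally show ?thesis .
        qed
        have "norm (?\<Phi> s r - ?\<Phi> (fst p) (snd p)) \<le> d1 s * L2_norm (\<lambda>x. cnj (f r x)) + L2_norm (f (fst p)) * d2 r"
          using norm_triangle_ineq[of "\<integral>x. (f s x - f (fst p) x) * cnj (f r x) \<partial>lebesgue" "\<integral>x. f (fst p) x * cnj (f r x - f (snd p) x) \<partial>lebesgue"]
            L2_mult(2)[OF i1 c] L2_mult(2)[OF f1 c12(1)]
          unfolding eq c12(2) d1_def[symmetric] by linarith
        also have "\<dots> \<le> d1 s * (d2 r + L2_norm (f (snd p))) + L2_norm (f (fst p)) * d2 r"
          using nr by (simp add: L2_cnj(2)[OF fr] mult_left_mono d1_def)
        finally show ?thesis .
      qed
      then show "\<forall>\<^sub>F q in ?F. norm (?\<Phi> (fst q) (snd q) - ?\<Phi> (fst p) (snd p)) \<le>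
          d1 (fst q) * (d2 (snd q) + L2_norm (f (snd p))) + L2_norm (f (fst p)) * d2 (snd q)"
        using inI by (auto elim!: eventually_mono)
    qed
  qed
  then show ?thesis by (intro continuous_intros)
qed

section \<open>Joint measurability of the pairing in two time variables\<close>

lemma simple_function_lebesgue_on_subset:
  assumes "J \<subseteq> I" "simple_function (lebesgue_on I) s"
  shows "simple_function (lebesgue_on J) s"
proof -
  have "finite (s ` I)" "s \<in> measurable (lebesgue_on I) (count_space UNIV)"
    using assms(2) by (simp_all add: simple_function_eq_measurable)
  moreover from this have "s \<in> measurable (lebesgue_on J) (count_space UNIV)"
    by (intro measurable_restrict_mono[OF _ assms(1)])
  moreover have "finite (s ` J)"
    using calculation(1) assms(1) by (meson finite_subset image_mono)
  ultimately show ?thesis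
    by (simp add: simple_function_eq_measurable)
qed

lemma strongly_measurable_subset:
  assumes "J \<in> sets lebesgue" "I \<in> sets lebesgue" "J \<subseteq> I" "strongly_measurable I V N f"
  shows "strongly_measurable J V N f"
proof -
  obtain s where s: "\<And>n. simple_function (lebesgue_on I) (s n)" "\<And>n. s n ` I \<subseteq> V"
    and lim: "AE t in lebesgue_on I. (\<lambda>n. N (f t - s n t)) \<longlonglongrightarrow> 0"
    and V: "AE t in lebesgue_on I. f t \<in> V"
    using assms(4) unfolding strongly_measurable_def by blast
  have "simple_function (lebesgue_on J) (s n) \<and> s n ` J \<subseteq> V" for n
    using simple_function_lebesgue_on_subset[OF assms(3) s(1)] s(2)[of n] assms(3) by blast
  then show ?thesis
    unfolding strongly_measurable_def
    using AE_lebesgue_on_subset[OF assms(1-3) lim] AE_lebesgue_on_subset[OF assms(1-3) V] by blast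
qed

lemma simple_function_comp_measurable:
  assumes q: "q \<in> measurable N M" and f: "simple_function M f"
  shows "simple_function N (\<lambda>p. f (q p))"
  unfolding simple_function_eq_measurable
proof
  have fin: "finite (f ` space M)" and m: "f \<in> measurable M (count_space UNIV)"
    using f by (simp_all add: simple_function_eq_measurable)
  show "(\<lambda>p. f (q p)) \<in> measurable N (count_space UNIV)"
    by (rule measurable_compose[OF q m])
  have "(\<lambda>p. f (q p)) ` space N \<subseteq> f ` space M"
    using measurable_space[OF q] by blast
  then show "finite ((\<lambda>p. f (q p)) ` space N)"
    using fin by (rule finite_subset)
qed

lemma simple_function_joint:
  assumes "simple_function M f" "simple_function M g"
  shows "simple_function (M \<Otimes>\<^sub>M M) (\<lambda>p. h (f (fst p)) (g (snd p)))"
proof -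
  show ?thesis
    by (rule simple_function_compose2[OF simple_function_comp_measurable[OF measurable_fst assms(1)]
        simple_function_comp_measurable[OF measurable_snd assms(2)]])
qed

text \<open>The error is expanded around the fixed pair F, u, so that besides the two approximation
  errors only the norms of F and u occur. Conjugation is isometric and does not affect the
  estimate.\<close>

lemma tendsto_joint_pairing:
  assumes F: "F \<in> W12_dual" "\<And>n. S n \<in> W12_dual" "(\<lambda>n. W12_dual_norm (F - S n)) \<longlonglongrightarrow> 0"
    and u: "u \<in> W12" "\<And>n. \<sigma> n \<in> W12" "(\<lambda>n. W12_norm (u - \<sigma> n)) \<longlonglongrightarrow> 0"
  shows "(\<lambda>n. S n (\<lambda>x. cnj (\<sigma> n x))) \<longlonglongrightarrow> F (\<lambda>x. cnj (u x))"
proof (rule LIM_zero_cancel, rule Lim_null_comparison)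
  let ?a = "\<lambda>n. W12_dual_norm (F - S n)" and ?b = "\<lambda>n. W12_norm (u - \<sigma> n)"
  show "(\<lambda>n. ?a n * W12_norm u + (W12_dual_norm F * ?b n + ?a n * ?b n)) \<longlonglongrightarrow> 0"
    by (rule tendsto_eq_intros F(3) u(3) | simp)+
  have "norm (S n (\<lambda>x. cnj (\<sigma> n x)) - F (\<lambda>x. cnj (u x))) \<le>
      ?a n * W12_norm u + (W12_dual_norm F * ?b n + ?a n * ?b n)" for n
  proof -
    have d: "u - \<sigma> n = (\<lambda>x. u x - \<sigma> n x)" by (simp add: fun_diff_def)
    have dW: "u - \<sigma> n \<in> W12" unfolding d by (rule W12_diff[OF u(1) u(2)[of n]])
    let ?uc = "\<lambda>x. cnj (u x)" and ?dc = "\<lambda>x. cnj ((u - \<sigma> n) x)"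
    note uc = W12_cnj(1)[OF u(1)] and sc = W12_cnj(1)[OF u(2)[of n]] and dc = W12_cnj(1)[OF dW]
    note FS = W12_dual_diff[OF F(1) F(2)[of n]]
    have split: "S n ?dc = S n ?uc - S n (\<lambda>x. cnj (\<sigma> n x))"
      using W12_dualD(3)[OF F(2)[of n] uc sc] by (simp add: fun_diff_def)
    have "norm (S n (\<lambda>x. cnj (\<sigma> n x)) - F ?uc) = norm ((F - S n) ?uc + (F ?dc - (F - S n) ?dc))"
      unfolding minus_apply using split by (simp add: norm_minus_commute)
    also have "\<dots> \<le> norm ((F - S n) ?uc) + (norm (F ?dc) + norm ((F - S n) ?dc))"
      by (intro order_trans[OF norm_triangle_ineq] add_left_mono norm_triangle_ineq4)
    also have "\<dots> \<le> ?a n * W12_norm ?uc + (W12_dual_norm F * W12_norm ?dc + ?a n * W12_norm ?dc)"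
      by (intro add_mono W12_dual_bound FS F(1) uc dc)
    finally show ?thesis unfolding W12_cnj(3)[OF u(1)] W12_cnj(3)[OF dW] .
  qed
  then show "\<forall>\<^sub>F n in sequentially. norm (S n (\<lambda>x. cnj (\<sigma> n x)) - F (\<lambda>x. cnj (u x))) \<le>
      ?a n * W12_norm u + (W12_dual_norm F * ?b n + ?a n * ?b n)"
    by simp
qed

text \<open>Fubini needs measurability on the product, which measurability in each variable alone
  does not give. Pairings of simple functions are simple on the product, and D is their limit
  everywhere. It agrees with the pairing on the square of a set \<open>G\<close> of full
  measure.\<close>

lemma joint_pairing_measurable:
  fixes J :: "real set"
  defines "M \<equiv> lebesgue_on J"
  assumes P: "strongly_measurable J W12_dual W12_dual_norm P" and u: "strongly_measurable J W12 W12_norm u"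
  obtains D G where "(\<lambda>p. D (fst p) (snd p)) \<in> borel_measurable (M \<Otimes>\<^sub>M M)" "AE t in M. t \<in> G"
    "\<And>s r. s \<in> G \<Longrightarrow> r \<in> G \<Longrightarrow> D s r = P s (\<lambda>x. cnj (u r x))"
proof -
  obtain S where S: "\<And>n. simple_function M (S n)" "\<And>n. S n ` J \<subseteq> W12_dual"
    and Slim: "AE t in M. (\<lambda>n. W12_dual_norm (P t - S n t)) \<longlonglongrightarrow> 0" and PV: "AE t in M. P t \<in> W12_dual"
    using P unfolding strongly_measurable_def M_def by blast
  obtain \<sigma> where \<sigma>: "\<And>n. simple_function M (\<sigma> n)" "\<And>n. \<sigma> n ` J \<subseteq> W12"
    and \<sigma>lim: "AE t in M. (\<lambda>n. W12_norm (u t - \<sigma> n t)) \<longlonglongrightarrow> 0" and uV: "AE t in M. u t \<in> W12"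
    using u unfolding strongly_measurable_def M_def by blast
  define G where "G = {t \<in> J. P t \<in> W12_dual \<and> (\<lambda>n. W12_dual_norm (P t - S n t)) \<longlonglongrightarrow> 0 \<and>
    u t \<in> W12 \<and> (\<lambda>n. W12_norm (u t - \<sigma> n t)) \<longlonglongrightarrow> 0}"
  define D where "D s r = lim (\<lambda>n. S n s (\<lambda>x. cnj (\<sigma> n r x)))" for s r
  have "AE t in M. t \<in> J" by (rule AE_I2) (simp add: M_def)
  then have G: "AE t in M. t \<in> G"
    using PV Slim uV \<sigma>lim by eventually_elim (simp add: G_def)
  have "(\<lambda>p. S n (fst p) (\<lambda>x. cnj (\<sigma> n (snd p) x))) \<in> borel_measurable (M \<Otimes>\<^sub>M M)" for n
    by (rule borel_measurable_simple_function[OF simple_function_joint[OF S(1) \<sigma>(1), of "\<lambda>F v. F (\<lambda>x. cnj (v x))"]])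
  then have "(\<lambda>p. D (fst p) (snd p)) \<in> borel_measurable (M \<Otimes>\<^sub>M M)"
    unfolding D_def by (rule borel_measurable_lim_metric)
  moreover have "D s r = P s (\<lambda>x. cnj (u r x))" if "s \<in> G" "r \<in> G" for s r
    unfolding D_def
  proof (rule limI, rule tendsto_joint_pairing)
    show "S n s \<in> W12_dual" "\<sigma> n r \<in> W12" for n
      using S(2)[of n] \<sigma>(2)[of n] that by (auto simp: G_def)
  qed (use that in \<open>auto simp: G_def\<close>)
  ultimately show thesis using G that by blast
qed

lemma integral_lebesgue_on_singleton: "(\<integral>x. f x \<partial>lebesgue_on {s :: real}) = (0 :: real)"
proof (rule integral_eq_zero_AE)
  have "AE x in lebesgue. x \<notin> {s}"
    by (rule AE_not_in) (simp add: negligible_iff_null_sets[symmetric])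
  then have "AE x in lebesgue. x \<in> {s} \<longrightarrow> f x = 0" by eventually_elim blast
  then show "AE x in lebesgue_on {s}. f x = 0"
    by (subst AE_restrict_space_iff) simp_all
qed

lemma embed_cong_AE:
  assumes "AE x in lebesgue. f x = g x" "AE x in lebesgue. v x = w x"
    and "f \<in> L2" "g \<in> L2" "v \<in> L2" "w \<in> L2"
  shows "embed f v = embed g w"
  unfolding embed_def
proof (rule integral_cong_AE)
  show "AE x in lebesgue. f x * v x = g x * w x"
    using assms(1,2) by eventually_elim simp
qed (intro borel_measurable_times L2D(1) assms)+

lemma embed_diff:
  assumes "f \<in> L2" "g \<in> L2" "v \<in> L2"
  shows "embed (\<lambda>x. f x - g x) v = embed f v - embed g v"
  unfolding embed_def left_diff_distrib
  by (rule Bochner_Integration.integral_diff[OF L2_mult(1)[OF assms(1,3)] L2_mult(1)[OF assms(2,3)]])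

lemma embed_cnj_self:
  assumes "f \<in> L2"
  shows "Re (embed f (\<lambda>x. cnj (f x))) = (L2_norm f)\<^sup>2"
proof -
  have "(\<lambda>x. f x * cnj (f x)) = (\<lambda>x. complex_of_real ((norm (f x))\<^sup>2))"
    by (rule ext) (rule complex_norm_square[symmetric])
  then show ?thesis
    unfolding embed_def L2_norm_square by (simp only: integral_complex_of_real Re_complex_of_real)
qed

lemma embed_cnj_sym:
  shows "Re (embed f (\<lambda>x. cnj (g x))) = Re (embed g (\<lambda>x. cnj (f x)))"
proof -
  have "embed f (\<lambda>x. cnj (g x)) = (\<integral>x. cnj (g x * cnj (f x)) \<partial>lebesgue)"
    unfolding embed_def by (simp add: mult.commute)
  also have "\<dots> = cnj (embed g (\<lambda>x. cnj (f x)))"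
    unfolding embed_def by (rule Bochner_Integration.integral_cnj)
  finally show ?thesis by simp
qed

section \<open>The energy inequality for two solutions\<close>

text \<open>For a fixed v the pairing is a scalar function with a bounded weak derivative, so the
  scalar theorem applies. Its continuous version is furnished by the L2-continuous
  representative.\<close>

lemma dual_FTC:
  assumes I: "I \<in> sets lebesgue" and st: "s < t" "{s..t} \<subseteq> interior I"
    and \<psi>: "AE \<tau> in lebesgue_on I. \<psi> \<tau> \<in> W12"
    and P: "strongly_measurable I W12_dual W12_dual_norm P" "AE \<tau> in lebesgue_on I. W12_dual_norm (P \<tau>) \<le> R'"
    and wd: "has_weak_time_derivative I W12_dual W12_dual_norm (\<lambda>t. embed (\<psi> t)) P"
    and cont: "continuous_L2 I \<psi>c"
    and rep: "AE \<tau> in lebesgue_on I. AE x in lebesgue. \<psi>c \<tau> x = \<psi> \<tau> x"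
    and v: "v \<in> W12"
  shows "embed (\<psi>c t) v - embed (\<psi>c s) v = (\<integral>\<tau>. P \<tau> v \<partial>lebesgue_on {s..t})"
    and "integrable (lebesgue_on {s..t}) (\<lambda>\<tau>. P \<tau> v)"
proof -
  have sub: "{s..t} \<subseteq> I" using st(2) interior_subset by blast
  have inI: "AE \<tau> in lebesgue_on I. \<tau> \<in> I" by (rule AE_I2) simp
  have dual: "AE \<tau> in lebesgue_on I. P \<tau> \<in> W12_dual"
    using P(1) by (simp add: strongly_measurable_def)
  have m: "(\<lambda>\<tau>. P \<tau> v) \<in> borel_measurable (lebesgue_on I)"
    by (rule strongly_measurable_dual_eval[OF I P(1) v])
  have bound: "AE \<tau> in lebesgue_on I. norm (P \<tau> v) \<le> R' * W12_norm v"
    using dual P(2)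
  proof eventually_elim
    case (elim \<tau>)
    then show ?case
      using W12_dual_bound[OF elim(1) v] mult_right_mono[OF elim(2), of "W12_norm v"] by simp
  qed
  show "embed (\<psi>c t) v - embed (\<psi>c s) v = (\<integral>\<tau>. P \<tau> v \<partial>lebesgue_on {s..t})"
  proof (rule weak_derivative_FTC[OF I st _ _ m bound])
    show "continuous_on {s..t} (\<lambda>\<tau>. embed (\<psi>c \<tau>) v)"
      by (rule continuous_on_subset[OF continuous_L2_pairing[OF cont W12_L2[OF v]] sub])
    show "AE \<tau> in lebesgue_on I. embed (\<psi> \<tau>) v = embed (\<psi>c \<tau>) v"
      using \<psi> rep inI
    proof eventually_elim
      case (elim \<tau>)
      have "\<psi>c \<tau> \<in> L2" using cont elim(3) by (simp add: continuous_L2_def)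
      then have "embed (\<psi>c \<tau>) v = embed (\<psi> \<tau>) v"
        by (intro embed_cong_AE[OF elim(2) _ _ W12_L2[OF elim(1)] W12_L2[OF v] W12_L2[OF v]]) simp_all
      then show ?case ..
    qed
    show "(\<integral>x. deriv \<theta> x *\<^sub>R embed (\<psi> x) v \<partial>lebesgue_on I) = - (\<integral>x. \<theta> x *\<^sub>R P x v \<partial>lebesgue_on I)"
      if "\<theta> \<in> test_functions (interior I)" for \<theta>
      by (rule weak_time_derivative_eval[OF I wd v that])
  qed
  interpret finite_measure "lebesgue_on {s..t}" by (rule finite_measure_lebesgue_on) simp
  show "integrable (lebesgue_on {s..t}) (\<lambda>\<tau>. P \<tau> v)"
    by (rule integrable_const_bound[OF AE_lebesgue_on_subset[OF _ I sub bound]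
          borel_measurable_lebesgue_on_subset[OF _ I sub m]]) simp_all
qed

text \<open>Verifies the hypotheses of \<open>diagonal_lipschitz\<close> for the inner product of
  w(s) and w(r). The squared norms enter through the bound \<open>S\<close>, the form that
  \<open>gronwall_zero\<close> consumes; the constant is the Lipschitz constant of both
  nonlinearities, doubled by the symmetrisation.\<close>

lemma energy_inequality:
  fixes \<psi> \<psi>c :: "bool \<Rightarrow> real \<Rightarrow> real^3 \<Rightarrow> complex"
  assumes I: "I \<in> sets lebesgue"
    and sm: "\<And>i. strongly_measurable I W12 W12_norm (\<psi> i)"
    and bd: "\<And>i. AE t in lebesgue_on I. W12_norm (\<psi> i t) \<le> R"
    and sm': "\<And>i. strongly_measurable I W12_dual W12_dual_norm (\<psi>' i)"
    and bd': "\<And>i. AE t in lebesgue_on I. W12_dual_norm (\<psi>' i t) \<le> R'" and R': "R' \<ge> 0"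
    and wd: "\<And>i. has_weak_time_derivative I W12_dual W12_dual_norm (\<lambda>t. embed (\<psi> i t)) (\<psi>' i)"
    and eqn: "\<And>i. AE t in lebesgue_on I. solves_equation a b (\<psi> i t) (\<psi>' i t)"
    and cont: "\<And>i. continuous_L2 I (\<psi>c i)"
    and rep: "\<And>i. AE s in lebesgue_on I. AE x in lebesgue. \<psi>c i s x = \<psi> i s x"
    and \<alpha>\<beta>: "\<alpha> < \<beta>" "{\<alpha>..\<beta>} \<subseteq> interior I"
    and S: "\<And>t. t \<in> {\<alpha>..\<beta>} \<Longrightarrow> (L2_norm (\<lambda>x. \<psi>c True t x - \<psi>c False t x))\<^sup>2 \<le> S"
  shows "\<bar>(L2_norm (\<lambda>x. \<psi>c True \<beta> x - \<psi>c False \<beta> x))\<^sup>2 - (L2_norm (\<lambda>x. \<psi>c True \<alpha> x - \<psi>c False \<alpha> x))\<^sup>2\<bar>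
    \<le> 2 * \<bar>b\<bar> * (9 * R\<^sup>2 + 15 * R ^ 4) * S * (\<beta> - \<alpha>)"
proof -
  let ?J = "{\<alpha>..\<beta>}"
  let ?K = "2 * \<bar>b\<bar> * (9 * R\<^sup>2 + 15 * R ^ 4)"
  define M where "M = lebesgue_on ?J"
  define w where "w t x = \<psi>c True t x - \<psi>c False t x" for t x
  define d where "d t x = \<psi> True t x - \<psi> False t x" for t x
  have sub: "?J \<subseteq> I" using \<alpha>\<beta>(2) interior_subset by blast
  have J: "?J \<in> sets lebesgue" by simp
  have sp: "space M = ?J" by (simp add: M_def)
  have S0: "S \<ge> 0" using order_trans[OF zero_le_power2 S[of \<alpha>]] \<alpha>\<beta>(1) by simp
  have K0: "?K \<ge> 0" by (intro mult_nonneg_nonneg add_nonneg_nonneg) auto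
  have wc: "continuous_L2 I w"
    unfolding w_def[abs_def] by (rule continuous_L2_diff[OF cont cont])
  have cL2: "\<psi>c i t \<in> L2" if "t \<in> I" for i t
    using cont[of i] that by (simp add: continuous_L2_def)
  have wL2: "w t \<in> L2" if "t \<in> I" for t
    using wc that by (simp add: continuous_L2_def)
  note onJ = AE_lebesgue_on_subset[OF J I sub, folded M_def]
  note smJ = strongly_measurable_subset[OF J I sub]
  \<comment> \<open>Joint measurability is available for one derivative paired with one solution, so
    the pairing of the differences is assembled from four functions indexed by i and j, each with
    its own set of full measure.\<close>
  define Q where "Q i j D G \<longleftrightarrow> (\<lambda>p. D (fst p) (snd p)) \<in> borel_measurable (M \<Otimes>\<^sub>M M) \<and>
      (AE t in M. t \<in> G) \<and> (\<forall>s\<in>G. \<forall>r\<in>G. D s r = \<psi>' i s (\<lambda>x. cnj (\<psi> j r x)))" for i j D G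
  have ex: "\<exists>D G. Q i j D G" for i j
    unfolding M_def Q_def by (rule joint_pairing_measurable[OF smJ[OF sm'[of i]] smJ[OF sm[of j]]]) blast
  define D where "D i j = (SOME D. \<exists>G. Q i j D G)" for i j
  define G where "G i j = (SOME G. Q i j (D i j) G)" for i j
  have exG: "\<exists>G. Q i j (D i j) G" for i j
    using someI_ex[OF ex[of i j]] unfolding D_def .
  have G: "Q i j (D i j) (G i j)" for i j
    using someI_ex[OF exG[of i j]] unfolding G_def .
  have Dm: "(\<lambda>p. D i j (fst p) (snd p)) \<in> borel_measurable (M \<Otimes>\<^sub>M M)" and GM: "AE t in M. t \<in> G i j"
    and DG: "s \<in> G i j \<Longrightarrow> r \<in> G i j \<Longrightarrow> D i j s r = \<psi>' i s (\<lambda>x. cnj (\<psi> j r x))" for i j s r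
    using G[of i j] unfolding Q_def by blast+
  \<comment> \<open>All almost everywhere conditions are gathered at once, so that a single
    measurable set \<open>T\<close> of good times serves both variables.\<close>
  define good where "good t \<longleftrightarrow> (\<forall>i. \<psi> i t \<in> W12 \<and> W12_norm (\<psi> i t) \<le> R \<and> \<psi>' i t \<in> W12_dual \<and>
      W12_dual_norm (\<psi>' i t) \<le> R' \<and> (AE x in lebesgue. \<psi>c i t x = \<psi> i t x) \<and>
      solves_equation a b (\<psi> i t) (\<psi>' i t)) \<and>
      (\<forall>i j. t \<in> G i j)" for t
  have V: "AE t in lebesgue_on I. \<psi> i t \<in> W12" "AE t in lebesgue_on I. \<psi>' i t \<in> W12_dual" for i
    using sm[of i] sm'[of i] by (simp_all add: strongly_measurable_def)
  have A: "AE t in M. \<psi> i t \<in> W12 \<and> W12_norm (\<psi> i t) \<le> R \<and> \<psi>' i t \<in> W12_dual \<and>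
      W12_dual_norm (\<psi>' i t) \<le> R' \<and> (AE x in lebesgue. \<psi>c i t x = \<psi> i t x) \<and>
      solves_equation a b (\<psi> i t) (\<psi>' i t)" for i
    using onJ[OF V(1)[of i]] onJ[OF bd[of i]] onJ[OF V(2)[of i]] onJ[OF bd'[of i]] onJ[OF rep[of i]] onJ[OF eqn[of i]]
    by eventually_elim simp
  have "AE t in M. \<forall>i j. t \<in> G i j"
    by (rule AE_all_countable[THEN iffD2, OF allI], rule AE_all_countable[THEN iffD2, OF allI], rule GM)
  with AE_all_countable[THEN iffD2, OF allI[OF A]] have "AE t in M. good t"
    by eventually_elim (simp only: good_def simp_thms)
  then obtain N where N: "{t \<in> space M. \<not> good t} \<subseteq> N" "N \<in> sets M" "emeasure M N = 0"
    by (rule AE_E) blast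
  define T where "T = ?J - N"
  have TM [measurable]: "T \<in> sets M"
    unfolding T_def sp[symmetric] using N(2) by blast
  have good: "good t" if "t \<in> T" for t using that N(1) by (auto simp: T_def sp)
  have T_AE: "AE t in M. t \<in> T"
  proof -
    have "AE t in M. t \<notin> N" using N(2,3) by (intro AE_not_in) (simp add: null_sets_def)
    moreover have "AE t in M. t \<in> ?J" by (rule AE_I2) (simp add: sp)
    ultimately show ?thesis by eventually_elim (simp add: T_def)
  qed
  have TJ: "t \<in> ?J" "t \<in> I" if "t \<in> T" for t using that sub by (auto simp: T_def)
  have \<psi>: "\<psi> i t \<in> W12" "W12_norm (\<psi> i t) \<le> R" and \<psi>': "\<psi>' i t \<in> W12_dual" "W12_dual_norm (\<psi>' i t) \<le> R'"
    and \<psi>c: "AE x in lebesgue. \<psi>c i t x = \<psi> i t x" and tG: "t \<in> G i j"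
    if "t \<in> T" for i j t
    using good[OF that] unfolding good_def by blast+
  have d: "d t \<in> W12" if "t \<in> T" for t
    unfolding d_def[abs_def] by (rule W12_diff[OF \<psi>(1)[OF that] \<psi>(1)[OF that]])
  have wd_AE: "AE x in lebesgue. w t x = d t x" if "t \<in> T" for t
    using \<psi>c[OF that, of True] \<psi>c[OF that, of False] by eventually_elim (simp add: w_def d_def)
  have dn: "L2_norm (d t) = L2_norm (w t)" if "t \<in> T" for t
    by (rule L2_AE_cong(2)[OF wd_AE[OF that] wL2[OF TJ(2)[OF that]]])
  have cd: "(\<lambda>x. cnj (d r x)) \<in> W12" if "r \<in> T" for r by (rule W12_cnj(1)[OF d[OF that]])
  \<comment> \<open>The bounds on the integrand are required at all pairs of times; the indicators
    make them trivial outside the good ones and change nothing almost everywhere.\<close>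
  define E where "E s r = indicator T s * indicator T r *
    Re ((D True True s r - D True False s r) - (D False True s r - D False False s r))" for s r
  have diff: "D i True s r - D i False s r = \<psi>' i s (\<lambda>x. cnj (d r x))" if "s \<in> T" "r \<in> T" for i s r
    unfolding DG[OF tG[OF that(1)] tG[OF that(2)]] d_def complex_cnj_diff
    by (rule W12_dualD(3)[OF \<psi>'(1)[OF that(1)] W12_cnj(1)[OF \<psi>(1)[OF that(2)]] W12_cnj(1)[OF \<psi>(1)[OF that(2)]], symmetric])
  have E: "E s r = Re (\<psi>' True s (\<lambda>x. cnj (d r x)) - \<psi>' False s (\<lambda>x. cnj (d r x)))" if "s \<in> T" "r \<in> T" for s r
    unfolding E_def diff[OF that] using that by simp
  have E0: "E s r = 0" if "s \<notin> T \<or> r \<notin> T" for s r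
    using that by (auto simp: E_def)
  have DB: "norm (D i j s r) \<le> R' * R" if "s \<in> T" "r \<in> T" for i j s r
  proof -
    have "norm (D i j s r) \<le> W12_dual_norm (\<psi>' i s) * W12_norm (\<psi> j r)"
      unfolding DG[OF tG[OF that(1)] tG[OF that(2)]]
      using W12_dual_bound[OF \<psi>'(1)[OF that(1)] W12_cnj(1)[OF \<psi>(1)[OF that(2)]]]
      unfolding W12_cnj(3)[OF \<psi>(1)[OF that(2)]] .
    also have "\<dots> \<le> R' * R"
      using \<psi>'(2)[OF that(1)] \<psi>(2)[OF that(2)] R' by (intro mult_mono) auto
    finally show ?thesis .
  qed
  have EC: "\<bar>E s r\<bar> \<le> \<bar>4 * (R' * R)\<bar>" for s r
  proof (cases "s \<in> T \<and> r \<in> T")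
    case True
    then have st: "s \<in> T" "r \<in> T" by auto
    have e: "E s r = Re ((D True True s r - D True False s r) - (D False True s r - D False False s r))"
      using st by (simp add: E_def)
    have "\<bar>E s r\<bar> \<le> norm ((D True True s r - D True False s r) - (D False True s r - D False False s r))"
      unfolding e by (rule abs_Re_le_cmod)
    also have "\<dots> \<le> (R' * R + R' * R) + (R' * R + R' * R)"
      by (intro order_trans[OF norm_triangle_ineq4] add_mono DB st)
    finally show ?thesis by linarith
  next
    case False
    then have "E s r = 0" using E0 by blast
    then show ?thesis by simp
  qed
  have EK: "\<bar>E s r + E r s\<bar> \<le> ?K * S" for s r
  proof (cases "s \<in> T \<and> r \<in> T")
    case True
    then have st: "s \<in> T" "r \<in> T" by auto
    have "\<bar>E s r + E r s\<bar> \<le> ?K * L2_norm (d s) * L2_norm (d r)"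
      unfolding E[OF st] E[OF st(2,1)] d_def[abs_def]
      by (rule symmetrised_energy_bound[where u="\<lambda>i. \<psi> i s" and v="\<lambda>i. \<psi> i r" and P="\<lambda>i. \<psi>' i s" and Q="\<lambda>i. \<psi>' i r" and a=a])
        (use \<psi>[OF st(1)] \<psi>[OF st(2)] good[OF st(1)] good[OF st(2)] in \<open>simp_all add: good_def\<close>)
    also have "\<dots> = ?K * (L2_norm (w s) * L2_norm (w r))"
      by (simp add: dn st)
    also have "\<dots> \<le> ?K * S"
    proof (rule mult_left_mono[OF _ K0])
      \<comment> \<open>The arithmetic-geometric mean inequality decouples the two times, so that
        \<open>S\<close> bounds the product.\<close>
      have "2 * L2_norm (w s) * L2_norm (w r) \<le> (L2_norm (w s))\<^sup>2 + (L2_norm (w r))\<^sup>2"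
        by (rule sum_squares_bound)
      moreover have "(L2_norm (w s))\<^sup>2 \<le> S" "(L2_norm (w r))\<^sup>2 \<le> S"
        unfolding w_def[abs_def] by (intro S TJ st)+
      ultimately show "L2_norm (w s) * L2_norm (w r) \<le> S" by linarith
    qed
    finally show ?thesis .
  next
    case False
    then have "E s r = 0" "E r s = 0" using E0 by blast+
    then show ?thesis using K0 S0 by simp
  qed
  have Em: "(\<lambda>p. E (fst p) (snd p)) \<in> borel_measurable (M \<Otimes>\<^sub>M M)"
  proof -
    note [measurable] = Dm
    have ind: "(indicator T :: real \<Rightarrow> real) \<in> borel_measurable M" by measurable
    have [measurable]: "(\<lambda>p. indicator T (fst p) :: real) \<in> borel_measurable (M \<Otimes>\<^sub>M M)"
      "(\<lambda>p. indicator T (snd p) :: real) \<in> borel_measurable (M \<Otimes>\<^sub>M M)"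
      by (rule measurable_compose[OF measurable_fst ind], rule measurable_compose[OF measurable_snd ind])
    show ?thesis unfolding E_def by measurable
  qed
  define \<Phi> where "\<Phi> s r = Re (embed (w s) (\<lambda>x. cnj (w r x)))" for s r
  have \<Phi>c: "continuous_on (?J \<times> ?J) (\<lambda>p. \<Phi> (fst p) (snd p))"
    unfolding \<Phi>_def by (rule continuous_on_subset[OF continuous_L2_inner[OF wc]]) (use sub in auto)
  have ftc: "\<Phi> t r - \<Phi> s r = (\<integral>\<tau>. E \<tau> r \<partial>lebesgue_on {s..t})"
    if r: "r \<in> T" and s: "s \<in> ?J" and t: "t \<in> {s..\<beta>}" for r s t
  proof (cases "s = t")
    case True
    then show ?thesis by (simp add: integral_lebesgue_on_singleton)
  next
    case False
    then have st: "s < t" "{s..t} \<subseteq> interior I" and stJ: "{s..t} \<subseteq> ?J"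
      using s t \<alpha>\<beta>(2) by auto
    let ?v = "\<lambda>x. cnj (d r x)" and ?L = "lebesgue_on {s..t}"
    have vL2: "?v \<in> L2" by (rule W12_L2[OF cd[OF r]])
    \<comment> \<open>For a good time r the second factor may be exchanged for \<open>d r\<close>,
      which lies in \<open>W12\<close> and can be paired with the dual-valued derivatives; the
      moving first factor stays the continuous representative.\<close>
    have \<Phi>v: "\<Phi> \<tau> r = Re (embed (\<psi>c True \<tau>) ?v - embed (\<psi>c False \<tau>) ?v)" if "\<tau> \<in> I" for \<tau>
    proof -
      have "AE x in lebesgue. cnj (w r x) = cnj (d r x)"
        using wd_AE[OF r] by eventually_elim simp
      then have "embed (w \<tau>) (\<lambda>x. cnj (w r x)) = embed (w \<tau>) ?v"
        by (intro embed_cong_AE wL2 that L2_cnj(1) TJ(2)[OF r] vL2) simp_all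
      also have "\<dots> = embed (\<psi>c True \<tau>) ?v - embed (\<psi>c False \<tau>) ?v"
        unfolding w_def[abs_def] by (rule embed_diff[OF cL2[OF that] cL2[OF that] vL2])
      finally show ?thesis by (simp add: \<Phi>_def)
    qed
    note F = dual_FTC[OF I st V(1) sm' bd' wd cont rep cd[OF r]]
    have "\<Phi> t r - \<Phi> s r = Re ((embed (\<psi>c True t) ?v - embed (\<psi>c True s) ?v) - (embed (\<psi>c False t) ?v - embed (\<psi>c False s) ?v))"
      using s t sub by (simp add: \<Phi>v subset_iff)
    also have "\<dots> = Re (\<integral>\<tau>. \<psi>' True \<tau> ?v - \<psi>' False \<tau> ?v \<partial>?L)"
      unfolding F(1)[of True] F(1)[of False] by (simp add: Bochner_Integration.integral_diff[OF F(2) F(2)])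
    also have "\<dots> = (\<integral>\<tau>. Re (\<psi>' True \<tau> ?v - \<psi>' False \<tau> ?v) \<partial>?L)"
      by (rule integral_Re[OF Bochner_Integration.integrable_diff[OF F(2) F(2)], symmetric])
    also have "\<dots> = (\<integral>\<tau>. E \<tau> r \<partial>?L)"
    proof -
      have ae: "AE \<tau> in ?L. Re (\<psi>' True \<tau> ?v - \<psi>' False \<tau> ?v) = E \<tau> r"
      proof -
        have "AE \<tau> in ?L. \<tau> \<in> T"
          by (rule AE_lebesgue_on_subset[OF _ J stJ T_AE[unfolded M_def]]) simp
        then show ?thesis by eventually_elim (simp add: E[OF _ r])
      qed
      have m: "(\<lambda>\<tau>. Re (\<psi>' True \<tau> ?v - \<psi>' False \<tau> ?v)) \<in> borel_measurable ?L"
        by (intro borel_measurable_integrable integrable_Re Bochner_Integration.integrable_diff F(2))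
      show ?thesis
        by (rule integral_cong_AE[OF m complete_measure.borel_measurable_AE_cong[OF complete_measure_lebesgue_on m ae] ae]) simp
    qed
    finally show ?thesis .
  qed
  have "\<bar>\<Phi> \<beta> \<beta> - \<Phi> \<alpha> \<alpha>\<bar> \<le> ?K * S * (\<beta> - \<alpha>)"
  proof (rule diagonal_lipschitz[OF \<alpha>\<beta>(1) \<Phi>c _ Em[unfolded M_def] EC EK])
    show "\<Phi> s r = \<Phi> r s" for s r unfolding \<Phi>_def by (rule embed_cnj_sym)
    show "AE r in lebesgue_on ?J. \<forall>s\<in>?J. \<forall>t\<in>{s..\<beta>}. \<Phi> t r - \<Phi> s r = (\<integral>x. E x r \<partial>lebesgue_on {s..t})"
      using T_AE[unfolded M_def] by eventually_elim (use ftc in blast)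
  qed
  moreover have "\<Phi> t t = (L2_norm (\<lambda>x. \<psi>c True t x - \<psi>c False t x))\<^sup>2" if "t \<in> ?J" for t
    using embed_cnj_self[OF wL2] that sub unfolding \<Phi>_def w_def[abs_def] by blast
  ultimately show ?thesis using \<alpha>\<beta>(1) by simp
qed

section \<open>From the interior of the time interval to uniqueness\<close>

text \<open>Weak time derivatives are tested only in the interior of \<open>I\<close>, so the energy
  inequality misses its endpoints, one of which may be the initial time. Continuity supplies
  them.\<close>

lemma lipschitz_bound_to_boundary:
  fixes N :: "real \<Rightarrow> real"
  assumes cont: "continuous_on {x..y} N" and xy: "x < y"
    and lip: "\<And>\<alpha> \<beta>. x < \<alpha> \<Longrightarrow> \<alpha> < \<beta> \<Longrightarrow> \<beta> < y \<Longrightarrow> \<bar>N \<beta> - N \<alpha>\<bar> \<le> L * (\<beta> - \<alpha>)"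
  shows "\<bar>N y - N x\<bar> \<le> L * (y - x)"
proof -
  \<comment> \<open>The summand 3 keeps the shift at most a third of the length, so the two shifted
    endpoints do not cross.\<close>
  define e where "e n = (y - x) / (real n + 3)" for n :: nat
  have e: "0 < e n" "e n \<le> (y - x) / 3" for n
  proof -
    show "0 < e n" using xy by (simp add: e_def)
    show "e n \<le> (y - x) / 3" unfolding e_def by (rule divide_left_mono) (use xy in auto)
  qed
  have elim: "e \<longlonglongrightarrow> 0"
  proof (rule Lim_null_comparison)
    show "(\<lambda>n. (y - x) * inverse (real (Suc n))) \<longlonglongrightarrow> 0"
      using tendsto_mult_left[OF LIMSEQ_inverse_real_of_nat, of "y - x"] by simp
    show "\<forall>\<^sub>F n in sequentially. norm (e n) \<le> (y - x) * inverse (real (Suc n))"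
      using xy by (intro always_eventually allI) (simp add: e_def divide_inverse[symmetric] frac_le)
  qed
  have l: "(\<lambda>n. N (x + e n)) \<longlonglongrightarrow> N x"
  proof (rule continuous_on_tendsto_compose[OF cont])
    show "(\<lambda>n. x + e n) \<longlonglongrightarrow> x" using tendsto_add[OF tendsto_const elim, of x] by simp
    have "x + e n \<in> {x..y}" for n using e[of n] xy by simp
    then show "\<forall>\<^sub>F n in sequentially. x + e n \<in> {x..y}" by simp
  qed (use xy in auto)
  have r: "(\<lambda>n. N (y - e n)) \<longlonglongrightarrow> N y"
  proof (rule continuous_on_tendsto_compose[OF cont])
    show "(\<lambda>n. y - e n) \<longlonglongrightarrow> y" using tendsto_diff[OF tendsto_const elim, of y] by simp
    have "y - e n \<in> {x..y}" for n using e[of n] xy by simp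
    then show "\<forall>\<^sub>F n in sequentially. y - e n \<in> {x..y}" by simp
  qed (use xy in auto)
  have "(\<lambda>n. \<bar>N (y - e n) - N (x + e n)\<bar>) \<longlonglongrightarrow> \<bar>N y - N x\<bar>"
    by (intro tendsto_intros l r)
  moreover have "(\<lambda>n. L * ((y - e n) - (x + e n))) \<longlonglongrightarrow> L * ((y - 0) - (x + 0))"
    by (intro tendsto_intros elim)
  moreover have "\<bar>N (y - e n) - N (x + e n)\<bar> \<le> L * ((y - e n) - (x + e n))" for n
    using e[of n] xy by (intro lip) auto
  ultimately have "\<bar>N y - N x\<bar> \<le> L * ((y - 0) - (x + 0))"
    by (intro LIMSEQ_le[of "\<lambda>n. \<bar>N (y - e n) - N (x + e n)\<bar>" _ "\<lambda>n. L * ((y - e n) - (x + e n))"]) auto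
  then show ?thesis by simp
qed

text \<open>The Gronwall argument runs forward in time from 0. Since the hypothesis bounds the
  absolute value of the increment, it is invariant under time reversal.\<close>

lemma zero_on_interval:
  fixes N :: "real \<Rightarrow> real"
  assumes I: "is_interval I" "0 \<in> I" and c: "c \<ge> 0"
    and cont: "continuous_on I N" and pos: "\<And>t. N t \<ge> 0" and zero: "N 0 = 0"
    and lip: "\<And>\<alpha> \<beta> S. \<alpha> < \<beta> \<Longrightarrow> {\<alpha>..\<beta>} \<subseteq> interior I \<Longrightarrow> (\<And>t. t \<in> {\<alpha>..\<beta>} \<Longrightarrow> N t \<le> S) \<Longrightarrow>
      \<bar>N \<beta> - N \<alpha>\<bar> \<le> c * S * (\<beta> - \<alpha>)"
    and t: "t \<in> I"
  shows "N t = 0"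
proof -
  have sub: "{x..y} \<subseteq> I" if "x \<in> I" "y \<in> I" for x y
  proof
    fix z assume "z \<in> {x..y}"
    then show "z \<in> I" by (intro mem_is_interval_1_I[OF I(1) that]) simp_all
  qed
  have lip': "\<bar>N y - N x\<bar> \<le> c * S * (y - x)"
    if xy: "x < y" "x \<in> I" "y \<in> I" and S: "\<And>t. t \<in> {x..y} \<Longrightarrow> N t \<le> S" for x y S
  proof (rule lipschitz_bound_to_boundary[OF continuous_on_subset[OF cont sub[OF xy(2,3)]] xy(1)])
    fix \<alpha> \<beta> assume ab: "x < \<alpha>" "\<alpha> < \<beta>" "\<beta> < y"
    have "{x<..<y} \<subseteq> {x..y}" by (rule greaterThanLessThan_subseteq_atLeastAtMost_iff[THEN iffD2]) simp
    then have "{x<..<y} \<subseteq> interior I"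
      using sub[OF xy(2,3)] by (intro interior_maximal) simp_all
    moreover have "{\<alpha>..\<beta>} \<subseteq> {x<..<y}" using ab by (intro subsetI) simp
    ultimately have "{\<alpha>..\<beta>} \<subseteq> interior I" by simp
    then show "\<bar>N \<beta> - N \<alpha>\<bar> \<le> c * S * (\<beta> - \<alpha>)"
      using ab by (intro lip S) auto
  qed
  show ?thesis
  proof (cases "t \<ge> 0")
    case True
    show ?thesis
    proof (rule gronwall_zero[where a=0 and b=t and N=N and c=c])
      show "continuous_on {0..t} N" by (rule continuous_on_subset[OF cont sub[OF I(2) t]])
      show "\<bar>N y - N x\<bar> \<le> c * S * (y - x)"
        if "0 \<le> x" "x < y" "y \<le> t" "\<And>t. t \<in> {x..y} \<Longrightarrow> N t \<le> S" for x y S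
        by (rule lip'[OF that(2) _ _ that(4)]) (use that(1-3) sub[OF I(2) t] in auto)
    qed (use c pos zero True in auto)
  next
    case False
    \<comment> \<open>Negative times are reached by applying the forward argument to the reflected
      function.\<close>
    have "N (- (- t)) = 0"
    proof (rule gronwall_zero[where a=0 and b="- t" and N="\<lambda>x. N (- x)" and c=c])
      show "continuous_on {0..- t} (\<lambda>x. N (- x))"
        by (rule continuous_on_compose2[OF cont]) (use sub[OF t I(2)] in \<open>auto intro!: continuous_intros\<close>)
      show "\<bar>N (- y) - N (- x)\<bar> \<le> c * S * (y - x)"
        if "0 \<le> x" "x < y" "y \<le> - t" "\<And>t. t \<in> {x..y} \<Longrightarrow> N (- t) \<le> S" for x y S
      proof -
        have "N s \<le> S" if "s \<in> {- y..- x}" for s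
          using that \<open>\<And>t. t \<in> {x..y} \<Longrightarrow> N (- t) \<le> S\<close>[of "- s"] by auto
        then have "\<bar>N (- x) - N (- y)\<bar> \<le> c * S * (- x - - y)"
          by (intro lip') (use that(1-3) sub[OF t I(2)] in auto)
        then show ?thesis by (simp add: abs_minus_commute)
      qed
    qed (use c pos zero False in auto)
    then show ?thesis by simp
  qed
qed

lemma weak_solutionE:
  assumes "weak_solution hbar m G I \<phi> \<psi>"
  obtains \<psi>' \<psi>c R R' where
    "strongly_measurable I W12 W12_norm \<psi>" "AE t in lebesgue_on I. W12_norm (\<psi> t) \<le> R"
    "strongly_measurable I W12_dual W12_dual_norm \<psi>'" "AE t in lebesgue_on I. W12_dual_norm (\<psi>' t) \<le> R'"
    "has_weak_time_derivative I W12_dual W12_dual_norm (\<lambda>t. embed (\<psi> t)) \<psi>'"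
    "AE t in lebesgue_on I. solves_equation (hbar / (2 * m)) (4 * pi * (G * m\<^sup>2 / hbar)) (\<psi> t) (\<psi>' t)"
    "continuous_L2 I \<psi>c" "AE s in lebesgue_on I. AE x in lebesgue. \<psi>c s x = \<psi> s x"
    "AE x in lebesgue. \<psi>c 0 x = \<phi> x"
proof -
  from assms obtain \<psi>' where
    L: "\<psi> \<in> Linfinity I W12 W12_norm"
    and W: "has_W1infinity_derivative I W12_dual W12_dual_norm (\<lambda>t. embed (\<psi> t)) \<psi>'"
    and E: "AE t in lebesgue_on I. solves_equation (hbar / (2 * m)) (4 * pi * (G * m\<^sup>2 / hbar)) (\<psi> t) (\<psi>' t)"
    and V: "has_value_at I \<psi> 0 \<phi>"
    unfolding weak_solution_def solves_equation_def by blast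
  obtain R where R: "strongly_measurable I W12 W12_norm \<psi>" "AE t in lebesgue_on I. W12_norm (\<psi> t) \<le> R"
    using L unfolding Linfinity_def by blast
  obtain R' where R': "strongly_measurable I W12_dual W12_dual_norm \<psi>'" "AE t in lebesgue_on I. W12_dual_norm (\<psi>' t) \<le> R'"
    using W unfolding has_W1infinity_derivative_def Linfinity_def by blast
  have wd: "has_weak_time_derivative I W12_dual W12_dual_norm (\<lambda>t. embed (\<psi> t)) \<psi>'"
    using W unfolding has_W1infinity_derivative_def by blast
  obtain \<psi>c where c: "continuous_L2 I \<psi>c" "AE s in lebesgue_on I. AE x in lebesgue. \<psi>c s x = \<psi> s x"
    "AE x in lebesgue. \<psi>c 0 x = \<phi> x"
    using V unfolding has_value_at_def by blast
  show thesis by (rule that[OF R R' wd E c])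
qed

theorem mainTheorem2:
  fixes hbar m G :: real and I :: "real set"
    and \<phi> :: "real^3 \<Rightarrow> complex" and \<psi>1 \<psi>2 :: "real \<Rightarrow> real^3 \<Rightarrow> complex"
  assumes "hbar > 0" and "m > 0" and "G > 0"
    and "is_interval I" and "0 \<in> I"
    and "\<phi> \<in> W12"
    and "weak_solution hbar m G I \<phi> \<psi>1"
    and "weak_solution hbar m G I \<phi> \<psi>2"
  shows "AE t in lebesgue_on I. AE x in lebesgue. \<psi>1 t x = \<psi>2 t x"
proof -
  define a b where "a = hbar / (2 * m)" and "b = 4 * pi * (G * m\<^sup>2 / hbar)"
  have I: "I \<in> sets lebesgue"
    using real_interval_borel_measurable[OF assms(4)] by (simp add: sets_completionI_sets)
  obtain \<psi>1' c1 R1 R1' where s1: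
    "strongly_measurable I W12 W12_norm \<psi>1" "AE t in lebesgue_on I. W12_norm (\<psi>1 t) \<le> R1"
    "strongly_measurable I W12_dual W12_dual_norm \<psi>1'" "AE t in lebesgue_on I. W12_dual_norm (\<psi>1' t) \<le> R1'"
    "has_weak_time_derivative I W12_dual W12_dual_norm (\<lambda>t. embed (\<psi>1 t)) \<psi>1'"
    "AE t in lebesgue_on I. solves_equation a b (\<psi>1 t) (\<psi>1' t)"
    "continuous_L2 I c1" "AE s in lebesgue_on I. AE x in lebesgue. c1 s x = \<psi>1 s x"
    "AE x in lebesgue. c1 0 x = \<phi> x"
    unfolding a_def b_def by (rule weak_solutionE[OF assms(7)])
  obtain \<psi>2' c2 R2 R2' where s2:
    "strongly_measurable I W12 W12_norm \<psi>2" "AE t in lebesgue_on I. W12_norm (\<psi>2 t) \<le> R2"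
    "strongly_measurable I W12_dual W12_dual_norm \<psi>2'" "AE t in lebesgue_on I. W12_dual_norm (\<psi>2' t) \<le> R2'"
    "has_weak_time_derivative I W12_dual W12_dual_norm (\<lambda>t. embed (\<psi>2 t)) \<psi>2'"
    "AE t in lebesgue_on I. solves_equation a b (\<psi>2 t) (\<psi>2' t)"
    "continuous_L2 I c2" "AE s in lebesgue_on I. AE x in lebesgue. c2 s x = \<psi>2 s x"
    "AE x in lebesgue. c2 0 x = \<phi> x"
    unfolding a_def b_def by (rule weak_solutionE[OF assms(8)])
  \<comment> \<open>One pair of bounds for both solutions; the 0 in the second maximum provides the
    sign needed when products of bounds are estimated.\<close>
  define R R' where "R = max R1 R2" and "R' = max (max R1' R2') 0"
  have bd1: "AE t in lebesgue_on I. W12_norm (\<psi>1 t) \<le> R" and bd2: "AE t in lebesgue_on I. W12_norm (\<psi>2 t) \<le> R"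
    using s1(2) s2(2) by (auto simp: R_def elim: eventually_mono)
  have bd1': "AE t in lebesgue_on I. W12_dual_norm (\<psi>1' t) \<le> R'" and bd2': "AE t in lebesgue_on I. W12_dual_norm (\<psi>2' t) \<le> R'"
    using s1(4) s2(4) by (auto simp: R'_def elim: eventually_mono)
  define N where "N t = (L2_norm (\<lambda>x. c1 t x - c2 t x))\<^sup>2" for t
  define c where "c = 2 * \<bar>b\<bar> * (9 * R\<^sup>2 + 15 * R ^ 4)"
  have c0: "c \<ge> 0" unfolding c_def by (intro mult_nonneg_nonneg add_nonneg_nonneg) auto
  have w: "continuous_L2 I (\<lambda>t x. c1 t x - c2 t x)" by (rule continuous_L2_diff[OF s1(7) s2(7)])
  then have wL2: "(\<lambda>x. c1 t x - c2 t x) \<in> L2" if "t \<in> I" for t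
    using that by (simp add: continuous_L2_def)
  have N_inner: "N t = Re (embed (\<lambda>x. c1 t x - c2 t x) (\<lambda>x. cnj (c1 t x - c2 t x)))" if "t \<in> I" for t
    unfolding N_def by (rule embed_cnj_self[OF wL2[OF that], symmetric])
  have N_cont: "continuous_on I N"
  proof -
    have "continuous_on I (\<lambda>t. Re (embed (\<lambda>x. c1 t x - c2 t x) (\<lambda>x. cnj (c1 t x - c2 t x))))"
      using continuous_on_compose2[OF continuous_L2_inner[OF w], of I "\<lambda>t. (t, t)"]
      by (force intro: continuous_intros)
    then show ?thesis
      by (rule continuous_on_eq) (simp only: N_inner)
  qed
  have N0: "N 0 = 0"
  proof -
    have "AE x in lebesgue. (0 :: complex) = c1 0 x - c2 0 x"
      using s1(9) s2(9) by eventually_elim simp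
    then have "L2_norm (\<lambda>x. c1 0 x - c2 0 x) = L2_norm (\<lambda>x. 0 :: complex)"
      by (rule L2_AE_cong(2)) (simp add: L2_def)
    then show ?thesis by (simp add: N_def L2_norm_def)
  qed
  have N_zero: "N t = 0" if "t \<in> I" for t
  proof (rule zero_on_interval[OF assms(4,5) c0 N_cont _ N0 _ that])
    show "N t \<ge> 0" for t by (simp add: N_def)
    fix \<alpha> \<beta> S assume ab: "\<alpha> < \<beta>" "{\<alpha>..\<beta>} \<subseteq> interior I" and S: "\<And>t. t \<in> {\<alpha>..\<beta>} \<Longrightarrow> N t \<le> S"
    \<comment> \<open>The two solutions are packed into families indexed by truth values, the form
      in which the energy inequality states each hypothesis once.\<close>
    define \<psi> \<psi>' \<psi>c where "\<psi> i = (if i then \<psi>1 else \<psi>2)" and "\<psi>' i = (if i then \<psi>1' else \<psi>2')"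
      and "\<psi>c i = (if i then c1 else c2)" for i
    note defs = \<psi>_def \<psi>'_def \<psi>c_def
    have "\<bar>(L2_norm (\<lambda>x. \<psi>c True \<beta> x - \<psi>c False \<beta> x))\<^sup>2 - (L2_norm (\<lambda>x. \<psi>c True \<alpha> x - \<psi>c False \<alpha> x))\<^sup>2\<bar>
        \<le> 2 * \<bar>b\<bar> * (9 * R\<^sup>2 + 15 * R ^ 4) * S * (\<beta> - \<alpha>)"
    proof (rule energy_inequality[OF I _ _ _ _ _ _ _ _ _ ab, where \<psi>=\<psi> and \<psi>'=\<psi>' and R'=R' and a=a])
      fix i
      show "strongly_measurable I W12 W12_norm (\<psi> i)" using s1(1) s2(1) by (cases i) (simp_all add: defs)
      show "AE t in lebesgue_on I. W12_norm (\<psi> i t) \<le> R" using bd1 bd2 by (cases i) (simp_all add: defs)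
      show "strongly_measurable I W12_dual W12_dual_norm (\<psi>' i)" using s1(3) s2(3) by (cases i) (simp_all add: defs)
      show "AE t in lebesgue_on I. W12_dual_norm (\<psi>' i t) \<le> R'" using bd1' bd2' by (cases i) (simp_all add: defs)
      show "has_weak_time_derivative I W12_dual W12_dual_norm (\<lambda>t. embed (\<psi> i t)) (\<psi>' i)"
        using s1(5) s2(5) by (cases i) (simp_all add: defs)
      show "AE t in lebesgue_on I. solves_equation a b (\<psi> i t) (\<psi>' i t)"
        using s1(6) s2(6) by (cases i) (simp_all only: defs if_True if_False)
      show "continuous_L2 I (\<psi>c i)" using s1(7) s2(7) by (cases i) (simp_all add: defs)
      show "AE s in lebesgue_on I. AE x in lebesgue. \<psi>c i s x = \<psi> i s x"
        using s1(8) s2(8) by (cases i) (simp_all add: defs)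
    next
      show "0 \<le> R'" by (simp add: R'_def)
      show "(L2_norm (\<lambda>x. \<psi>c True t x - \<psi>c False t x))\<^sup>2 \<le> S" if "t \<in> {\<alpha>..\<beta>}" for t
        using S[OF that] by (simp add: N_def defs)
    qed
    then show "\<bar>N \<beta> - N \<alpha>\<bar> \<le> c * S * (\<beta> - \<alpha>)"
      by (simp add: N_def c_def defs)
  qed
  have zero: "AE x in lebesgue. c1 t x = c2 t x" if "t \<in> I" for t
  proof -
    have "(\<integral>x. (norm (c1 t x - c2 t x))\<^sup>2 \<partial>lebesgue) = 0"
      using N_zero[OF that] unfolding N_def L2_norm_square .
    then have "AE x in lebesgue. (norm (c1 t x - c2 t x))\<^sup>2 = 0"
      using integral_nonneg_eq_0_iff_AE[OF L2D(2)[OF wL2[OF that]]] by simp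
    then show ?thesis by eventually_elim simp
  qed
  \<comment> \<open>The continuous representatives agree at every time of \<open>I\<close>; the
    given solutions equal them for almost every time, and the conclusion passes back.\<close>
  have "AE t in lebesgue_on I. t \<in> I" by (rule AE_I2) simp
  then show ?thesis
    using s1(8) s2(8)
  proof eventually_elim
    case (elim t)
    show ?case
      using zero[OF elim(1)] elim(2,3) by eventually_elim simp
  qed
qed

end
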